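(* Let $R(A,P_0)$ be a trinomial algebra of type 2 (with $r\ge2$). (a) Let $\delta=\frac{\partial}{\partial S_p}$ for some $1\le p\le m$. Then an element $h\in R(A,P_0)$ is a $K_0$-homogeneous element of $\ker\delta$ if and only if $$h=F(T_1^{l_1},T_2^{l_2})\prod_{i,j}T_{ij}^{b_{ij}}\prod_{k\ne p}S_k^{d_k}$$ for some $b_{ij},d_k\in\mathbb Z_{\ge0}$ and some homogeneous polynomial $F$ in two variables over $\mathbb K$. (b) Let $\delta=\delta_{C,\beta}$ (for a pair $(C,\beta)$ for which $\delta_{C,\beta}$ is defined). Then $h\in R(A,P_0)$ is a $K_0$-homogeneous element of $\ker\delta$ if and only if $$h=\alpha(\beta_2T_1^{l_1}-\beta_1T_2^{l_2})^{s}\prod_{T_{ij}\in\ker\delta}T_{ij}^{b_{ij}}\prod_kS_k^{d_k}$$ for some $s,b_{ij},d_k\in\mathbb Z_{\ge0}$ and $\alpha\in\mathbb K$.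
   Context: Ground field: $\mathbb K$ is an algebraically closed field of characteristic zero. Trinomial algebras of type 2: fix integers $r,n>0$, $m\ge 0$, a partition $n=n_0+\dots+n_r$ with $n_i>0$, and for each $i=0,\dots,r$ a tuple of positive integers $l_i=(l_{i1},\dots,l_{in_i})$. Put $T_i^{l_i}=T_{i1}^{l_{i1}}\cdots T_{in_i}^{l_{in_i}}$ in the polynomial ring $\mathbb K[T_{ij},S_k]$ ($0\le i\le r$, $1\le j\le n_i$, $1\le k\le m$). Let $A=(a_0,\dots,a_r)$ be a $2\times(r+1)$ matrix over $\mathbb K$ with pairwise linearly independent columns, and put $\mathfrak g_i=\det\begin{pmatrix}T_i^{l_i}&T_{i+1}^{l_{i+1}}&T_{i+2}^{l_{i+2}}\\ a_i&a_{i+1}&a_{i+2}\end{pmatrix}$ for $i=0,\dots,r-2$. Let $P_0$ be the integer $r\times(n+m)$ matrix (columns indexed by the variables $T_{ij}$, then $S_k$) whose $i$-th row ($1\le i\le r$) has $-l_0$ in the block of $T_{01},\dots,T_{0n_0}$, $l_i$ in the block of $T_{i1},\dots,T_{in_i}$, and $0$ elsewhere. The trinomial algebra is $R(A,P_0)=\mathbb K[T_{ij},S_k]/(\mathfrak g_0,\dots,\mathfrak g_{r-2})$. Let $K_0=\mathbb Z^{n+m}/\mathrm{im}(P_0^T)$ with quotient map $Q$, and let $v_{ij},v_k$ be the standard basis vectors of $\mathbb Z^{n+m}$. The $K_0$-grading of $R(A,P_0)$ is induced by $\deg T_{ij}=Q(v_{ij})$, $\deg S_k=Q(v_k)$. Derivations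 ($\mathbb K$-linear maps satisfying the Leibniz rule), given on generators and well defined on $R(A,P_0)$ (empty products equal 1): For $1\le p\le m$: $\frac{\partial}{\partial S_p}(T_{ij})=0$ for all $(i,j)$; $\frac{\partial}{\partial S_p}(S_k)=1$ if $k=p$ and $0$ if $k\ne p$. Let $\beta=(\beta_0,\dots,\beta_r)\in\mathbb K^{r+1}$ be a nonzero vector in the row space of $A$ (so at most one $\beta_i$ is zero). (2.1) If all $\beta_i\ne0$ and $C=(c_0,\dots,c_r)$ satisfies $1\le c_i\le n_i$ and $l_{ic_i}=1$ for all $i$ except at most one: $\delta_{C,\beta}(T_{ic_i})=\beta_i\prod_{k\ne i}\frac{\partial T_k^{l_k}}{\partial T_{kc_k}}$, $\delta_{C,\beta}(T_{ij})=0$ for $j\ne c_i$, $\delta_{C,\beta}(S_k)=0$ for all $k$. (2.2) If $\beta_{i_0}=0$ for exactly one $i_0$ and $C=(c_0,\dots,c_r)$ satisfies $1\le c_i\le n_i$ and $l_{ic_i}=1$ for all $i\ne i_0$ except at most one: $\delta_{C,\beta}(T_{ic_i})=\beta_i\prod_{k\ne i,i_0}\frac{\partial T_k^{l_k}}{\partial T_{kc_k}}$, $\delta_{C,\beta}(T_{ij})=0$ for $j\ne c_i$, $\delta_{C,\beta}(S_k)=0$ for all $k$. These derivations are locally nilpotent. The product over $T_{ij}\in\ker\delta$ runs over those pairs $(i,j)$ with $\delta(T_{ij})=0$. *)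

theory Defs
  imports
    "HOL-Library.Poly_Mapping"
    "HOL-Algebra.QuotRing"
    "HOL-Algebra.Free_Abelian_Groups"
    "Jordan_Normal_Form.VS_Connect"
begin

section \<open>Multivariate polynomials\<close>

text \<open>
  Polynomials with coefficients in \<open>'k\<close> and variables in \<open>'v\<close> are finitely supported functions
  from exponent vectors \<open>'v \<Rightarrow>\<^sub>0 nat\<close> to \<open>'k\<close>, with the convolution product.
\<close>

type_synonym ('v, 'k) mpoly = "('v \<Rightarrow>\<^sub>0 nat) \<Rightarrow>\<^sub>0 'k"

definition mvar :: "'v \<Rightarrow> ('v, 'k::comm_ring_1) mpoly" where
  "mvar v = Poly_Mapping.single (Poly_Mapping.single v 1) 1"

definition mconst :: "'k::comm_ring_1 \<Rightarrow> ('v, 'k) mpoly" where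
  "mconst c = Poly_Mapping.single 0 c"

definition mpderiv :: "'v \<Rightarrow> ('v, 'k::comm_ring_1) mpoly \<Rightarrow> ('v, 'k) mpoly" where
  "mpderiv v f = (\<Sum>\<mu>\<in>Poly_Mapping.keys f.
     Poly_Mapping.single (\<mu> - Poly_Mapping.single v 1)
       (of_nat (Poly_Mapping.lookup \<mu> v) * Poly_Mapping.lookup f \<mu>))"

definition msubst :: "('v \<Rightarrow> ('w, 'k::comm_ring_1) mpoly) \<Rightarrow> ('v, 'k) mpoly \<Rightarrow> ('w, 'k) mpoly" where
  "msubst g f = (\<Sum>\<mu>\<in>Poly_Mapping.keys f.
     mconst (Poly_Mapping.lookup f \<mu>) * (\<Prod>v\<in>Poly_Mapping.keys \<mu>. g v ^ Poly_Mapping.lookup \<mu> v))"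

definition mhomogeneous :: "('v, 'k::comm_ring_1) mpoly \<Rightarrow> bool" where
  "mhomogeneous f \<longleftrightarrow> (\<exists>d. \<forall>\<mu>\<in>Poly_Mapping.keys f.
     (\<Sum>v\<in>Poly_Mapping.keys \<mu>. Poly_Mapping.lookup \<mu> v) = d)"

definition mpoly_ring :: "'v set \<Rightarrow> ('v, 'k::comm_ring_1) mpoly ring" where
  "mpoly_ring V = \<lparr>carrier = {f. \<forall>\<mu>\<in>Poly_Mapping.keys f. Poly_Mapping.keys \<mu> \<subseteq> V},
     monoid.mult = (*), one = 1, ring.zero = 0, add = (+)\<rparr>"


section \<open>Trinomial algebras of type 2\<close>

text \<open>
  The defining data: \<open>tri_n D i\<close> is \<open>n_i\<close>, \<open>tri_l D i j\<close> is \<open>l_ij\<close>. Only the values for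
  \<open>i \<le> r\<close> and \<open>1 \<le> j \<le> n_i\<close> are relevant. Column \<open>a_i\<close> of the matrix is \<open>col (tri_A D) i\<close>;
  rows and columns are numbered from 0.
\<close>

record 'k trinomial_data =
  tri_r :: nat
  tri_n :: "nat \<Rightarrow> nat"
  tri_m :: nat
  tri_l :: "nat \<Rightarrow> nat \<Rightarrow> nat"
  tri_A :: "'k mat"

definition trinomial_data :: "'k::field trinomial_data \<Rightarrow> bool" where
  "trinomial_data D \<longleftrightarrow>
     tri_r D > 0 \<and>
     (\<forall>i\<le>tri_r D. tri_n D i > 0) \<and>
     (\<forall>i\<le>tri_r D. \<forall>j\<in>{1..tri_n D i}. tri_l D i j > 0) \<and>
     tri_A D \<in> carrier_mat 2 (tri_r D + 1) \<and>
     (\<forall>i\<le>tri_r D. \<forall>j\<le>tri_r D. i \<noteq> j \<longrightarrow>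
        (\<forall>x y. x \<cdot>\<^sub>v col (tri_A D) i + y \<cdot>\<^sub>v col (tri_A D) j = 0\<^sub>v 2 \<longrightarrow> x = 0 \<and> y = 0))"

datatype tvar = TV nat nat | SV nat

definition tri_indices :: "'k trinomial_data \<Rightarrow> (nat \<times> nat) set" where
  "tri_indices D = (SIGMA i:{0..tri_r D}. {1..tri_n D i})"

definition tri_vars :: "'k trinomial_data \<Rightarrow> tvar set" where
  "tri_vars D = (\<lambda>(i, j). TV i j) ` tri_indices D \<union> SV ` {1..tri_m D}"

abbreviation tri_poly_ring :: "'k::field trinomial_data \<Rightarrow> (tvar, 'k) mpoly ring" where
  "tri_poly_ring D \<equiv> mpoly_ring (tri_vars D)"

definition tri_mon :: "'k::field trinomial_data \<Rightarrow> nat \<Rightarrow> (tvar, 'k) mpoly" where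
  "tri_mon D i = (\<Prod>j=1..tri_n D i. mvar (TV i j) ^ tri_l D i j)"

definition tri_rel :: "'k::field trinomial_data \<Rightarrow> nat \<Rightarrow> (tvar, 'k) mpoly" where
  "tri_rel D i = det (mat_of_rows_list 3
     [[tri_mon D i, tri_mon D (i + 1), tri_mon D (i + 2)],
      [mconst (tri_A D $$ (0, i)), mconst (tri_A D $$ (0, i + 1)), mconst (tri_A D $$ (0, i + 2))],
      [mconst (tri_A D $$ (1, i)), mconst (tri_A D $$ (1, i + 1)), mconst (tri_A D $$ (1, i + 2))]])"

definition tri_ideal :: "'k::field trinomial_data \<Rightarrow> (tvar, 'k) mpoly set" where
  "tri_ideal D = Idl\<^bsub>tri_poly_ring D\<^esub> {tri_rel D i | i. i + 2 \<le> tri_r D}"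

definition tri_alg :: "'k::field trinomial_data \<Rightarrow> (tvar, 'k) mpoly set ring" where
  "tri_alg D = tri_poly_ring D Quot tri_ideal D"

text \<open>The element of the trinomial algebra represented by a polynomial.\<close>

definition tri_cls :: "'k::field trinomial_data \<Rightarrow> (tvar, 'k) mpoly \<Rightarrow> (tvar, 'k) mpoly set" where
  "tri_cls D f = tri_ideal D +>\<^bsub>tri_poly_ring D\<^esub> f"


section \<open>The grading\<close>

text \<open>
  The columns of \<open>P_0\<close> are indexed by the variables, so \<open>\<int>\<^bsup>n+m\<^esup>\<close> is the free abelian group on
  \<open>tri_vars D\<close>. Rows are indexed by \<open>1, \<dots>, r\<close>.
\<close>

definition tri_P0 :: "'k trinomial_data \<Rightarrow> nat \<Rightarrow> tvar \<Rightarrow> int" where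
  "tri_P0 D i v = (case v of
      TV k j \<Rightarrow> if k = 0 then - int (tri_l D 0 j) else if k = i then int (tri_l D i j) else 0
    | SV k \<Rightarrow> 0)"

abbreviation tri_Z :: "'k trinomial_data \<Rightarrow> (tvar \<Rightarrow>\<^sub>0 int) monoid" where
  "tri_Z D \<equiv> free_Abelian_group (tri_vars D)"

definition tri_im_P0T :: "'k trinomial_data \<Rightarrow> (tvar \<Rightarrow>\<^sub>0 int) set" where
  "tri_im_P0T D = {w \<in> carrier (tri_Z D). \<exists>u :: nat \<Rightarrow> int.
     \<forall>v\<in>tri_vars D. Poly_Mapping.lookup w v = (\<Sum>i=1..tri_r D. tri_P0 D i v * u i)}"

definition tri_K0 :: "'k trinomial_data \<Rightarrow> (tvar \<Rightarrow>\<^sub>0 int) set monoid" where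
  "tri_K0 D = tri_Z D Mod tri_im_P0T D"

definition tri_Q :: "'k trinomial_data \<Rightarrow> (tvar \<Rightarrow>\<^sub>0 int) \<Rightarrow> (tvar \<Rightarrow>\<^sub>0 int) set" where
  "tri_Q D w = tri_im_P0T D #>\<^bsub>tri_Z D\<^esub> w"

text \<open>The degree of the monomial with exponent vector \<open>\<mu>\<close>.\<close>

definition tri_deg :: "'k trinomial_data \<Rightarrow> (tvar \<Rightarrow>\<^sub>0 nat) \<Rightarrow> (tvar \<Rightarrow>\<^sub>0 int) set" where
  "tri_deg D \<mu> = tri_Q D (\<Sum>v\<in>Poly_Mapping.keys \<mu>. frag_cmul (int (Poly_Mapping.lookup \<mu> v)) (frag_of v))"

definition tri_component ::
  "'k::field trinomial_data \<Rightarrow> (tvar \<Rightarrow>\<^sub>0 int) set \<Rightarrow> (tvar, 'k) mpoly set set" where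
  "tri_component D w =
     tri_cls D ` {f \<in> carrier (tri_poly_ring D). \<forall>\<mu>\<in>Poly_Mapping.keys f. tri_deg D \<mu> = w}"

text \<open>In particular 0 is homogeneous.\<close>

definition tri_homogeneous :: "'k::field trinomial_data \<Rightarrow> (tvar, 'k) mpoly set \<Rightarrow> bool" where
  "tri_homogeneous D h \<longleftrightarrow> (\<exists>w\<in>carrier (tri_K0 D). h \<in> tri_component D w)"


section \<open>Derivations\<close>

definition tri_derivation ::
  "'k::field trinomial_data \<Rightarrow> ((tvar, 'k) mpoly set \<Rightarrow> (tvar, 'k) mpoly set) \<Rightarrow> bool" where
  "tri_derivation D \<delta> \<longleftrightarrow>
     \<delta> \<in> carrier (tri_alg D) \<rightarrow> carrier (tri_alg D) \<and>
     (\<forall>x\<in>carrier (tri_alg D). \<forall>y\<in>carrier (tri_alg D).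
        \<delta> (x \<oplus>\<^bsub>tri_alg D\<^esub> y) = \<delta> x \<oplus>\<^bsub>tri_alg D\<^esub> \<delta> y) \<and>
     (\<forall>a. \<forall>x\<in>carrier (tri_alg D).
        \<delta> (tri_cls D (mconst a) \<otimes>\<^bsub>tri_alg D\<^esub> x) = tri_cls D (mconst a) \<otimes>\<^bsub>tri_alg D\<^esub> \<delta> x) \<and>
     (\<forall>x\<in>carrier (tri_alg D). \<forall>y\<in>carrier (tri_alg D).
        \<delta> (x \<otimes>\<^bsub>tri_alg D\<^esub> y) = (\<delta> x \<otimes>\<^bsub>tri_alg D\<^esub> y) \<oplus>\<^bsub>tri_alg D\<^esub> (x \<otimes>\<^bsub>tri_alg D\<^esub> \<delta> y))"

definition tri_kernel ::
  "'k::field trinomial_data \<Rightarrow> ((tvar, 'k) mpoly set \<Rightarrow> (tvar, 'k) mpoly set) \<Rightarrow> (tvar, 'k) mpoly set set"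
  where "tri_kernel D \<delta> = {h \<in> carrier (tri_alg D). \<delta> h = \<zero>\<^bsub>tri_alg D\<^esub>}"

definition is_partial_S ::
  "'k::field trinomial_data \<Rightarrow> nat \<Rightarrow> ((tvar, 'k) mpoly set \<Rightarrow> (tvar, 'k) mpoly set) \<Rightarrow> bool" where
  "is_partial_S D p \<delta> \<longleftrightarrow> tri_derivation D \<delta> \<and>
     (\<forall>(i, j)\<in>tri_indices D. \<delta> (tri_cls D (mvar (TV i j))) = \<zero>\<^bsub>tri_alg D\<^esub>) \<and>
     (\<forall>k\<in>{1..tri_m D}. \<delta> (tri_cls D (mvar (SV k))) =
        (if k = p then \<one>\<^bsub>tri_alg D\<^esub> else \<zero>\<^bsub>tri_alg D\<^esub>))"

text \<open>
  \<open>tri_C D J C\<close>: \<open>1 \<le> c_i \<le> n_i\<close> for all \<open>i\<close>, and \<open>l_{i c_i} = 1\<close> for all \<open>i \<notin> J\<close> except at most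
  one. The set \<open>J\<close> of indices \<open>i\<close> with \<open>\<beta>_i = 0\<close> is empty in the first case and a singleton
  \<open>{i_0}\<close> in the second.
\<close>

definition tri_C :: "'k trinomial_data \<Rightarrow> nat set \<Rightarrow> (nat \<Rightarrow> nat) \<Rightarrow> bool" where
  "tri_C D J C \<longleftrightarrow> (\<forall>i\<le>tri_r D. C i \<in> {1..tri_n D i}) \<and>
     card {i \<in> {0..tri_r D} - J. tri_l D i (C i) \<noteq> 1} \<le> 1"

definition tri_delta_values ::
  "'k::field trinomial_data \<Rightarrow> nat set \<Rightarrow> (nat \<Rightarrow> nat) \<Rightarrow> 'k vec \<Rightarrow>
   ((tvar, 'k) mpoly set \<Rightarrow> (tvar, 'k) mpoly set) \<Rightarrow> bool" where
  "tri_delta_values D J C \<beta> \<delta> \<longleftrightarrow>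
     (\<forall>(i, j)\<in>tri_indices D. \<delta> (tri_cls D (mvar (TV i j))) =
        (if j = C i
         then tri_cls D (mconst (\<beta> $ i) *
                (\<Prod>k\<in>{0..tri_r D} - insert i J. mpderiv (TV k (C k)) (tri_mon D k)))
         else \<zero>\<^bsub>tri_alg D\<^esub>)) \<and>
     (\<forall>k\<in>{1..tri_m D}. \<delta> (tri_cls D (mvar (SV k))) = \<zero>\<^bsub>tri_alg D\<^esub>)"

text \<open>\<open>tri_beta D J \<beta>\<close>: \<open>\<beta>\<close> is a nonzero vector in the row space of \<open>A\<close>, and \<open>J\<close> is its zero set.\<close>

definition tri_beta :: "'k::field trinomial_data \<Rightarrow> nat set \<Rightarrow> 'k vec \<Rightarrow> bool" where
  "tri_beta D J \<beta> \<longleftrightarrow> \<beta> \<in> vec_space.row_space (tri_r D + 1) (tri_A D) \<and>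
     \<beta> \<noteq> 0\<^sub>v (tri_r D + 1) \<and> J = {i. i \<le> tri_r D \<and> \<beta> $ i = 0}"

definition is_delta ::
  "'k::field trinomial_data \<Rightarrow> (nat \<Rightarrow> nat) \<Rightarrow> 'k vec \<Rightarrow>
   ((tvar, 'k) mpoly set \<Rightarrow> (tvar, 'k) mpoly set) \<Rightarrow> bool" where
  "is_delta D C \<beta> \<delta> \<longleftrightarrow> tri_derivation D \<delta> \<and>
     (\<exists>J. (J = {} \<or> (\<exists>i0. J = {i0})) \<and> tri_beta D J \<beta> \<and> tri_C D J C \<and> tri_delta_values D J C \<beta> \<delta>)"


section \<open>Existence of the derivations\<close>

text \<open>
  The predicates \<open>is_partial_S\<close> and \<open>is_delta\<close> prescribe the values of a derivation on the
  generators. Such a derivation exists for every \<open>p\<close> and every admissible pair \<open>(C, \<beta>)\<close>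
  (lemmas \<open>partial_S_exists\<close> and \<open>delta_exists\<close> below), so these hypotheses are not vacuous.
\<close>

lemma lookup_mpderiv:
  "Poly_Mapping.lookup (mpderiv v f) \<mu> =
     of_nat (Poly_Mapping.lookup \<mu> v + 1) * Poly_Mapping.lookup f (\<mu> + Poly_Mapping.single v 1)"
proof -
  let ?e = "Poly_Mapping.single v (1::nat)"
  have eq: "(\<nu> - ?e = \<mu> \<and> Poly_Mapping.lookup \<nu> v \<noteq> 0) \<longleftrightarrow> \<nu> = \<mu> + ?e" for \<nu>
    by (auto simp: poly_mapping_eq_iff fun_eq_iff lookup_minus lookup_add lookup_single when_def split: if_splits)
  have "Poly_Mapping.lookup (mpderiv v f) \<mu> =
      (\<Sum>\<nu>\<in>Poly_Mapping.keys f. if \<nu> = \<mu> + ?e then of_nat (Poly_Mapping.lookup \<mu> v + 1) * Poly_Mapping.lookup f (\<mu> + ?e) else 0)"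
    unfolding mpderiv_def lookup_sum
  proof (rule sum.cong[OF refl])
    fix \<nu>
    show "Poly_Mapping.lookup (Poly_Mapping.single (\<nu> - ?e) (of_nat (Poly_Mapping.lookup \<nu> v) * Poly_Mapping.lookup f \<nu>)) \<mu>
       = (if \<nu> = \<mu> + ?e then of_nat (Poly_Mapping.lookup \<mu> v + 1) * Poly_Mapping.lookup f (\<mu> + ?e) else 0)"
      using eq[of \<nu>]
      by (cases "Poly_Mapping.lookup \<nu> v = 0") (auto simp: lookup_single when_def lookup_add)
  qed
  also have "\<dots> = of_nat (Poly_Mapping.lookup \<mu> v + 1) * Poly_Mapping.lookup f (\<mu> + ?e)"
    by (auto simp: sum.delta in_keys_iff)
  finally show ?thesis .
qed

lemma mpderiv_add: "mpderiv v (f + g) = mpderiv v f + mpderiv v g"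
  by (rule poly_mapping_eqI) (simp add: lookup_mpderiv lookup_add algebra_simps)

lemma mpderiv_zero [simp]: "mpderiv v 0 = 0"
  by (simp add: mpderiv_def)

lemma mpderiv_sum: "mpderiv v (\<Sum>x\<in>S. f x) = (\<Sum>x\<in>S. mpderiv v (f x))"
  by (induction S rule: infinite_finite_induct) (auto simp: mpderiv_add)

lemma mpderiv_single:
  "mpderiv v (Poly_Mapping.single \<mu> c) =
     Poly_Mapping.single (\<mu> - Poly_Mapping.single v 1) (of_nat (Poly_Mapping.lookup \<mu> v) * c)"
  by (cases "c = 0") (auto simp: mpderiv_def)

lemma mpoly_expand: "(f::('v, 'k::comm_ring_1) mpoly) =
   (\<Sum>\<mu>\<in>Poly_Mapping.keys f. Poly_Mapping.single \<mu> (Poly_Mapping.lookup f \<mu>))"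
  by (rule poly_mapping_eqI) (auto simp: lookup_sum lookup_single when_def sum.delta in_keys_iff)

lemma mpderiv_mult_single:
  fixes a b :: "'k::comm_ring_1"
  shows "mpderiv v (Poly_Mapping.single \<mu> a * Poly_Mapping.single \<nu> b) =
     mpderiv v (Poly_Mapping.single \<mu> a) * Poly_Mapping.single \<nu> b + Poly_Mapping.single \<mu> a * mpderiv v (Poly_Mapping.single \<nu> b)"
proof -
  let ?e = "Poly_Mapping.single v (1::nat)"
  have 1: "\<mu> - ?e + \<nu> = \<mu> + \<nu> - ?e" if "Poly_Mapping.lookup \<mu> v \<noteq> 0"
    using that by (intro poly_mapping_eqI) (auto simp: lookup_minus lookup_add lookup_single when_def)
  have 2: "\<mu> + (\<nu> - ?e) = \<mu> + \<nu> - ?e" if "Poly_Mapping.lookup \<nu> v \<noteq> 0"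
    using that by (intro poly_mapping_eqI) (auto simp: lookup_minus lookup_add lookup_single when_def)
  show ?thesis
    using 1 2
    by (cases "Poly_Mapping.lookup \<mu> v = 0"; cases "Poly_Mapping.lookup \<nu> v = 0")
       (auto simp: mult_single mpderiv_single lookup_add algebra_simps simp flip: single_add)
qed

lemma mpderiv_mult: "mpderiv v (f * g) = mpderiv v f * g + f * mpderiv v g"
proof -
  let ?s = "\<lambda>f \<mu>. Poly_Mapping.single \<mu> (Poly_Mapping.lookup f \<mu>)"
  let ?K = Poly_Mapping.keys
  have L: "mpderiv v (Poly_Mapping.single \<mu> a * g) =
      mpderiv v (Poly_Mapping.single \<mu> a) * g + Poly_Mapping.single \<mu> a * mpderiv v g" for \<mu> a
  proof -
    have "mpderiv v (Poly_Mapping.single \<mu> a * (\<Sum>\<nu>\<in>?K g. ?s g \<nu>)) =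
      mpderiv v (Poly_Mapping.single \<mu> a) * (\<Sum>\<nu>\<in>?K g. ?s g \<nu>) + Poly_Mapping.single \<mu> a * mpderiv v (\<Sum>\<nu>\<in>?K g. ?s g \<nu>)"
      by (simp add: sum_distrib_left mpderiv_sum mpderiv_mult_single sum.distrib)
    then show ?thesis using mpoly_expand[of g] by simp
  qed
  have "mpderiv v ((\<Sum>\<mu>\<in>?K f. ?s f \<mu>) * g) =
      mpderiv v (\<Sum>\<mu>\<in>?K f. ?s f \<mu>) * g + (\<Sum>\<mu>\<in>?K f. ?s f \<mu>) * mpderiv v g"
    by (simp add: sum_distrib_right mpderiv_sum L sum.distrib)
  then show ?thesis using mpoly_expand[of f] by simp
qed

lemma mpderiv_mconst [simp]: "mpderiv v (mconst c) = 0"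
  by (simp add: mconst_def mpderiv_single)

lemma mpderiv_mvar: "mpderiv v (mvar w) = (if v = w then 1 else 0)"
  by (auto simp: mvar_def mpderiv_single lookup_single when_def)

lemma mpderiv_eq_0:
  assumes "f \<in> carrier (mpoly_ring V)" "v \<notin> V"
  shows "mpderiv v f = 0"
  unfolding mpderiv_def
proof (rule sum.neutral, rule ballI)
  fix \<mu> assume "\<mu> \<in> Poly_Mapping.keys f"
  then have "Poly_Mapping.lookup \<mu> v = 0"
    using assms by (auto simp: mpoly_ring_def in_keys_iff subset_iff)
  then show "Poly_Mapping.single (\<mu> - Poly_Mapping.single v 1)
       (of_nat (Poly_Mapping.lookup \<mu> v) * Poly_Mapping.lookup f \<mu>) = 0"
    by simp
qed

lemma mpoly_ring_simps:
  "\<zero>\<^bsub>mpoly_ring V\<^esub> = 0" "\<one>\<^bsub>mpoly_ring V\<^esub> = 1"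
  "x \<oplus>\<^bsub>mpoly_ring V\<^esub> y = x + y" "x \<otimes>\<^bsub>mpoly_ring V\<^esub> y = x * y"
  by (simp_all add: mpoly_ring_def)

lemma cring_mpoly_ring: "cring (mpoly_ring V :: ('v, 'k::comm_ring_1) mpoly ring)"
proof -
  let ?R = "mpoly_ring V :: ('v, 'k) mpoly ring"
  have plus: "x + y \<in> carrier ?R" if "x \<in> carrier ?R" "y \<in> carrier ?R" for x y
    using that keys_add[of x y] by (auto simp: mpoly_ring_def)
  have times: "x * y \<in> carrier ?R" if "x \<in> carrier ?R" "y \<in> carrier ?R" for x y
  proof -
    have "Poly_Mapping.keys \<mu> \<subseteq> V" if m: "\<mu> \<in> Poly_Mapping.keys (x * y)" for \<mu>
    proof -
      obtain a b where "\<mu> = a + b" "a \<in> Poly_Mapping.keys x" "b \<in> Poly_Mapping.keys y"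
        using m keys_mult[of x y] by auto
      then show ?thesis
        using keys_add[of a b] \<open>x \<in> carrier ?R\<close> \<open>y \<in> carrier ?R\<close> by (auto simp: mpoly_ring_def)
    qed
    then show ?thesis by (auto simp: mpoly_ring_def)
  qed
  have uminus: "- x \<in> carrier ?R" if "x \<in> carrier ?R" for x
    using that by (auto simp: mpoly_ring_def in_keys_iff)
  have zero: "0 \<in> carrier ?R" and one: "1 \<in> carrier ?R"
    by (auto simp: mpoly_ring_def)
  show ?thesis
  proof (rule cringI)
    show "abelian_group ?R"
    proof (rule abelian_groupI, goal_cases)
      case (6 x)
      then show ?case by (intro bexI[of _ "- x"]) (simp_all add: uminus mpoly_ring_simps)
    qed (simp_all only: mpoly_ring_simps plus zero add.assoc add.commute add.left_commute add_0_left add_0_right)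
    show "comm_monoid ?R"
      by (rule comm_monoidI) (simp_all only: mpoly_ring_simps times one mult.assoc mult.commute mult.left_commute mult_1_left mult_1_right)
  qed (simp add: mpoly_ring_simps distrib_right)
qed

lemma mpoly_ring_zero: "0 \<in> carrier (mpoly_ring V)"
  and mpoly_ring_one: "1 \<in> carrier (mpoly_ring V)"
  and mpoly_ring_const: "mconst c \<in> carrier (mpoly_ring V)"
  and mpoly_ring_var: "v \<in> V \<Longrightarrow> mvar v \<in> carrier (mpoly_ring V)"
  by (auto simp: mpoly_ring_def mconst_def mvar_def split: if_splits)

lemma mpoly_ring_add: "x \<in> carrier (mpoly_ring V) \<Longrightarrow> y \<in> carrier (mpoly_ring V) \<Longrightarrow> x + y \<in> carrier (mpoly_ring V)"
  and mpoly_ring_mult: "x \<in> carrier (mpoly_ring V) \<Longrightarrow> y \<in> carrier (mpoly_ring V) \<Longrightarrow> x * y \<in> carrier (mpoly_ring V)"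
  using ring.ring_simprules(1,5)[OF cring.axioms(1)[OF cring_mpoly_ring[of V]]] by (simp_all add: mpoly_ring_simps)

lemma mpoly_ring_uminus: "x \<in> carrier (mpoly_ring V) \<Longrightarrow> - x \<in> carrier (mpoly_ring V)"
  by (auto simp: mpoly_ring_def in_keys_iff)

lemma mpoly_ring_diff: "x \<in> carrier (mpoly_ring V) \<Longrightarrow> y \<in> carrier (mpoly_ring V) \<Longrightarrow> x - y \<in> carrier (mpoly_ring V)"
  using mpoly_ring_add[of x V "- y"] mpoly_ring_uminus[of y V] by simp

lemma mpoly_ring_prod: "(\<And>x. x \<in> S \<Longrightarrow> f x \<in> carrier (mpoly_ring V)) \<Longrightarrow> (\<Prod>x\<in>S. f x) \<in> carrier (mpoly_ring V)"
  by (induction S rule: infinite_finite_induct) (auto intro: mpoly_ring_mult mpoly_ring_one)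

lemma mpoly_ring_sum: "(\<And>x. x \<in> S \<Longrightarrow> f x \<in> carrier (mpoly_ring V)) \<Longrightarrow> (\<Sum>x\<in>S. f x) \<in> carrier (mpoly_ring V)"
  by (induction S rule: infinite_finite_induct) (auto intro: mpoly_ring_add mpoly_ring_zero)

lemma mpoly_ring_power: "x \<in> carrier (mpoly_ring V) \<Longrightarrow> x ^ n \<in> carrier (mpoly_ring V)"
  by (induction n) (auto intro: mpoly_ring_mult mpoly_ring_one)

lemma mpoly_ring_mono: "V \<subseteq> W \<Longrightarrow> x \<in> carrier (mpoly_ring V) \<Longrightarrow> x \<in> carrier (mpoly_ring W)"
  by (auto simp: mpoly_ring_def)

lemma mpoly_ring_mpderiv:
  assumes "f \<in> carrier (mpoly_ring V)"
  shows "mpderiv v f \<in> carrier (mpoly_ring V)"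
  unfolding mpderiv_def
proof (rule mpoly_ring_sum)
  fix \<mu> assume "\<mu> \<in> Poly_Mapping.keys f"
  then have "Poly_Mapping.keys \<mu> \<subseteq> V" using assms by (auto simp: mpoly_ring_def)
  moreover have "Poly_Mapping.keys (\<mu> - Poly_Mapping.single v 1) \<subseteq> Poly_Mapping.keys \<mu>"
    by (auto simp: in_keys_iff lookup_minus)
  ultimately show "Poly_Mapping.single (\<mu> - Poly_Mapping.single v 1)
       (of_nat (Poly_Mapping.lookup \<mu> v) * Poly_Mapping.lookup f \<mu>) \<in> carrier (mpoly_ring V)"
    by (auto simp: mpoly_ring_def split: if_splits)
qed

lemma det_3_rows:
  fixes a :: "'a::comm_ring_1"
  shows "det (mat_of_rows_list 3 [[a, b, c], [d, e, f], [g, h, i]]) =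
     a * (e * i - f * h) - b * (d * i - f * g) + c * (d * h - e * g)"
proof -
  have two: "det M = M $$ (0,0) * M $$ (1,1) - M $$ (0,1) * M $$ (1,0)"
    if M: "M \<in> carrier_mat 2 2" for M :: "'a mat"
    using M
    by (subst laplace_expansion_row[OF M, of 0])
       (auto simp: numeral_2_eq_2 cofactor_def mat_delete_def det_single)
  let ?M = "mat_of_rows_list 3 [[a, b, c], [d, e, f], [g, h, i]]"
  have M: "?M \<in> carrier_mat 3 3" by (simp add: mat_of_rows_list_def numeral_3_eq_3)
  have minors: "det (mat_delete ?M 0 0) = e * i - f * h" "det (mat_delete ?M 0 1) = d * i - f * g"
      "det (mat_delete ?M 0 2) = d * h - e * g"
    by (subst two; simp add: mat_delete_def mat_of_rows_list_def numeral_2_eq_2 numeral_3_eq_3)+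
  have set3: "{..<3} = {0, 1, 2::nat}" by auto
  show ?thesis
    unfolding laplace_expansion_row[OF M, of 0, simplified] set3
    by (simp add: cofactor_def minors minors[simplified], simp add: mat_of_rows_list_def algebra_simps)
qed

context
  fixes D :: "'k::field trinomial_data"
begin

lemma tri_mon_block: "tri_mon D i \<in> carrier (mpoly_ring (TV i ` {1..tri_n D i}))"
  unfolding tri_mon_def by (intro mpoly_ring_prod mpoly_ring_power mpoly_ring_var) auto

lemma tri_mon_closed: "i \<le> tri_r D \<Longrightarrow> tri_mon D i \<in> carrier (tri_poly_ring D)"
  by (rule mpoly_ring_mono[OF _ tri_mon_block]) (auto simp: tri_vars_def tri_indices_def image_iff)

lemma tri_rel_closed: "i + 2 \<le> tri_r D \<Longrightarrow> tri_rel D i \<in> carrier (tri_poly_ring D)"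
  unfolding tri_rel_def det_3_rows
  by (intro mpoly_ring_add mpoly_ring_diff mpoly_ring_mult tri_mon_closed mpoly_ring_const) auto

interpretation P: cring "tri_poly_ring D" by (rule cring_mpoly_ring)

lemma tri_ideal_ideal: "ideal (tri_ideal D) (tri_poly_ring D)"
  unfolding tri_ideal_def by (rule P.genideal_ideal) (auto simp: tri_rel_closed)

lemma tri_cls_hom: "tri_cls D \<in> Ring.ring_hom (tri_poly_ring D) (tri_alg D)"
  using ideal.rcos_ring_hom[OF tri_ideal_ideal] unfolding tri_alg_def tri_cls_def[abs_def] .

lemma tri_alg_ring: "ring (tri_alg D)"
  unfolding tri_alg_def by (rule ideal.quotient_is_ring[OF tri_ideal_ideal])

lemma tri_alg_carrier: "carrier (tri_alg D) = tri_cls D ` carrier (tri_poly_ring D)"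
  by (auto simp: tri_alg_def tri_cls_def FactRing_def A_RCOSETS_def')

lemma tri_cls_eq_iff:
  assumes "f \<in> carrier (tri_poly_ring D)" "g \<in> carrier (tri_poly_ring D)"
  shows "tri_cls D f = tri_cls D g \<longleftrightarrow> f - g \<in> tri_ideal D"
proof -
  have "\<ominus>\<^bsub>tri_poly_ring D\<^esub> g = - g"
    using P.minus_equality[of "- g" g] assms(2)
    by (simp add: mpoly_ring_simps mpoly_ring_uminus)
  then have "f \<ominus>\<^bsub>tri_poly_ring D\<^esub> g = f - g"
    by (simp add: a_minus_def mpoly_ring_simps)
  then show ?thesis
    using P.quotient_eq_iff_same_a_r_cos[OF tri_ideal_ideal assms] by (simp add: tri_cls_def)
qed

lemma derivation_exists:
  fixes g :: "tvar \<Rightarrow> (tvar, 'k) mpoly"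
  assumes g: "\<And>v. v \<in> tri_vars D \<Longrightarrow> g v \<in> carrier (tri_poly_ring D)"
    and rel: "\<And>i. i + 2 \<le> tri_r D \<Longrightarrow> (\<Sum>v\<in>tri_vars D. g v * mpderiv v (tri_rel D i)) = 0"
  shows "\<exists>\<delta>. tri_derivation D \<delta> \<and> (\<forall>v\<in>tri_vars D. \<delta> (tri_cls D (mvar v)) = tri_cls D (g v))"
proof -
  let ?P = "tri_poly_ring D" and ?R = "tri_alg D" and ?I = "tri_ideal D"
  define d where "d f = (\<Sum>v\<in>tri_vars D. g v * mpderiv v f)" for f
  have d_add: "d (f + h) = d f + d h" for f h
    by (simp add: d_def mpderiv_add algebra_simps sum.distrib)
  have d_mult: "d (f * h) = d f * h + f * d h" for f h
    by (simp add: d_def mpderiv_mult algebra_simps sum.distrib sum_distrib_left)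
  have d_const: "d (mconst c) = 0" for c
    by (simp add: d_def)
  have d_0: "d 0 = 0" by (simp add: d_def)
  have d_um: "d (- f) = - d f" for f
    using d_add[of f "- f"] d_0 by (simp add: eq_neg_iff_add_eq_0 add.commute)
  have d_diff: "d (f - h) = d f - d h" for f h
    using d_add[of f "- h"] d_um by simp
  have d_closed: "d f \<in> carrier ?P" if "f \<in> carrier ?P" for f
    unfolding d_def using that g by (intro mpoly_ring_sum mpoly_ring_mult mpoly_ring_mpderiv) auto
  have fin: "finite (tri_vars D)" by (simp add: tri_vars_def tri_indices_def)
  have d_var: "d (mvar v) = g v" if "v \<in> tri_vars D" for v
    using that fin by (simp add: d_def mpderiv_mvar if_distrib cong: if_cong)
  interpret I: ideal ?I ?P by (rule tri_ideal_ideal)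
  have I_closed: "f + h \<in> ?I" if "f \<in> ?I" "h \<in> ?I" for f h
    using I.a_closed[OF that] by (simp add: mpoly_ring_simps)
  have I_mult: "f * h \<in> ?I" "h * f \<in> ?I" if "f \<in> ?I" "h \<in> carrier ?P" for f h
    using I.I_l_closed[OF that] I.I_r_closed[OF that] by (simp_all add: mpoly_ring_simps)
  have I_um: "- f \<in> ?I" if "f \<in> ?I" for f
    using I_mult(1)[OF that mpoly_ring_uminus[OF mpoly_ring_one]] by simp
  let ?J = "{f \<in> ?I. d f \<in> ?I}"
  have I0: "0 \<in> ?I" using I.zero_closed by (simp add: mpoly_ring_simps)
  have "ideal ?J ?P"
  proof (rule idealI)
    show "ring ?P" by (rule P.ring_axioms)
    show "subgroup ?J (add_monoid ?P)"
    proof (rule P.add.subgroupI)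
      show "?J \<subseteq> carrier ?P" using I.Icarr by auto
      show "?J \<noteq> {}" using I0 d_0 by auto
      fix a assume a: "a \<in> ?J"
      then have "a \<in> carrier ?P" using I.Icarr by auto
      then have "\<ominus>\<^bsub>?P\<^esub> a = - a"
        using P.minus_equality[of "- a" a] by (simp add: mpoly_ring_simps mpoly_ring_uminus)
      then show "\<ominus>\<^bsub>?P\<^esub> a \<in> ?J" using a I_um by (auto simp: d_um)
    next
      fix a b assume "a \<in> ?J" "b \<in> ?J"
      then show "a \<oplus>\<^bsub>?P\<^esub> b \<in> ?J" by (auto simp: mpoly_ring_simps d_add I_closed)
    qed
  next
    fix a x assume "a \<in> ?J" "x \<in> carrier ?P"
    then show "x \<otimes>\<^bsub>?P\<^esub> a \<in> ?J" "a \<otimes>\<^bsub>?P\<^esub> x \<in> ?J"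
      by (auto simp: mpoly_ring_simps d_mult I_mult I_closed d_closed)
  qed
  moreover have "{tri_rel D i | i. i + 2 \<le> tri_r D} \<subseteq> ?J"
  proof safe
    fix i assume i: "i + 2 \<le> tri_r D"
    show "tri_rel D i \<in> ?I"
      unfolding tri_ideal_def by (rule subsetD[OF P.genideal_self]) (use i tri_rel_closed in auto)
    show "d (tri_rel D i) \<in> ?I" using rel[OF i] I0 by (simp add: d_def)
  qed
  ultimately have "?I \<subseteq> ?J"
    using P.genideal_minimal unfolding tri_ideal_def by blast
  then have dI: "d f \<in> ?I" if "f \<in> ?I" for f using that by auto
  define rep where "rep X = (SOME f. f \<in> carrier ?P \<and> tri_cls D f = X)" for X
  define \<delta> where "\<delta> X = tri_cls D (d (rep X))" for X
  have \<delta>: "\<delta> (tri_cls D f) = tri_cls D (d f)" if f: "f \<in> carrier ?P" for f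
  proof -
    have "rep (tri_cls D f) \<in> carrier ?P \<and> tri_cls D (rep (tri_cls D f)) = tri_cls D f"
      unfolding rep_def by (rule someI[of _ f]) (use f in auto)
    then have "d (rep (tri_cls D f) - f) \<in> ?I" "rep (tri_cls D f) \<in> carrier ?P"
      using dI f tri_cls_eq_iff by blast+
    then show ?thesis
      using f by (simp add: \<delta>_def tri_cls_eq_iff d_closed d_diff)
  qed
  have hom: "tri_cls D x \<oplus>\<^bsub>?R\<^esub> tri_cls D y = tri_cls D (x + y)"
            "tri_cls D x \<otimes>\<^bsub>?R\<^esub> tri_cls D y = tri_cls D (x * y)"
    if "x \<in> carrier ?P" "y \<in> carrier ?P" for x y
    using ring_hom_add[OF tri_cls_hom that] ring_hom_mult[OF tri_cls_hom that]
    by (simp_all add: mpoly_ring_simps)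
  have "tri_derivation D \<delta>"
    unfolding tri_derivation_def tri_alg_carrier
    by (auto simp: \<delta> hom d_closed mpoly_ring_add mpoly_ring_mult mpoly_ring_const d_add d_mult d_const)
  moreover have "\<delta> (tri_cls D (mvar v)) = tri_cls D (g v)" if "v \<in> tri_vars D" for v
    using \<delta>[OF mpoly_ring_var[OF that]] d_var[OF that] by simp
  ultimately show ?thesis by blast
qed

lemma tri_cls_0_1: "tri_cls D 0 = \<zero>\<^bsub>tri_alg D\<^esub>" "tri_cls D 1 = \<one>\<^bsub>tri_alg D\<^esub>"
  using ring_hom_zero[OF tri_cls_hom P.ring_axioms tri_alg_ring] ring_hom_one[OF tri_cls_hom]
  by (simp_all add: mpoly_ring_simps)

lemma tri_mpderiv_rel:
  "mpderiv v (tri_rel D i) =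
     mpderiv v (tri_mon D i) *
       mconst (tri_A D $$ (0, i+1) * tri_A D $$ (1, i+2) - tri_A D $$ (0, i+2) * tri_A D $$ (1, i+1))
   - mpderiv v (tri_mon D (i+1)) *
       mconst (tri_A D $$ (0, i) * tri_A D $$ (1, i+2) - tri_A D $$ (0, i+2) * tri_A D $$ (1, i))
   + mpderiv v (tri_mon D (i+2)) *
       mconst (tri_A D $$ (0, i) * tri_A D $$ (1, i+1) - tri_A D $$ (0, i+1) * tri_A D $$ (1, i))"
proof -
  have md: "mpderiv v (x - y) = mpderiv v x - mpderiv v y" for x y :: "(tvar, 'k) mpoly"
    using mpderiv_add[of v "x - y" y] by simp
  have c: "mconst (x * y) = mconst x * mconst y" "mconst (x - y) = mconst x - mconst y" for x y :: 'k
    by (simp_all add: mconst_def mult_single single_diff)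
  show ?thesis
    unfolding tri_rel_def det_3_rows by (simp add: c mpderiv_add md mpderiv_mult algebra_simps)
qed

lemma partial_S_exists: "\<exists>\<delta>. is_partial_S D p \<delta>"
proof -
  have 0: "mpderiv (SV k) (tri_mon D i) = 0" for k i
    by (rule mpderiv_eq_0[OF tri_mon_block]) auto
  have "\<exists>\<delta>. tri_derivation D \<delta> \<and> (\<forall>v\<in>tri_vars D. \<delta> (tri_cls D (mvar v)) =
          tri_cls D (if v = SV p then 1 else 0))"
    by (rule derivation_exists)
       (auto simp: mpoly_ring_one mpoly_ring_zero tri_mpderiv_rel 0 intro!: sum.neutral)
  then show ?thesis
    unfolding is_partial_S_def by (force simp: tri_vars_def tri_cls_0_1)
qed

lemma delta_exists:
  assumes D: "trinomial_data D" and J: "J = {} \<or> (\<exists>i0. J = {i0})"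
    and beta: "tri_beta D J \<beta>" and C: "tri_C D J C"
  shows "\<exists>\<delta>. is_delta D C \<beta> \<delta>"
proof -
  let ?r = "tri_r D" and ?A = "tri_A D"
  define p where "p k = mpderiv (TV k (C k)) (tri_mon D k)" for k
  define g where "g v = (case v of SV k \<Rightarrow> 0 | TV i j \<Rightarrow>
     if j = C i then mconst (\<beta> $ i) * (\<Prod>k\<in>{0..?r} - insert i J. p k) else 0)" for v
  define q where "q = (\<Prod>k\<in>{0..?r} - J. p k)"
  have A: "?A \<in> carrier_mat 2 (?r + 1)" using D by (simp add: trinomial_data_def)
  obtain y where y: "y \<in> carrier_vec 2" "?A\<^sup>T *\<^sub>v y = \<beta>"
    using beta A vec_space.row_space_eq[OF A] by (auto simp: tri_beta_def)
  have \<beta>: "\<beta> $ i = ?A $$ (0, i) * y $ 0 + ?A $$ (1, i) * y $ 1" if "i \<le> ?r" for i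
    using A y(1) that by (auto simp: y(2)[symmetric] scalar_prod_def numeral_2_eq_2)
  have Cr: "C i \<in> {1..tri_n D i}" if "i \<le> ?r" for i using C that by (simp add: tri_C_def)
  have other: "mpderiv (TV k j) (tri_mon D i) = 0" if "k \<noteq> i" for k j i
    by (rule mpderiv_eq_0[OF tri_mon_block]) (use that in auto)
  have S: "mpderiv (SV k) (tri_mon D i) = 0" for k i
    by (rule mpderiv_eq_0[OF tri_mon_block]) auto
  have fin: "finite (tri_vars D)" by (simp add: tri_vars_def tri_indices_def)
  have mon: "(\<Sum>v\<in>tri_vars D. g v * mpderiv v (tri_mon D i)) = mconst (\<beta> $ i) * q" if i: "i \<le> ?r" for i
  proof -
    have "(\<Sum>v\<in>tri_vars D. g v * mpderiv v (tri_mon D i)) =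
          (\<Sum>v\<in>tri_vars D. if v = TV i (C i) then mconst (\<beta> $ i) * (\<Prod>k\<in>{0..?r} - insert i J. p k) * p i else 0)"
    proof (rule sum.cong[OF refl])
      fix v
      show "g v * mpderiv v (tri_mon D i) =
        (if v = TV i (C i) then mconst (\<beta> $ i) * (\<Prod>k\<in>{0..?r} - insert i J. p k) * p i else 0)"
        by (cases v) (auto simp: g_def p_def S other)
    qed
    also have "\<dots> = mconst (\<beta> $ i) * (\<Prod>k\<in>{0..?r} - insert i J. p k) * p i"
      using fin i Cr[OF i] by (auto simp: sum.delta tri_vars_def tri_indices_def)
    also have "\<dots> = mconst (\<beta> $ i) * q"
    proof (cases "i \<in> J")
      case True
      then have "\<beta> $ i = 0" using beta by (auto simp: tri_beta_def)
      then show ?thesis by (simp add: mconst_def)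
    next
      case False
      have "q = p i * (\<Prod>k\<in>({0..?r} - J) - {i}. p k)"
        unfolding q_def by (rule prod.remove) (use False i in auto)
      also have "({0..?r} - J) - {i} = {0..?r} - insert i J" by auto
      finally show ?thesis by (simp add: mult_ac)
    qed
    finally show ?thesis .
  qed
  have mc: "mconst (x * y) = mconst x * mconst y" "mconst (x + y) = mconst x + mconst y"
           "mconst (x - y) = mconst x - mconst y" for x y :: 'k
    by (simp_all add: mconst_def mult_single single_diff single_add)
  have "\<exists>\<delta>. tri_derivation D \<delta> \<and> (\<forall>v\<in>tri_vars D. \<delta> (tri_cls D (mvar v)) = tri_cls D (g v))"
  proof (rule derivation_exists)
    fix v assume "v \<in> tri_vars D"
    show "g v \<in> carrier (tri_poly_ring D)"
      by (cases v) (auto simp: g_def p_def mpoly_ring_zero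
            intro!: mpoly_ring_mult mpoly_ring_const mpoly_ring_prod mpoly_ring_mpderiv tri_mon_closed)
  next
    fix i assume i: "i + 2 \<le> ?r"
    let ?s = "\<lambda>i. \<Sum>v\<in>tri_vars D. g v * mpderiv v (tri_mon D i)"
    have "(\<Sum>v\<in>tri_vars D. g v * mpderiv v (tri_rel D i)) =
       ?s i * mconst (?A $$ (0, i+1) * ?A $$ (1, i+2) - ?A $$ (0, i+2) * ?A $$ (1, i+1))
     - ?s (i+1) * mconst (?A $$ (0, i) * ?A $$ (1, i+2) - ?A $$ (0, i+2) * ?A $$ (1, i))
     + ?s (i+2) * mconst (?A $$ (0, i) * ?A $$ (1, i+1) - ?A $$ (0, i+1) * ?A $$ (1, i))"
      unfolding tri_mpderiv_rel
      by (simp only: distrib_left right_diff_distrib sum.distrib sum_subtractf sum_distrib_right mult.assoc)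
    also have "\<dots> = 0"
      using i by (simp add: mon \<beta> mc algebra_simps)
    finally show "(\<Sum>v\<in>tri_vars D. g v * mpderiv v (tri_rel D i)) = 0" .
  qed
  then obtain \<delta> where \<delta>: "tri_derivation D \<delta>"
      "\<And>v. v \<in> tri_vars D \<Longrightarrow> \<delta> (tri_cls D (mvar v)) = tri_cls D (g v)" by blast
  have "tri_delta_values D J C \<beta> \<delta>"
    unfolding tri_delta_values_def
    using \<delta>(2) by (force simp: tri_vars_def g_def p_def tri_cls_0_1)
  then show ?thesis using \<delta>(1) J beta C unfolding is_delta_def by blast
qed

end

end

theory Submission
  imports Defs
begin

text \<open>
  A homogeneous element is a monomial times a binary form in any two of the \<open>T_i^{l_i}\<close>, because
  exponent vectors of equal \<open>K_0\<close>-degree differ by exponents of the \<open>T_i^{l_i}\<close> and each of these is a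
  linear form \<open>\<gamma>_i Z + \<beta>_i W\<close> in two fixed elements \<open>Z, W\<close> of the algebra.

  For \<open>\<partial>/\<partial>S_p\<close>: if \<open>S_p\<close> divides the monomial of a homogeneous \<open>h\<close>, then \<open>S_p \<partial>h/\<partial>S_p\<close> is a positive
  multiple of \<open>h\<close>, so \<open>h\<close> is not in the kernel unless it is 0.

  For \<open>\<delta>_{C,\<beta>}\<close>: take \<open>Z\<close> proportional to \<open>\<beta>_2 T_1^{l_1} - \<beta>_1 T_2^{l_2}\<close>, so that \<open>\<delta> Z = 0\<close>, and let
  \<open>g\<close> be the binary form of \<open>h\<close> dehomogenized at \<open>Z = 1\<close>. Evaluating \<open>\<delta> h = 0\<close> at points of the
  variety with non-zero coordinates (they exist because the field has roots) gives
  \<open>g' + g \<Sum> (b_i / l_i) \<beta>_i / (\<gamma>_i + \<beta>_i x) = 0\<close> with \<open>b_i\<close> the exponent of \<open>T_{ic_i}\<close> in \<open>h\<close>. Comparing leading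
  coefficients yields \<open>deg g + \<Sum> b_i / l_i = 0\<close>, hence \<open>g\<close> is constant and all \<open>b_i\<close> vanish.
\<close>

section \<open>Substitution in polynomials\<close>

lemma comm_ring_hom_mconst: "comm_ring_hom mconst"
  by unfold_locales (simp_all add: mconst_def single_add mult_single)

interpretation mconst: comm_ring_hom mconst
  by (rule comm_ring_hom_mconst)

lemma comm_ring_hom_id: "comm_ring_hom (\<lambda>x. x)"
  by unfold_locales simp_all

lemma single_mult_mconst: "mconst c * Poly_Mapping.single \<mu> d = Poly_Mapping.single \<mu> (c * d)"
  by (simp add: mconst_def mult_single)

lemma mvar_power: "mvar v ^ n = Poly_Mapping.single (Poly_Mapping.single v n) 1"
  by (induction n) (simp_all add: mvar_def mult_single flip: single_add)

lemma prod_single: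
  "(\<Prod>x\<in>S. Poly_Mapping.single (f x) (1::'k::comm_ring_1)) = Poly_Mapping.single (\<Sum>x\<in>S. f x) 1"
  by (induction S rule: infinite_finite_induct) (simp_all add: mult_single)

lemma lookup_sum_single:
  "finite S \<Longrightarrow> Poly_Mapping.lookup (\<Sum>v\<in>S. Poly_Mapping.single v (f v)) w = (if w \<in> S then f w else 0)"
  by (simp add: lookup_sum lookup_single when_def sum.delta)

lemma monomial_eq_prod:
  assumes "finite S" "Poly_Mapping.keys \<mu> \<subseteq> S"
  shows "Poly_Mapping.single \<mu> (1::'k::comm_ring_1) = (\<Prod>v\<in>S. mvar v ^ Poly_Mapping.lookup \<mu> v)"
proof -
  have "\<mu> = (\<Sum>v\<in>S. Poly_Mapping.single v (Poly_Mapping.lookup \<mu> v))"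
    using assms by (intro poly_mapping_eqI) (auto simp: lookup_sum_single in_keys_iff subset_iff)
  then show ?thesis by (simp add: mvar_power prod_single)
qed

text \<open>A polynomial is a finite sum of constants times products of powers of variables, so
  these four cases suffice. The cases for sums and products also supply membership in the ring,
  which claims about classes modulo an ideal require.\<close>

lemma mpoly_ring_induct [consumes 1, case_names const var add mult]:
  fixes f :: "('v, 'k::comm_ring_1) mpoly"
  assumes f: "f \<in> carrier (mpoly_ring V)"
    and c: "\<And>c. Q (mconst c)"
    and v: "\<And>v. v \<in> V \<Longrightarrow> Q (mvar v)"
    and a: "\<And>f g. f \<in> carrier (mpoly_ring V) \<Longrightarrow> g \<in> carrier (mpoly_ring V) \<Longrightarrow> Q f \<Longrightarrow> Q g \<Longrightarrow> Q (f + g)"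
    and m: "\<And>f g. f \<in> carrier (mpoly_ring V) \<Longrightarrow> g \<in> carrier (mpoly_ring V) \<Longrightarrow> Q f \<Longrightarrow> Q g \<Longrightarrow> Q (f * g)"
  shows "Q f"
proof -
  let ?C = "carrier (mpoly_ring V) :: ('v, 'k) mpoly set"
  have pow: "g ^ n \<in> ?C \<and> Q (g ^ n)" if "g \<in> ?C" "Q g" for g n
    using that c[of 1] by (induction n) (auto intro: m mpoly_ring_mult mpoly_ring_one)
  have prod: "(\<Prod>x\<in>S. g x) \<in> ?C \<and> Q (\<Prod>x\<in>S. g x)" if "\<And>x. x \<in> S \<Longrightarrow> g x \<in> ?C \<and> Q (g x)" for g and S :: "'v set"
    using that c[of 1]
    by (induction S rule: infinite_finite_induct) (auto intro: m mpoly_ring_mult mpoly_ring_one)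
  have sum: "(\<Sum>x\<in>S. g x) \<in> ?C \<and> Q (\<Sum>x\<in>S. g x)" if "\<And>x. x \<in> S \<Longrightarrow> g x \<in> ?C \<and> Q (g x)" for g and S :: "('v \<Rightarrow>\<^sub>0 nat) set"
    using that c[of 0]
    by (induction S rule: infinite_finite_induct) (auto intro: a mpoly_ring_add mpoly_ring_zero)
  have "Q (\<Sum>\<mu>\<in>Poly_Mapping.keys f. mconst (Poly_Mapping.lookup f \<mu>) *
      (\<Prod>v\<in>Poly_Mapping.keys \<mu>. mvar v ^ Poly_Mapping.lookup \<mu> v))"
  proof (rule conjunct2[OF sum])
    fix \<mu> assume "\<mu> \<in> Poly_Mapping.keys f"
    then have \<mu>: "Poly_Mapping.keys \<mu> \<subseteq> V" using f by (auto simp: mpoly_ring_def)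
    have "mvar v ^ Poly_Mapping.lookup \<mu> v \<in> ?C \<and> Q (mvar v ^ Poly_Mapping.lookup \<mu> v)"
      if "v \<in> Poly_Mapping.keys \<mu>" for v
      by (rule pow) (use that \<mu> in \<open>auto intro: v mpoly_ring_var\<close>)
    then have "(\<Prod>v\<in>Poly_Mapping.keys \<mu>. mvar v ^ Poly_Mapping.lookup \<mu> v) \<in> ?C \<and>
        Q (\<Prod>v\<in>Poly_Mapping.keys \<mu>. mvar v ^ Poly_Mapping.lookup \<mu> v)"
      by (rule prod)
    then show "mconst (Poly_Mapping.lookup f \<mu>) * (\<Prod>v\<in>Poly_Mapping.keys \<mu>. mvar v ^ Poly_Mapping.lookup \<mu> v) \<in> ?C \<and>
        Q (mconst (Poly_Mapping.lookup f \<mu>) * (\<Prod>v\<in>Poly_Mapping.keys \<mu>. mvar v ^ Poly_Mapping.lookup \<mu> v))"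
      by (auto intro: m c mpoly_ring_mult mpoly_ring_const)
  qed
  also have "(\<Sum>\<mu>\<in>Poly_Mapping.keys f. mconst (Poly_Mapping.lookup f \<mu>) *
      (\<Prod>v\<in>Poly_Mapping.keys \<mu>. mvar v ^ Poly_Mapping.lookup \<mu> v)) = f"
    by (subst (3) mpoly_expand)
       (simp add: single_mult_mconst flip: monomial_eq_prod[OF finite_keys subset_refl])
  finally show ?thesis .
qed

text \<open>Substitution with coefficients pushed through a ring map: \<open>c = mconst\<close>
  gives \<open>msubst\<close>, the identity gives the value at a point.\<close>

definition mpeval ::
  "('k::comm_ring_1 \<Rightarrow> 'r::comm_ring_1) \<Rightarrow> ('v \<Rightarrow> 'r) \<Rightarrow> ('v, 'k) mpoly \<Rightarrow> 'r" where
  "mpeval c a f = (\<Sum>\<mu>\<in>Poly_Mapping.keys f.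
     c (Poly_Mapping.lookup f \<mu>) * (\<Prod>v\<in>Poly_Mapping.keys \<mu>. a v ^ Poly_Mapping.lookup \<mu> v))"

lemma msubst_eq_mpeval: "msubst g = mpeval mconst g"
  by (rule ext) (simp add: msubst_def mpeval_def)

text \<open>The sums and products in \<open>mpeval\<close> may be extended to any finite superset of
  the supports. Over the union of two supports, additivity and the product rule for monomials hold
  termwise; multiplicativity follows by bilinearity.\<close>

lemma comm_ring_hom_mpeval:
  assumes "comm_ring_hom c"
  shows "comm_ring_hom (mpeval c a)"
proof -
  interpret c: comm_ring_hom c by (rule assms)
  define m where "m \<mu> = (\<Prod>v\<in>Poly_Mapping.keys \<mu>. a v ^ Poly_Mapping.lookup \<mu> v)" for \<mu>
  have m_sup: "m \<mu> = (\<Prod>v\<in>S. a v ^ Poly_Mapping.lookup \<mu> v)"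
    if "finite S" "Poly_Mapping.keys \<mu> \<subseteq> S" for S \<mu>
    unfolding m_def by (rule prod.mono_neutral_left) (use that in \<open>auto simp: in_keys_iff\<close>)
  have m_add: "m (\<mu> + \<nu>) = m \<mu> * m \<nu>" for \<mu> \<nu>
  proof -
    let ?S = "Poly_Mapping.keys \<mu> \<union> Poly_Mapping.keys \<nu>"
    have "m (\<mu> + \<nu>) = (\<Prod>v\<in>?S. a v ^ Poly_Mapping.lookup (\<mu> + \<nu>) v)"
      by (rule m_sup) (auto simp: Poly_Mapping.keys_add)
    also have "\<dots> = m \<mu> * m \<nu>"
      by (subst (1 2) m_sup[of ?S]) (auto simp: lookup_add power_add prod.distrib)
    finally show ?thesis .
  qed
  have e: "mpeval c a f = (\<Sum>\<mu>\<in>S. c (Poly_Mapping.lookup f \<mu>) * m \<mu>)"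
    if "finite S" "Poly_Mapping.keys f \<subseteq> S" for S f
    unfolding mpeval_def m_def[symmetric]
    by (rule sum.mono_neutral_left) (use that in \<open>auto simp: in_keys_iff\<close>)
  have single: "mpeval c a (Poly_Mapping.single \<mu> x) = c x * m \<mu>" for \<mu> x
    by (subst e[of "{\<mu>}"]) auto
  have add: "mpeval c a (f + g) = mpeval c a f + mpeval c a g" for f g
  proof -
    let ?S = "Poly_Mapping.keys f \<union> Poly_Mapping.keys g"
    have "mpeval c a (f + g) = (\<Sum>\<mu>\<in>?S. c (Poly_Mapping.lookup (f + g) \<mu>) * m \<mu>)"
      by (rule e) (auto simp: Poly_Mapping.keys_add)
    also have "\<dots> = mpeval c a f + mpeval c a g"
      by (subst (1 2) e[of ?S]) (auto simp: lookup_add c.hom_add distrib_right sum.distrib)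
    finally show ?thesis .
  qed
  have zero: "mpeval c a 0 = 0" by (simp add: mpeval_def)
  have sum: "mpeval c a (\<Sum>x\<in>S. f x) = (\<Sum>x\<in>S. mpeval c a (f x))" for f and S :: "('c \<Rightarrow>\<^sub>0 nat) set"
    by (induction S rule: infinite_finite_induct) (auto simp: add zero)
  let ?K = Poly_Mapping.keys and ?s = "\<lambda>f \<mu>. Poly_Mapping.single \<mu> (Poly_Mapping.lookup f \<mu>)"
  have mult: "mpeval c a (f * g) = mpeval c a f * mpeval c a g" for f g
  proof -
    have "mpeval c a ((\<Sum>\<mu>\<in>?K f. ?s f \<mu>) * (\<Sum>\<nu>\<in>?K g. ?s g \<nu>)) =
        mpeval c a (\<Sum>\<mu>\<in>?K f. ?s f \<mu>) * mpeval c a (\<Sum>\<nu>\<in>?K g. ?s g \<nu>)"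
      by (simp add: sum_product sum mult_single single m_add c.hom_mult mult_ac)
    then show ?thesis using mpoly_expand[of f] mpoly_expand[of g] by simp
  qed
  have one: "mpeval c a 1 = 1"
    using single[of 0 1] by (simp add: m_def)
  show ?thesis by unfold_locales (simp_all add: add mult zero one)
qed

lemma mpeval_mconst:
  assumes "comm_ring_hom c"
  shows "mpeval c a (mconst x) = c x"
proof -
  interpret c: comm_ring_hom c by (rule assms)
  show ?thesis by (simp add: mpeval_def mconst_def)
qed

lemma mpeval_mvar:
  assumes "comm_ring_hom c"
  shows "mpeval c a (mvar v) = a v"
proof -
  interpret c: comm_ring_hom c by (rule assms)
  show ?thesis by (simp add: mpeval_def mvar_def)
qed

section \<open>Derivations of polynomial rings\<close>

text \<open>For finite \<open>V\<close>, the derivation of the polynomial ring in \<open>V\<close>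
  that sends each variable \<open>v\<close> to \<open>g v\<close>. It serves as a lift of
  derivations of the trinomial algebra.\<close>

definition mpder :: "'v set \<Rightarrow> ('v \<Rightarrow> ('v, 'k::comm_ring_1) mpoly) \<Rightarrow> ('v, 'k) mpoly \<Rightarrow> ('v, 'k) mpoly" where
  "mpder V g f = (\<Sum>v\<in>V. g v * mpderiv v f)"

lemma mpder_add: "mpder V g (f + h) = mpder V g f + mpder V g h"
  by (simp add: mpder_def mpderiv_add distrib_left sum.distrib)

lemma mpder_mult: "mpder V g (f * h) = mpder V g f * h + f * mpder V g h"
  by (simp add: mpder_def mpderiv_mult algebra_simps sum.distrib sum_distrib_left)

lemma mpder_mconst [simp]: "mpder V g (mconst c) = 0"
  by (simp add: mpder_def)

lemma mpder_zero [simp]: "mpder V g 0 = 0"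
  by (simp add: mpder_def)

lemma mpder_one [simp]: "mpder V g 1 = 0"
  using mpder_mconst[of V g 1] by (simp add: mconst.hom_one)

lemma mpder_diff: "mpder V g (f - h) = mpder V g f - mpder V g h"
  using mpder_add[of V g "f - h" h] by simp

lemma mpder_sum: "mpder V g (\<Sum>x\<in>S. f x) = (\<Sum>x\<in>S. mpder V g (f x))"
  by (induction S rule: infinite_finite_induct) (auto simp: mpder_add)

lemma mpder_power: "mpder V g (f ^ n) = of_nat n * f ^ (n - 1) * mpder V g f"
proof (induction n)
  case (Suc n)
  \<comment> \<open>The case split absorbs the truncated \<open>n - 1\<close>: for
    \<open>n = 0\<close> the coefficient \<open>of_nat n\<close> kills both sides.\<close>
  have "f * (of_nat n * (f ^ (n - 1) * mpder V g f)) = of_nat n * (f ^ n * mpder V g f)"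
    by (cases n) (auto simp: mult_ac)
  then show ?case
    using Suc by (simp add: mpder_mult algebra_simps)
qed simp

lemma mpder_mvar: "finite V \<Longrightarrow> v \<in> V \<Longrightarrow> mpder V g (mvar v) = g v"
  by (simp add: mpder_def mpderiv_mvar if_distrib cong: if_cong)

lemma mpder_closed:
  "(\<And>v. v \<in> V \<Longrightarrow> g v \<in> carrier (mpoly_ring W)) \<Longrightarrow> f \<in> carrier (mpoly_ring W) \<Longrightarrow>
    mpder V g f \<in> carrier (mpoly_ring W)"
  unfolding mpder_def by (intro mpoly_ring_sum mpoly_ring_mult mpoly_ring_mpderiv) auto

text \<open>Monomials are eigenvectors of the Euler operator v d/dv. For a positive exponent the
  factor \<open>mvar v\<close> restores the lowered exponent; for exponent 0 both sides
  vanish.\<close>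

lemma mvar_mult_mpderiv_monomial:
  "mvar v * mpderiv v (Poly_Mapping.single \<mu> c) =
     mconst (of_nat (Poly_Mapping.lookup \<mu> v)) * Poly_Mapping.single \<mu> (c::'k::comm_ring_1)"
proof (cases "Poly_Mapping.lookup \<mu> v = 0")
  case False
  then have "Poly_Mapping.single v 1 + (\<mu> - Poly_Mapping.single v 1) = \<mu>"
    by (intro poly_mapping_eqI) (auto simp: lookup_minus lookup_add lookup_single when_def)
  then show ?thesis
    by (simp add: mvar_def mpderiv_single mult_single single_mult_mconst)
qed (simp add: mpderiv_single mconst_def)

section \<open>Homogenization of univariate polynomials\<close>

text \<open>The binary form of degree \<open>e\<close> that becomes \<open>p\<close> at
  \<open>z = 1\<close>. The degree is a separate parameter because a form may be divisible by a
  power of \<open>z\<close>; coefficients beyond \<open>e\<close> are cut off, hence the degree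
  bounds below. The map \<open>c\<close> lets the same form live in a polynomial ring or in the
  field.\<close>

definition homogenize :: "('k \<Rightarrow> 'r) \<Rightarrow> nat \<Rightarrow> 'k::comm_ring_1 poly \<Rightarrow> 'r \<Rightarrow> 'r \<Rightarrow> 'r::comm_ring_1" where
  "homogenize c e p z w = (\<Sum>k\<le>e. c (poly.coeff p k) * z ^ (e - k) * w ^ k)"

lemma homogenize_add:
  assumes "comm_ring_hom c"
  shows "homogenize c e (p + q) z w = homogenize c e p z w + homogenize c e q z w"
proof -
  interpret c: comm_ring_hom c by (rule assms)
  show ?thesis by (simp add: homogenize_def c.hom_add distrib_right sum.distrib)
qed

lemma homogenize_sum_smult:
  assumes "comm_ring_hom c"
  shows "homogenize c e (\<Sum>x\<in>S. Polynomial.smult (a x) (p x)) z w = (\<Sum>x\<in>S. c (a x) * homogenize c e (p x) z w)"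
proof -
  interpret c: comm_ring_hom c by (rule assms)
  have "homogenize c e (Polynomial.smult a p) z w = c a * homogenize c e p z w" for a p
    by (simp add: homogenize_def c.hom_mult sum_distrib_left mult.assoc)
  then show ?thesis
    by (induction S rule: infinite_finite_induct)
       (simp_all add: homogenize_add[OF assms], simp_all add: homogenize_def)
qed

lemma hom_homogenize:
  assumes "comm_ring_hom \<phi>" and "\<And>x. \<phi> (c x) = c' x"
  shows "\<phi> (homogenize c e p z w) = homogenize c' e p (\<phi> z) (\<phi> w)"
proof -
  interpret \<phi>: comm_ring_hom \<phi> by (rule assms(1))
  show ?thesis by (simp add: homogenize_def \<phi>.hom_sum \<phi>.hom_mult \<phi>.hom_power assms(2))
qed

lemma homogenize_const:
  assumes "comm_ring_hom c"
  shows "homogenize c e [:a:] z w = c a * z ^ e"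
proof -
  interpret c: comm_ring_hom c by (rule assms)
  have "homogenize c e [:a:] z w = (\<Sum>k\<le>e. if k = 0 then c a * z ^ e else 0)"
    unfolding homogenize_def by (rule sum.cong) (auto simp: coeff_pCons split: nat.splits)
  then show ?thesis by simp
qed

lemma homogenize_1:
  assumes "Polynomial.degree p \<le> e"
  shows "homogenize (\<lambda>x. x) e p 1 x = poly p x"
proof -
  have "poly p x = (\<Sum>i\<le>e. poly.coeff p i * x ^ i)"
    unfolding poly_altdef by (rule sum.mono_neutral_left) (use assms in \<open>auto simp: coeff_eq_0\<close>)
  then show ?thesis by (simp add: homogenize_def)
qed

text \<open>Summing up to a bound \<open>e\<close> matches the index range of
  \<open>homogenize\<close>. The truncated exponent at \<open>i = 0\<close> comes with coefficient
  0.\<close>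

lemma poly_pderiv_altdef:
  assumes "Polynomial.degree p \<le> e"
  shows "poly (pderiv p) x = (\<Sum>i\<le>e. poly.coeff p i * (of_nat i * x ^ (i - 1)))"
proof -
  have "pderiv p = (\<Sum>i\<le>e. pderiv (Polynomial.monom (poly.coeff p i) i))"
    by (subst poly_as_sum_of_monoms'[OF assms, symmetric]) (rule higher_pderiv_sum[of 1, simplified])
  then show ?thesis by (simp add: pderiv_monom poly_sum poly_monom mult_ac)
qed

text \<open>The constant term \<open>a\<close> raises the power of \<open>z\<close>, the new top
  coefficient being 0 by the degree bound; the linear term \<open>b\<close> shifts the index by one
  and raises the power of \<open>w\<close>.\<close>

lemma homogenize_mult_linear:
  assumes "comm_ring_hom c" and "Polynomial.degree p \<le> e"
  shows "homogenize c (Suc e) ([:a, b:] * p) z w = (c a * z + c b * w) * homogenize c e p z w"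
proof -
  interpret c: comm_ring_hom c by (rule assms)
  have 1: "homogenize c (Suc e) (Polynomial.smult a p) z w = c a * z * homogenize c e p z w"
  proof -
    have "poly.coeff p (Suc e) = 0" using assms(2) by (simp add: coeff_eq_0)
    then show ?thesis
      by (simp add: homogenize_def sum_distrib_left c.hom_mult Suc_diff_le mult_ac)
  qed
  have 2: "homogenize c (Suc e) (pCons 0 (Polynomial.smult b p)) z w = c b * w * homogenize c e p z w"
    by (simp add: homogenize_def sum_distrib_left c.hom_mult sum.atMost_Suc_shift mult_ac del: sum.atMost_Suc)
  show ?thesis
    by (simp add: homogenize_add[OF assms(1)] 1 2 distrib_right)
qed

lemma homogenize_power_linear:
  assumes "comm_ring_hom c" and "Polynomial.degree p \<le> e"
  shows "Polynomial.degree ([:a, b:] ^ n * p) \<le> n + e \<and>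
    homogenize c (n + e) ([:a, b:] ^ n * p) z w = (c a * z + c b * w) ^ n * homogenize c e p z w"
proof (induction n)
  case (Suc n)
  have "Polynomial.degree ([:a, b:] * ([:a, b:] ^ n * p)) \<le> 1 + (n + e)"
    by (rule order.trans[OF degree_mult_le]) (use Suc in \<open>auto intro: add_mono\<close>)
  with Suc show ?case
    using homogenize_mult_linear[OF assms(1), of "[:a, b:] ^ n * p" "n + e" a b z w]
    by (simp only: power_Suc mult.assoc add_Suc plus_1_eq_Suc)
qed (use assms(2) in simp)

text \<open>Once every T_i^{l_i} is replaced by a linear form, this makes a product of their powers
  a single binary form whose degree is the total exponent.\<close>

lemma homogenize_prod_linear:
  assumes "comm_ring_hom c" and "finite S"
  shows "Polynomial.degree (\<Prod>i\<in>S. [:a i, b i:] ^ n i) \<le> (\<Sum>i\<in>S. n i) \<and>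
    homogenize c (\<Sum>i\<in>S. n i) (\<Prod>i\<in>S. [:a i, b i:] ^ n i) z w = (\<Prod>i\<in>S. (c (a i) * z + c (b i) * w) ^ n i)"
proof -
  interpret c: comm_ring_hom c by (rule assms)
  show ?thesis
    using assms(2)
  proof induction
    case (insert i S)
    then show ?case
      using homogenize_power_linear[OF assms(1), of "\<Prod>i\<in>S. [:a i, b i:] ^ n i" "\<Sum>i\<in>S. n i" "a i" "b i" "n i" z w]
      by simp
  qed (simp add: homogenize_def)
qed

section \<open>A logarithmic differential equation\<close>

text \<open>In the convolution only the index \<open>m\<close> survives: above it the first factor
  vanishes, below it the second. The bounds need not be attained, so vanishing top coefficients are
  covered.\<close>

lemma coeff_mult_upper:
  fixes p q :: "'a::comm_semiring_0 poly"
  assumes "Polynomial.degree p \<le> m" "Polynomial.degree q \<le> n"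
  shows "poly.coeff (p * q) (m + n) = poly.coeff p m * poly.coeff q n"
proof -
  have "poly.coeff (p * q) (m + n) =
      (\<Sum>i\<le>m + n. if i = m then poly.coeff p m * poly.coeff q n else 0)"
    unfolding coeff_mult
  proof (rule sum.cong)
    fix i
    show "poly.coeff p i * poly.coeff q (m + n - i) = (if i = m then poly.coeff p m * poly.coeff q n else 0)"
      using assms by (cases i m rule: linorder_cases) (auto simp: coeff_eq_0)
  qed simp
  then show ?thesis by simp
qed

lemma prod_linear_upper:
  fixes a b :: "'i \<Rightarrow> 'a::comm_ring_1"
  assumes "finite S"
  shows "Polynomial.degree (\<Prod>i\<in>S. [:a i, b i:]) \<le> card S"
    and "poly.coeff (\<Prod>i\<in>S. [:a i, b i:]) (card S) = (\<Prod>i\<in>S. b i)"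
proof -
  have "Polynomial.degree (\<Prod>i\<in>S. [:a i, b i:]) \<le> card S \<and>
      poly.coeff (\<Prod>i\<in>S. [:a i, b i:]) (card S) = (\<Prod>i\<in>S. b i)"
    using assms
  proof induction
    case (insert i S)
    have "Polynomial.degree [:a i, b i:] \<le> 1" by simp
    with insert show ?case
      using coeff_mult_upper[of "[:a i, b i:]" 1 "\<Prod>i\<in>S. [:a i, b i:]" "card S"]
        order.trans[OF degree_mult_le[of "[:a i, b i:]" "\<Prod>i\<in>S. [:a i, b i:]"], of "1 + card S"]
      by (simp del: mult_pCons_left add: add_mono)
  qed simp
  then show "Polynomial.degree (\<Prod>i\<in>S. [:a i, b i:]) \<le> card S"
    "poly.coeff (\<Prod>i\<in>S. [:a i, b i:]) (card S) = (\<Prod>i\<in>S. b i)" by auto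
qed

text \<open>The hypothesis says that \<open>g\<close> times the product of the \<open>(\<gamma>_i + \<beta>_i x)\<close> to the powers
  \<open>b_i / l_i\<close> has derivative 0. Comparing leading coefficients, its total degree
  \<open>deg g + \<Sum> b_i / l_i\<close> vanishes, and all summands are non-negative.\<close>

lemma log_derivative_eq_0:
  fixes g :: "'k::field_char_0 poly" and b l :: "'i \<Rightarrow> nat"
  assumes S: "finite S" "N \<subseteq> S" and \<beta>: "\<And>i. i \<in> N \<Longrightarrow> \<beta> i \<noteq> 0"
    and \<gamma>: "\<And>i. i \<in> S \<Longrightarrow> \<gamma> i \<noteq> 0 \<or> \<beta> i \<noteq> 0" and l: "\<And>i. i \<in> N \<Longrightarrow> l i > 0"
    and g: "g \<noteq> 0"
    and eq: "\<And>x. (\<And>i. i \<in> S \<Longrightarrow> \<gamma> i + \<beta> i * x \<noteq> 0) \<Longrightarrow>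
      poly (pderiv g) x + poly g x * (\<Sum>i\<in>N. of_nat (b i) * \<beta> i / (of_nat (l i) * (\<gamma> i + \<beta> i * x))) = 0"
  shows "Polynomial.degree g = 0" and "\<And>i. i \<in> N \<Longrightarrow> b i = 0"
proof -
  define L where "L i = [:\<gamma> i, \<beta> i:]" for i
  define c where "c i = (of_nat (b i) / of_nat (l i) :: 'k)" for i
  \<comment> \<open>\<open>R\<close> is x times the sum in \<open>eq\<close> with denominators
    cleared, and \<open>P\<close> is x times the whole equation, cleared likewise. The factor x
    makes deg g a degree bound for x g', with coefficient deg g times the leading one there, even
    when deg g = 0.\<close>
  define R where "R = (\<Sum>i\<in>N. Polynomial.smult (c i) ([:0, \<beta> i:] * (\<Prod>k\<in>N - {i}. L k)))"
  define P where "P = pCons 0 (pderiv g) * (\<Prod>i\<in>N. L i) + g * R"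
  have fin: "finite N" using S finite_subset by blast
  have L: "poly (L i) x = \<gamma> i + \<beta> i * x" for i x by (simp add: L_def algebra_simps)
  have "poly P x = 0" if x: "\<And>i. i \<in> S \<Longrightarrow> poly (L i) x \<noteq> 0" for x
  proof -
    have "poly (Polynomial.smult (c i) ([:0, \<beta> i:] * (\<Prod>k\<in>N - {i}. L k))) x =
        x * (\<Prod>i\<in>N. poly (L i) x) * (of_nat (b i) * \<beta> i / (of_nat (l i) * (\<gamma> i + \<beta> i * x)))" if i: "i \<in> N" for i
    proof -
      have "(\<Prod>i\<in>N. poly (L i) x) = poly (L i) x * (\<Prod>i\<in>N - {i}. poly (L i) x)"
        by (rule prod.remove[OF fin i])
      moreover have "\<gamma> i + \<beta> i * x \<noteq> 0" using x[of i] S i by (auto simp: L)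
      ultimately show ?thesis
        by (simp add: c_def poly_prod L)
    qed
    then have "poly R x =
        x * (\<Prod>i\<in>N. poly (L i) x) * (\<Sum>i\<in>N. of_nat (b i) * \<beta> i / (of_nat (l i) * (\<gamma> i + \<beta> i * x)))"
      unfolding R_def poly_sum sum_distrib_left by (rule sum.cong[OF refl])
    then have "poly P x = x * (\<Prod>i\<in>N. poly (L i) x) * (poly (pderiv g) x +
        poly g x * (\<Sum>i\<in>N. of_nat (b i) * \<beta> i / (of_nat (l i) * (\<gamma> i + \<beta> i * x))))"
      by (simp add: P_def poly_prod algebra_simps)
    then show ?thesis using eq[of x] x by (simp add: L)
  qed
  \<comment> \<open>\<open>P\<close> vanishes away from the zeros of the \<open>L i\<close>, so its
    product with all of them vanishes everywhere and is the zero polynomial. No \<open>L i\<close>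
    is zero by \<open>\<gamma>\<close>.\<close>
  then have "poly (P * (\<Prod>i\<in>S. L i)) x = 0" for x
    using S(1) by (auto simp: poly_prod)
  then have "P * (\<Prod>i\<in>S. L i) = 0" using poly_all_0_iff_0 by blast
  then have P: "P = 0" using S(1) \<gamma> by (auto simp: L_def)
  let ?d = "Polynomial.degree g" and ?B = "\<Prod>i\<in>N. \<beta> i"
  have "Polynomial.degree (pCons 0 (pderiv g)) \<le> ?d"
    by (cases "?d = 0") (auto simp: degree_pderiv pderiv_eq_0_iff degree_pCons_eq_if)
  then have 1: "poly.coeff (pCons 0 (pderiv g) * (\<Prod>i\<in>N. L i)) (?d + card N) =
      of_nat ?d * Polynomial.lead_coeff g * ?B"
    using coeff_mult_upper[OF _ prod_linear_upper(1)[OF fin], of "pCons 0 (pderiv g)" ?d \<gamma> \<beta>]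
      prod_linear_upper(2)[OF fin, of \<gamma> \<beta>]
    by (simp add: L_def coeff_pCons coeff_pderiv split: nat.splits del: mult_pCons_left)
  have 2: "Polynomial.degree ([:0, \<beta> i:] * (\<Prod>k\<in>N - {i}. L k)) \<le> card N \<and>
      poly.coeff ([:0, \<beta> i:] * (\<Prod>k\<in>N - {i}. L k)) (card N) = ?B" if i: "i \<in> N" for i
  proof -
    \<comment> \<open>Giving the i-th factor the constant term 0 writes the summand as a product of
      \<open>card N\<close> linear factors.\<close>
    have "([:0, \<beta> i:] * (\<Prod>k\<in>N - {i}. L k)) = (\<Prod>k\<in>N. [:if k = i then 0 else \<gamma> k, \<beta> k:])"
      unfolding prod.remove[OF fin i] by (simp add: L_def)
    then show ?thesis
      using prod_linear_upper[OF fin, of "\<lambda>k. if k = i then 0 else \<gamma> k" \<beta>] by simp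
  qed
  have 3: "poly.coeff R (card N) = (\<Sum>i\<in>N. c i) * ?B"
    using 2 by (simp add: R_def coeff_sum sum_distrib_right del: mult_pCons_left)
  have "Polynomial.degree R \<le> card N"
    unfolding R_def using 2 by (intro degree_sum_le fin) (meson degree_smult_le order.trans)
  then have "poly.coeff P (?d + card N) = (of_nat ?d + (\<Sum>i\<in>N. c i)) * (Polynomial.lead_coeff g * ?B)"
    unfolding P_def coeff_add 1 by (subst coeff_mult_upper) (simp_all add: 3 algebra_simps)
  moreover have "Polynomial.lead_coeff g * ?B \<noteq> 0" using g \<beta> fin by auto
  ultimately have "of_nat ?d + (\<Sum>i\<in>N. c i) = 0" using P by auto
  \<comment> \<open>The field has no order, so the sum is pulled back along the embedding of the
    rationals, where non-negativity of the summands can be used.\<close>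
  moreover have "of_nat ?d + (\<Sum>i\<in>N. c i) = of_rat (of_nat ?d + (\<Sum>i\<in>N. of_nat (b i) / of_nat (l i)))"
    by (simp add: c_def of_rat_add of_rat_sum of_rat_divide)
  ultimately have rat: "(of_nat ?d + (\<Sum>i\<in>N. of_nat (b i) / of_nat (l i)) :: rat) = 0"
    by (simp only: of_rat_eq_0_iff)
  have nn: "(0::rat) \<le> (\<Sum>i\<in>N. of_nat (b i) / of_nat (l i))" by (intro sum_nonneg) auto
  with rat show "?d = 0"
    by (metis add_nonneg_eq_0_iff of_nat_0_le_iff of_nat_eq_0_iff)
  with rat have "(\<Sum>i\<in>N. of_nat (b i) / of_nat (l i) :: rat) = 0" by simp
  then have "\<forall>i\<in>N. of_nat (b i) / of_nat (l i) = (0::rat)"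
    by (subst (asm) sum_nonneg_eq_0_iff) (auto simp: fin)
  with l show "b i = 0" if "i \<in> N" for i using that by fastforce
qed

section \<open>Congruence modulo the trinomial relations\<close>

lemma finite_tri_indices: "finite (tri_indices D)"
  by (simp add: tri_indices_def)

lemma finite_tri_vars: "finite (tri_vars D)"
  by (simp add: tri_vars_def finite_tri_indices)

text \<open>Congruence modulo the ideal, bundled with membership of both sides so that the rules for
  sums, products and powers carry no side conditions.\<close>

definition tri_eq :: "'k::field trinomial_data \<Rightarrow> (tvar, 'k) mpoly \<Rightarrow> (tvar, 'k) mpoly \<Rightarrow> bool" where
  "tri_eq D f g \<longleftrightarrow> f \<in> carrier (tri_poly_ring D) \<and> g \<in> carrier (tri_poly_ring D) \<and>
     tri_cls D f = tri_cls D g"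

context
  fixes D :: "'k::field trinomial_data"
begin

lemma tri_cls_add:
  assumes "f \<in> carrier (tri_poly_ring D)" "g \<in> carrier (tri_poly_ring D)"
  shows "tri_cls D (f + g) = tri_cls D f \<oplus>\<^bsub>tri_alg D\<^esub> tri_cls D g"
  using ring_hom_add[OF tri_cls_hom assms] by (simp add: mpoly_ring_simps)

lemma tri_cls_mult:
  assumes "f \<in> carrier (tri_poly_ring D)" "g \<in> carrier (tri_poly_ring D)"
  shows "tri_cls D (f * g) = tri_cls D f \<otimes>\<^bsub>tri_alg D\<^esub> tri_cls D g"
  using ring_hom_mult[OF tri_cls_hom assms] by (simp add: mpoly_ring_simps)

lemma tri_eq_iff:
  "tri_eq D f g \<longleftrightarrow> f \<in> carrier (tri_poly_ring D) \<and> g \<in> carrier (tri_poly_ring D) \<and> f - g \<in> tri_ideal D"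
  unfolding tri_eq_def using tri_cls_eq_iff by blast

lemma tri_eq_refl: "f \<in> carrier (tri_poly_ring D) \<Longrightarrow> tri_eq D f f"
  by (simp add: tri_eq_def)

lemma tri_eq_add: "tri_eq D f f' \<Longrightarrow> tri_eq D g g' \<Longrightarrow> tri_eq D (f + g) (f' + g')"
  by (simp add: tri_eq_def tri_cls_add mpoly_ring_add)

lemma tri_eq_mult: "tri_eq D f f' \<Longrightarrow> tri_eq D g g' \<Longrightarrow> tri_eq D (f * g) (f' * g')"
  by (simp add: tri_eq_def tri_cls_mult mpoly_ring_mult)

lemma tri_eq_power: "tri_eq D f f' \<Longrightarrow> tri_eq D (f ^ n) (f' ^ n)"
  by (induction n) (simp_all add: tri_eq_mult tri_eq_refl mpoly_ring_one)

lemma tri_eq_prod: "(\<And>x. x \<in> S \<Longrightarrow> tri_eq D (f x) (g x)) \<Longrightarrow> tri_eq D (\<Prod>x\<in>S. f x) (\<Prod>x\<in>S. g x)"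
  by (induction S rule: infinite_finite_induct) (simp_all add: tri_eq_mult tri_eq_refl mpoly_ring_one)

lemma tri_eq_sum: "(\<And>x. x \<in> S \<Longrightarrow> tri_eq D (f x) (g x)) \<Longrightarrow> tri_eq D (\<Sum>x\<in>S. f x) (\<Sum>x\<in>S. g x)"
  by (induction S rule: infinite_finite_induct) (simp_all add: tri_eq_add tri_eq_refl mpoly_ring_zero)

lemma tri_eq_mult_0: "tri_eq D f 0 \<Longrightarrow> g \<in> carrier (tri_poly_ring D) \<Longrightarrow> tri_eq D (f * g) 0"
  using tri_eq_mult[of f 0 g g] tri_eq_refl[of g] by simp

lemma tri_cls_eq_zero_iff:
  "f \<in> carrier (tri_poly_ring D) \<Longrightarrow> tri_cls D f = \<zero>\<^bsub>tri_alg D\<^esub> \<longleftrightarrow> tri_eq D f 0"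
  by (simp add: tri_eq_def mpoly_ring_zero flip: tri_cls_0_1(1))

lemma tri_rel_in_ideal: "i + 2 \<le> tri_r D \<Longrightarrow> tri_rel D i \<in> tri_ideal D"
  unfolding tri_ideal_def
  by (rule subsetD[OF ring.genideal_self[OF cring.axioms(1)[OF cring_mpoly_ring]]])
     (auto simp: tri_rel_closed)

text \<open>The polynomials of the ring that vanish at \<open>a\<close> form an ideal, and it
  contains the generators of \<open>tri_ideal D\<close>.\<close>

lemma tri_ideal_eval_eq_0:
  assumes a: "\<And>i. i + 2 \<le> tri_r D \<Longrightarrow> mpeval (\<lambda>x. x) a (tri_rel D i) = 0" and f: "f \<in> tri_ideal D"
  shows "mpeval (\<lambda>x. x) a f = 0"
proof -
  interpret P: cring "tri_poly_ring D" by (rule cring_mpoly_ring)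
  interpret ev: comm_ring_hom "mpeval (\<lambda>x. x) a" by (rule comm_ring_hom_mpeval[OF comm_ring_hom_id])
  let ?J = "{f \<in> carrier (tri_poly_ring D). mpeval (\<lambda>x. x) a f = 0}"
  have "ideal ?J (tri_poly_ring D)"
  proof (rule idealI)
    show "ring (tri_poly_ring D)" by (rule P.ring_axioms)
    show "subgroup ?J (add_monoid (tri_poly_ring D))"
    proof (rule P.add.subgroupI)
      have "0 \<in> ?J" using mpoly_ring_zero ev.hom_zero by simp
      then show "?J \<noteq> {}" by blast
      fix f assume f: "f \<in> ?J"
      then have "\<ominus>\<^bsub>tri_poly_ring D\<^esub> f = - f"
        using P.minus_equality[of "- f" f] by (simp add: mpoly_ring_simps mpoly_ring_uminus)
      with f show "\<ominus>\<^bsub>tri_poly_ring D\<^esub> f \<in> ?J" by (auto simp: mpoly_ring_uminus ev.hom_uminus)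
    qed (auto simp: mpoly_ring_simps mpoly_ring_add ev.hom_add)
  qed (auto simp: mpoly_ring_simps mpoly_ring_mult ev.hom_mult)
  moreover have "{tri_rel D i | i. i + 2 \<le> tri_r D} \<subseteq> ?J"
    using a tri_rel_closed by auto
  ultimately show ?thesis
    using P.genideal_minimal f unfolding tri_ideal_def by blast
qed

text \<open>Linearity and the Leibniz rule determine a derivation from its values on generators, so
  any lift \<open>g\<close> of these values computes \<open>\<delta>\<close> on
  representatives.\<close>

lemma derivation_eq_mpder:
  assumes \<delta>: "tri_derivation D \<delta>"
    and g: "\<And>v. v \<in> tri_vars D \<Longrightarrow> g v \<in> carrier (tri_poly_ring D)"
    and v: "\<And>v. v \<in> tri_vars D \<Longrightarrow> \<delta> (tri_cls D (mvar v)) = tri_cls D (g v)"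
    and f: "f \<in> carrier (tri_poly_ring D)"
  shows "\<delta> (tri_cls D f) = tri_cls D (mpder (tri_vars D) g f)"
  using f
proof (induction rule: mpoly_ring_induct)
  case (const c)
  interpret R: ring "tri_alg D" by (rule tri_alg_ring)
  have car: "tri_cls D f \<in> carrier (tri_alg D)" if "f \<in> carrier (tri_poly_ring D)" for f
    using that by (simp add: tri_alg_carrier)
  have one: "tri_cls D 1 = \<one>\<^bsub>tri_alg D\<^esub>" by (rule tri_cls_0_1)
  have \<delta>c: "\<delta> x \<in> carrier (tri_alg D)" if "x \<in> carrier (tri_alg D)" for x
    using \<delta> that by (auto simp: tri_derivation_def)
  \<comment> \<open>The Leibniz rule for 1 * 1 shows that 1 is sent to 0; linearity over the field
    then kills all constants.\<close>
  have "\<delta> (\<one>\<^bsub>tri_alg D\<^esub> \<otimes>\<^bsub>tri_alg D\<^esub> \<one>\<^bsub>tri_alg D\<^esub>) = (\<delta> \<one>\<^bsub>tri_alg D\<^esub> \<otimes>\<^bsub>tri_alg D\<^esub> \<one>\<^bsub>tri_alg D\<^esub>) \<oplus>\<^bsub>tri_alg D\<^esub> (\<one>\<^bsub>tri_alg D\<^esub> \<otimes>\<^bsub>tri_alg D\<^esub> \<delta> \<one>\<^bsub>tri_alg D\<^esub>)"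
    using \<delta> R.one_closed unfolding tri_derivation_def by blast
  then have "\<delta> \<one>\<^bsub>tri_alg D\<^esub> = \<zero>\<^bsub>tri_alg D\<^esub>"
    using \<delta>c[OF R.one_closed] R.add.l_cancel_one by auto
  moreover have "\<delta> (tri_cls D (mconst c) \<otimes>\<^bsub>tri_alg D\<^esub> \<one>\<^bsub>tri_alg D\<^esub>) =
      tri_cls D (mconst c) \<otimes>\<^bsub>tri_alg D\<^esub> \<delta> \<one>\<^bsub>tri_alg D\<^esub>"
    using \<delta> R.one_closed unfolding tri_derivation_def by blast
  ultimately show ?case
    using car[OF mpoly_ring_const] by (simp add: tri_cls_0_1)
next
  case (var w)
  then show ?case by (simp add: v mpder_mvar finite_tri_vars)
next
  case (add f h)
  have "\<delta> (tri_cls D f \<oplus>\<^bsub>tri_alg D\<^esub> tri_cls D h) = \<delta> (tri_cls D f) \<oplus>\<^bsub>tri_alg D\<^esub> \<delta> (tri_cls D h)"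
    using \<delta> add(1,2) unfolding tri_derivation_def tri_alg_carrier by blast
  with add show ?case by (simp add: tri_cls_add mpder_add mpder_closed g)
next
  case (mult f h)
  have "\<delta> (tri_cls D f \<otimes>\<^bsub>tri_alg D\<^esub> tri_cls D h) =
      (\<delta> (tri_cls D f) \<otimes>\<^bsub>tri_alg D\<^esub> tri_cls D h) \<oplus>\<^bsub>tri_alg D\<^esub> (tri_cls D f \<otimes>\<^bsub>tri_alg D\<^esub> \<delta> (tri_cls D h))"
    using \<delta> mult(1,2) unfolding tri_derivation_def tri_alg_carrier by blast
  with mult show ?case
    by (simp add: tri_cls_add tri_cls_mult mpder_mult mpder_closed g mpoly_ring_mult)
qed

end

section \<open>The homogeneous elements\<close>

definition tri_mon_exp :: "'k trinomial_data \<Rightarrow> nat \<Rightarrow> nat \<Rightarrow> (tvar \<Rightarrow>\<^sub>0 nat)" where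
  "tri_mon_exp D i n = (\<Sum>j=1..tri_n D i. Poly_Mapping.single (TV i j) (n * tri_l D i j))"

lemma tri_mon_power: "tri_mon D i ^ n = Poly_Mapping.single (tri_mon_exp D i n) 1"
  unfolding tri_mon_def tri_mon_exp_def prod_power_distrib power_mult[symmetric]
  by (simp add: mvar_power prod_single mult.commute)

lemma lookup_tri_mon_exp:
  "Poly_Mapping.lookup (tri_mon_exp D i n) (TV i' j) = (if i' = i \<and> j \<in> {1..tri_n D i} then n * tri_l D i j else 0)"
  "Poly_Mapping.lookup (tri_mon_exp D i n) (SV k) = 0"
  by (auto simp: tri_mon_exp_def lookup_sum lookup_single when_def sum.delta)

text \<open>Equality of degrees without quotient groups: the integer row space of \<open>P_0\<close>
  consists of the vectors that equal k_i l_i on block i and 0 on the S_k, subject to k_0 + ... + k_r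
  = 0.\<close>

definition tri_shift :: "'k trinomial_data \<Rightarrow> (tvar \<Rightarrow>\<^sub>0 nat) \<Rightarrow> (tvar \<Rightarrow>\<^sub>0 nat) \<Rightarrow> bool" where
  "tri_shift D \<mu> \<nu> \<longleftrightarrow> (\<exists>k :: nat \<Rightarrow> int. (\<Sum>i\<le>tri_r D. k i) = 0 \<and>
     (\<forall>i j. (i, j) \<in> tri_indices D \<longrightarrow> int (Poly_Mapping.lookup \<mu> (TV i j)) =
        int (Poly_Mapping.lookup \<nu> (TV i j)) + int (tri_l D i j) * k i) \<and>
     (\<forall>s\<in>{1..tri_m D}. Poly_Mapping.lookup \<mu> (SV s) = Poly_Mapping.lookup \<nu> (SV s)))"

lemma tri_shift_refl: "tri_shift D \<mu> \<mu>"
  unfolding tri_shift_def by (intro exI[of _ "\<lambda>_. 0"]) simp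

lemma tri_shift_sym: "tri_shift D \<mu> \<nu> \<Longrightarrow> tri_shift D \<nu> \<mu>"
  unfolding tri_shift_def
proof (elim exE conjE, goal_cases)
  case (1 k)
  then show ?case by (intro exI[of _ "\<lambda>i. - k i"]) (auto simp: sum_negf)
qed

lemma tri_shift_add: "tri_shift D \<mu> \<nu> \<Longrightarrow> tri_shift D \<mu>' \<nu>' \<Longrightarrow> tri_shift D (\<mu> + \<mu>') (\<nu> + \<nu>')"
  unfolding tri_shift_def
proof (elim exE conjE, goal_cases)
  case (1 k k')
  then show ?case
    by (intro exI[of _ "\<lambda>i. k i + k' i"]) (auto simp: sum.distrib lookup_add algebra_simps)
qed

lemma tri_shift_trans: "tri_shift D \<mu> \<nu> \<Longrightarrow> tri_shift D \<nu> \<rho> \<Longrightarrow> tri_shift D \<mu> \<rho>"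
  unfolding tri_shift_def
proof (elim exE conjE, goal_cases)
  case (1 k k')
  then show ?case
    by (intro exI[of _ "\<lambda>i. k i + k' i"]) (auto simp: sum.distrib algebra_simps)
qed

lemma tri_shift_mon_exp:
  assumes "i \<le> tri_r D" "i' \<le> tri_r D"
  shows "tri_shift D (tri_mon_exp D i n) (tri_mon_exp D i' n)"
  unfolding tri_shift_def
  \<comment> \<open>The exponents differ by +n at \<open>i\<close> and -n at \<open>i'\<close>;
    separate conditionals let them cancel when \<open>i = i'\<close>.\<close>
  by (rule exI[of _ "\<lambda>k. (if k = i then int n else 0) - (if k = i' then int n else 0)"])
     (use assms in \<open>auto simp: lookup_tri_mon_exp sum_subtractf sum.delta tri_indices_def\<close>)

lemma tri_im_P0T_closed:
  "0 \<in> tri_im_P0T D"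
  "x \<in> tri_im_P0T D \<Longrightarrow> y \<in> tri_im_P0T D \<Longrightarrow> x + y \<in> tri_im_P0T D"
  "x \<in> tri_im_P0T D \<Longrightarrow> - x \<in> tri_im_P0T D"
proof -
  show "0 \<in> tri_im_P0T D"
    by (auto simp: tri_im_P0T_def free_Abelian_group_def intro!: exI[of _ "\<lambda>_. 0"])
  show "x + y \<in> tri_im_P0T D" if xy: "x \<in> tri_im_P0T D" "y \<in> tri_im_P0T D"
  proof -
    obtain u u' where u: "\<forall>v\<in>tri_vars D. Poly_Mapping.lookup x v = (\<Sum>i=1..tri_r D. tri_P0 D i v * u i)"
      "\<forall>v\<in>tri_vars D. Poly_Mapping.lookup y v = (\<Sum>i=1..tri_r D. tri_P0 D i v * u' i)"
      using xy by (auto simp: tri_im_P0T_def)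
    then have "\<forall>v\<in>tri_vars D. Poly_Mapping.lookup (x + y) v = (\<Sum>i=1..tri_r D. tri_P0 D i v * (u i + u' i))"
      by (simp add: lookup_add sum.distrib distrib_left)
    moreover have "x + y \<in> carrier (tri_Z D)"
      using xy Poly_Mapping.keys_add[of x y] by (auto simp: tri_im_P0T_def free_Abelian_group_def)
    ultimately show ?thesis by (auto simp: tri_im_P0T_def)
  qed
  show "- x \<in> tri_im_P0T D" if x: "x \<in> tri_im_P0T D"
  proof -
    obtain u where u: "\<forall>v\<in>tri_vars D. Poly_Mapping.lookup x v = (\<Sum>i=1..tri_r D. tri_P0 D i v * u i)"
      using x by (auto simp: tri_im_P0T_def)
    then have "\<exists>u. \<forall>v\<in>tri_vars D. Poly_Mapping.lookup (- x) v = (\<Sum>i=1..tri_r D. tri_P0 D i v * u i)"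
      by (intro exI[of _ "\<lambda>i. - u i"]) (simp add: sum_negf)
    moreover have "- x \<in> carrier (tri_Z D)"
      using x by (auto simp: tri_im_P0T_def free_Abelian_group_def)
    ultimately show ?thesis unfolding tri_im_P0T_def by simp
  qed
qed

lemma tri_Q_eq_iff: "tri_Q D w = tri_Q D w' \<longleftrightarrow> w - w' \<in> tri_im_P0T D"
proof -
  have Q: "tri_Q D w = {h + w | h. h \<in> tri_im_P0T D}" for w
    by (auto simp: tri_Q_def r_coset_def free_Abelian_group_def)
  show ?thesis
  proof
    assume "tri_Q D w = tri_Q D w'"
    moreover have "w \<in> tri_Q D w" unfolding Q using tri_im_P0T_closed(1) by force
    ultimately show "w - w' \<in> tri_im_P0T D" by (auto simp: Q)
  next
    have sub: "tri_Q D w \<subseteq> tri_Q D w'" if "w - w' \<in> tri_im_P0T D" for w w'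
    proof
      fix x assume "x \<in> tri_Q D w"
      then obtain h where h: "x = h + w" "h \<in> tri_im_P0T D" by (auto simp: Q)
      then have "x = (h + (w - w')) + w'" "h + (w - w') \<in> tri_im_P0T D"
        using that tri_im_P0T_closed(2) by auto
      then show "x \<in> tri_Q D w'" unfolding Q by blast
    qed
    assume "w - w' \<in> tri_im_P0T D"
    moreover from tri_im_P0T_closed(3)[OF this] have "w' - w \<in> tri_im_P0T D" by simp
    ultimately show "tri_Q D w = tri_Q D w'" using sub by blast
  qed
qed

definition tri_frag :: "(tvar \<Rightarrow>\<^sub>0 nat) \<Rightarrow> (tvar \<Rightarrow>\<^sub>0 int)" where
  "tri_frag \<mu> = (\<Sum>v\<in>Poly_Mapping.keys \<mu>. frag_cmul (int (Poly_Mapping.lookup \<mu> v)) (frag_of v))"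

lemma lookup_tri_frag: "Poly_Mapping.lookup (tri_frag \<mu>) v = int (Poly_Mapping.lookup \<mu> v)"
  by (simp add: tri_frag_def lookup_sum lookup_single when_def if_distrib sum.delta in_keys_iff cong: if_cong)

lemma keys_tri_frag: "Poly_Mapping.keys (tri_frag \<mu>) = Poly_Mapping.keys \<mu>"
  by (auto simp: in_keys_iff lookup_tri_frag)

lemma tri_deg_eq_iff:
  assumes "Poly_Mapping.keys \<mu> \<subseteq> tri_vars D" "Poly_Mapping.keys \<nu> \<subseteq> tri_vars D"
  shows "tri_deg D \<mu> = tri_deg D \<nu> \<longleftrightarrow> tri_shift D \<mu> \<nu>"
proof -
  have car: "tri_frag \<mu> - tri_frag \<nu> \<in> carrier (tri_Z D)"
    using assms keys_diff[of "tri_frag \<mu>" "tri_frag \<nu>"] by (auto simp: free_Abelian_group_def keys_tri_frag)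
  have S: "(\<Sum>i=1..tri_r D. tri_P0 D i (SV s) * u i) = 0" for u s
    by (simp add: tri_P0_def)
  have T0: "(\<Sum>i=1..tri_r D. tri_P0 D i (TV 0 j) * u i) = - int (tri_l D 0 j) * (\<Sum>i=1..tri_r D. u i)" for u j
    by (simp add: tri_P0_def sum_distrib_left sum_negf)
  have T: "(\<Sum>i=1..tri_r D. tri_P0 D i (TV k j) * u i) = int (tri_l D k j) * u k"
    if "1 \<le> k" "k \<le> tri_r D" for u k j
  proof -
    have "(\<Sum>i=1..tri_r D. tri_P0 D i (TV k j) * u i) = (\<Sum>i=1..tri_r D. if i = k then int (tri_l D k j) * u k else 0)"
      by (rule sum.cong) (use that in \<open>auto simp: tri_P0_def\<close>)
    then show ?thesis using that by simp
  qed
  have split: "(\<Sum>i\<le>tri_r D. k i) = k 0 + (\<Sum>i=1..tri_r D. k i)" for k :: "nat \<Rightarrow> int"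
    using sum.atLeast_Suc_atMost[of 0 "tri_r D" k] by (simp add: atMost_atLeast0)
  have "tri_deg D \<mu> = tri_deg D \<nu> \<longleftrightarrow> (\<exists>u. \<forall>v\<in>tri_vars D.
      int (Poly_Mapping.lookup \<mu> v) - int (Poly_Mapping.lookup \<nu> v) = (\<Sum>i=1..tri_r D. tri_P0 D i v * u i))"
    using car by (auto simp: tri_deg_def tri_Q_eq_iff tri_im_P0T_def lookup_minus lookup_tri_frag simp flip: tri_frag_def)
  also have "\<dots> \<longleftrightarrow> tri_shift D \<mu> \<nu>"
  proof
    assume "\<exists>u. \<forall>v\<in>tri_vars D.
      int (Poly_Mapping.lookup \<mu> v) - int (Poly_Mapping.lookup \<nu> v) = (\<Sum>i=1..tri_r D. tri_P0 D i v * u i)"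
    then obtain u where u: "int (Poly_Mapping.lookup \<mu> v) - int (Poly_Mapping.lookup \<nu> v) =
      (\<Sum>i=1..tri_r D. tri_P0 D i v * u i)" if "v \<in> tri_vars D" for v by blast
    \<comment> \<open>Every row of \<open>P_0\<close> has -l_0 in block 0, so the multiplier of that
      block is minus the sum of the others.\<close>
    define k where "k i = (if i = 0 then - (\<Sum>i=1..tri_r D. u i) else u i)" for i
    have "int (Poly_Mapping.lookup \<mu> (TV i j)) = int (Poly_Mapping.lookup \<nu> (TV i j)) + int (tri_l D i j) * k i"
      if "(i, j) \<in> tri_indices D" for i j
      using u[of "TV i j"] T[of i j u] T0[of j u] that
      by (cases "i = 0") (force simp: k_def tri_vars_def tri_indices_def)+
    moreover have "Poly_Mapping.lookup \<mu> (SV s) = Poly_Mapping.lookup \<nu> (SV s)" if "s \<in> {1..tri_m D}" for s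
      using u[of "SV s"] S[of s u] that by (auto simp: tri_vars_def)
    moreover have "(\<Sum>i\<le>tri_r D. k i) = 0"
      by (simp add: split k_def)
    ultimately show "tri_shift D \<mu> \<nu>" unfolding tri_shift_def by blast
  next
    assume "tri_shift D \<mu> \<nu>"
    then obtain k where k: "(\<Sum>i\<le>tri_r D. k i) = 0"
      "\<And>i j. (i, j) \<in> tri_indices D \<Longrightarrow> int (Poly_Mapping.lookup \<mu> (TV i j)) =
        int (Poly_Mapping.lookup \<nu> (TV i j)) + int (tri_l D i j) * k i"
      "\<And>s. s \<in> {1..tri_m D} \<Longrightarrow> Poly_Mapping.lookup \<mu> (SV s) = Poly_Mapping.lookup \<nu> (SV s)"
      unfolding tri_shift_def by blast
    have k0: "k 0 = - (\<Sum>i=1..tri_r D. k i)" using k(1) by (simp add: split)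
    have "int (Poly_Mapping.lookup \<mu> v) - int (Poly_Mapping.lookup \<nu> v) = (\<Sum>i=1..tri_r D. tri_P0 D i v * k i)"
      if v: "v \<in> tri_vars D" for v
    proof (cases v)
      case (TV i j)
      with v have ij: "(i, j) \<in> tri_indices D" by (auto simp: tri_vars_def)
      then show ?thesis
        using k(2)[OF ij] T[of i j k] T0[of j k] TV
        by (cases "i = 0") (auto simp: k0 tri_indices_def)
    next
      case (SV s)
      with v k(3)[of s] S[of s k] show ?thesis by (auto simp: tri_vars_def)
    qed
    then show "\<exists>u. \<forall>v\<in>tri_vars D. int (Poly_Mapping.lookup \<mu> v) - int (Poly_Mapping.lookup \<nu> v) =
      (\<Sum>i=1..tri_r D. tri_P0 D i v * u i)" by blast
  qed
  finally show ?thesis .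
qed

text \<open>The degree is recorded by a reference exponent \<open>\<nu>\<close>, so that references
  add up in products. It need not occur in \<open>f\<close>, and 0 is homogeneous at every
  reference.\<close>

definition homogeneous_at :: "'k::field trinomial_data \<Rightarrow> (tvar \<Rightarrow>\<^sub>0 nat) \<Rightarrow> (tvar, 'k) mpoly \<Rightarrow> bool" where
  "homogeneous_at D \<nu> f \<longleftrightarrow> (\<forall>\<mu>\<in>Poly_Mapping.keys f. tri_shift D \<mu> \<nu>)"

lemma homogeneous_at_mult:
  "homogeneous_at D \<nu> f \<Longrightarrow> homogeneous_at D \<nu>' g \<Longrightarrow> homogeneous_at D (\<nu> + \<nu>') (f * g)"
  unfolding homogeneous_at_def using keys_mult[of f g] by (fastforce intro: tri_shift_add)

lemma homogeneous_at_add: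
  "homogeneous_at D \<nu> f \<Longrightarrow> homogeneous_at D \<nu> g \<Longrightarrow> homogeneous_at D \<nu> (f + g)"
  unfolding homogeneous_at_def using Poly_Mapping.keys_add[of f g] by blast

lemma homogeneous_at_sum:
  "(\<And>x. x \<in> S \<Longrightarrow> homogeneous_at D \<nu> (f x)) \<Longrightarrow> homogeneous_at D \<nu> (\<Sum>x\<in>S. f x)"
  by (induction S rule: infinite_finite_induct)
     (auto intro: homogeneous_at_add, simp_all add: homogeneous_at_def)

lemma homogeneous_at_shift: "homogeneous_at D \<nu> f \<Longrightarrow> tri_shift D \<nu> \<nu>' \<Longrightarrow> homogeneous_at D \<nu>' f"
  unfolding homogeneous_at_def by (blast intro: tri_shift_trans)

lemma homogeneous_at_single: "homogeneous_at D \<nu> (Poly_Mapping.single \<nu> c)"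
  by (simp add: homogeneous_at_def tri_shift_refl)

lemma homogeneous_at_mconst: "homogeneous_at D 0 (mconst c)"
  unfolding mconst_def by (rule homogeneous_at_single)

lemma homogeneous_at_mon_power:
  "i \<le> tri_r D \<Longrightarrow> i' \<le> tri_r D \<Longrightarrow> homogeneous_at D (tri_mon_exp D i' n) (tri_mon D i ^ n)"
  unfolding tri_mon_power by (rule homogeneous_at_shift[OF homogeneous_at_single tri_shift_mon_exp])

lemma tri_homogeneous_cls:
  assumes f: "f \<in> carrier (tri_poly_ring D)" and h: "homogeneous_at D \<nu> f"
  shows "tri_homogeneous D (tri_cls D f)"
proof -
  \<comment> \<open>\<open>\<nu>\<close> may involve variables outside \<open>tri_vars D\<close>, so
    an exponent occurring in \<open>f\<close> names the degree instead; for f = 0 the exponent 0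
    does.\<close>
  obtain \<mu>0 where \<mu>0: "Poly_Mapping.keys \<mu>0 \<subseteq> tri_vars D" "\<forall>\<mu>\<in>Poly_Mapping.keys f. tri_deg D \<mu> = tri_deg D \<mu>0"
  proof (cases "Poly_Mapping.keys f = {}")
    case True
    then show ?thesis using that[of 0] by simp
  next
    case False
    then obtain \<mu>0 where \<mu>0: "\<mu>0 \<in> Poly_Mapping.keys f" by blast
    have keys: "Poly_Mapping.keys \<mu> \<subseteq> tri_vars D" if "\<mu> \<in> Poly_Mapping.keys f" for \<mu>
      using that f by (auto simp: mpoly_ring_def)
    have "tri_deg D \<mu> = tri_deg D \<mu>0" if "\<mu> \<in> Poly_Mapping.keys f" for \<mu>
      unfolding tri_deg_eq_iff[OF keys[OF that] keys[OF \<mu>0]]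
      using that \<mu>0 h unfolding homogeneous_at_def by (blast intro: tri_shift_trans tri_shift_sym)
    then show ?thesis using that[OF keys[OF \<mu>0]] by blast
  qed
  have "tri_frag \<mu>0 \<in> carrier (tri_Z D)"
    using \<mu>0(1) by (simp add: free_Abelian_group_def keys_tri_frag)
  then have "tri_deg D \<mu>0 \<in> carrier (tri_K0 D)"
    by (auto simp: tri_K0_def FactGroup_def RCOSETS_def tri_deg_def tri_Q_def simp flip: tri_frag_def)
  moreover have "tri_cls D f \<in> tri_component D (tri_deg D \<mu>0)"
    unfolding tri_component_def using f \<mu>0(2) by blast
  ultimately show ?thesis unfolding tri_homogeneous_def by blast
qed

text \<open>The monomial \<open>\<rho>\<close> below is reduced, that is, not divisible by any \<open>T_i^{l_i}\<close>. For each \<open>i\<close>,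
  an index \<open>j\<close> with \<open>\<rho>_{ij} < l_{ij}\<close> witnesses that all exponents \<open>n_i\<close> are non-negative.\<close>

lemma homogeneous_exponents:
  assumes D: "trinomial_data D" and \<mu>0: "Poly_Mapping.keys \<mu>0 \<subseteq> tri_vars D"
  shows "\<exists>\<rho> e. Poly_Mapping.keys \<rho> \<subseteq> tri_vars D \<and>
    (\<forall>\<mu>. Poly_Mapping.keys \<mu> \<subseteq> tri_vars D \<longrightarrow> tri_shift D \<mu> \<mu>0 \<longrightarrow>
       (\<exists>n. (\<Sum>i\<le>tri_r D. n i) = e \<and> \<mu> = \<rho> + (\<Sum>i\<le>tri_r D. tri_mon_exp D i (n i))))"
proof -
  let ?l = Poly_Mapping.lookup
  define q where "q i j = ?l \<mu>0 (TV i j) div tri_l D i j" for i j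
  \<comment> \<open>\<open>\<kappa> i\<close> is the largest power to which T_i^{l_i} divides the
    monomial of \<open>\<mu>0\<close>. Dividing all these powers out gives \<open>\<rho>\<close>,
    and e is the sum of the \<open>\<kappa> i\<close>.\<close>
  define \<kappa> where "\<kappa> i = Min (q i ` {1..tri_n D i})" for i
  have ne: "{1..tri_n D i} \<noteq> {}" if "i \<le> tri_r D" for i
    using D that by (auto simp: trinomial_data_def)
  have \<kappa>_le: "tri_l D i j * \<kappa> i \<le> ?l \<mu>0 (TV i j)" if "(i, j) \<in> tri_indices D" for i j
  proof -
    have "\<kappa> i \<le> q i j" unfolding \<kappa>_def using that by (intro Min_le) (auto simp: tri_indices_def)
    then have "tri_l D i j * \<kappa> i \<le> tri_l D i j * q i j" by simp
    also have "\<dots> \<le> ?l \<mu>0 (TV i j)" by (simp add: q_def)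
    finally show ?thesis .
  qed
  have \<kappa>_eq: "\<exists>j. (i, j) \<in> tri_indices D \<and> \<kappa> i = q i j" if "i \<le> tri_r D" for i
  proof -
    have "\<kappa> i \<in> q i ` {1..tri_n D i}"
      unfolding \<kappa>_def using ne[OF that] by (intro Min_in) auto
    then show ?thesis using that by (auto simp: tri_indices_def)
  qed
  have lk: "?l (\<Sum>i\<le>tri_r D. tri_mon_exp D i (n i)) (TV i j) = n i * tri_l D i j"
    if "(i, j) \<in> tri_indices D" for n i j
  proof -
    have "?l (\<Sum>i\<le>tri_r D. tri_mon_exp D i (n i)) (TV i j) = (\<Sum>k\<le>tri_r D. if k = i then n i * tri_l D i j else 0)"
      unfolding lookup_sum by (rule sum.cong) (use that in \<open>auto simp: lookup_tri_mon_exp tri_indices_def\<close>)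
    then show ?thesis using that by (simp add: tri_indices_def)
  qed
  define \<rho> where "\<rho> = \<mu>0 - (\<Sum>i\<le>tri_r D. tri_mon_exp D i (\<kappa> i))"
  have \<rho>: "?l \<rho> (TV i j) = ?l \<mu>0 (TV i j) - tri_l D i j * \<kappa> i" if "(i, j) \<in> tri_indices D" for i j
    by (simp add: \<rho>_def lookup_minus lk[OF that] mult.commute)
  have lkS: "?l (\<Sum>i\<le>tri_r D. tri_mon_exp D i (n i)) (SV s) = 0" for n s
    by (simp add: lookup_sum lookup_tri_mon_exp)
  have keys: "Poly_Mapping.keys \<rho> \<subseteq> tri_vars D"
    using \<mu>0 by (auto simp: \<rho>_def in_keys_iff lookup_minus subset_iff)
  have "\<exists>n. (\<Sum>i\<le>tri_r D. n i) = (\<Sum>i\<le>tri_r D. \<kappa> i) \<and> \<mu> = \<rho> + (\<Sum>i\<le>tri_r D. tri_mon_exp D i (n i))"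
    if \<mu>: "Poly_Mapping.keys \<mu> \<subseteq> tri_vars D" "tri_shift D \<mu> \<mu>0" for \<mu>
  proof -
    obtain k where k: "(\<Sum>i\<le>tri_r D. k i) = 0"
      "\<And>i j. (i, j) \<in> tri_indices D \<Longrightarrow> int (?l \<mu> (TV i j)) = int (?l \<mu>0 (TV i j)) + int (tri_l D i j) * k i"
      "\<And>s. s \<in> {1..tri_m D} \<Longrightarrow> ?l \<mu> (SV s) = ?l \<mu>0 (SV s)"
      using \<mu>(2) unfolding tri_shift_def by blast
    have nn: "0 \<le> int (\<kappa> i) + k i" if i: "i \<le> tri_r D" for i
    proof -
      obtain j where j: "(i, j) \<in> tri_indices D" "\<kappa> i = q i j" using \<kappa>_eq[OF i] by blast
      have l: "int (tri_l D i j) > 0" using D j by (auto simp: trinomial_data_def tri_indices_def)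
      \<comment> \<open>At an index attaining the minimum, floor division of the exponent of
        \<open>\<mu>\<close> by l_ij gives exactly \<open>\<kappa> i\<close> +
        \<open>k i\<close>.\<close>
      have "0 \<le> int (?l \<mu> (TV i j)) div int (tri_l D i j)"
        using l by (simp add: pos_imp_zdiv_nonneg_iff)
      also have "\<dots> = int (\<kappa> i) + k i"
        unfolding k(2)[OF j(1)] j(2) q_def using l by (simp add: zdiv_int)
      finally show ?thesis .
    qed
    define n where "n i = nat (int (\<kappa> i) + k i)" for i
    have n: "int (n i) = int (\<kappa> i) + k i" if "i \<le> tri_r D" for i
      using nn[OF that] by (simp add: n_def)
    have "int (\<Sum>i\<le>tri_r D. n i) = int (\<Sum>i\<le>tri_r D. \<kappa> i)"
      using k(1) n by (simp add: sum.distrib)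
    then have "(\<Sum>i\<le>tri_r D. n i) = (\<Sum>i\<le>tri_r D. \<kappa> i)" by (simp only: of_nat_eq_iff)
    moreover have "\<mu> = \<rho> + (\<Sum>i\<le>tri_r D. tri_mon_exp D i (n i))"
    proof (rule poly_mapping_eqI)
      fix v
      show "?l \<mu> v = ?l (\<rho> + (\<Sum>i\<le>tri_r D. tri_mon_exp D i (n i))) v"
      proof (cases "v \<in> tri_vars D")
        case True
        show ?thesis
        proof (cases v)
          case (TV i j)
          with True have ij: "(i, j) \<in> tri_indices D" by (auto simp: tri_vars_def)
          then have i: "i \<le> tri_r D" by (simp add: tri_indices_def)
          have "int (?l \<mu> (TV i j)) = int (?l \<rho> (TV i j)) + int (n i * tri_l D i j)"
            using k(2)[OF ij] n[OF i] \<kappa>_le[OF ij] by (simp add: \<rho>[OF ij] of_nat_diff algebra_simps)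
          then have "?l \<mu> (TV i j) = ?l \<rho> (TV i j) + n i * tri_l D i j"
            by linarith
          then show ?thesis by (simp add: TV lookup_add lk[OF ij])
        next
          case (SV s)
          with True have "s \<in> {1..tri_m D}" by (auto simp: tri_vars_def)
          with SV k(3) show ?thesis by (simp add: lookup_add lkS \<rho>_def lookup_minus)
        qed
      next
        case False
        then have "?l \<mu> v = 0" "?l \<rho> v = 0"
          using \<mu>(1) keys by (auto simp: in_keys_iff subset_iff)
        moreover have "?l (\<Sum>i\<le>tri_r D. tri_mon_exp D i (n i)) v = 0"
          using False
          by (cases v) (auto simp: lookup_sum lookup_tri_mon_exp tri_vars_def tri_indices_def image_iff intro!: sum.neutral)
        ultimately show ?thesis by (simp add: lookup_add)
      qed
    qed
    ultimately show ?thesis by blast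
  qed
  with keys show ?thesis by blast
qed

section \<open>Linear coordinates\<close>

lemma trinomial_minor_nonzero:
  assumes D: "trinomial_data (D :: 'k::field trinomial_data)" and ij: "i \<le> tri_r D" "j \<le> tri_r D" "i \<noteq> j"
  shows "tri_A D $$ (0, i) * tri_A D $$ (1, j) - tri_A D $$ (0, j) * tri_A D $$ (1, i) \<noteq> 0"
proof
  let ?A = "tri_A D"
  assume 0: "?A $$ (0, i) * ?A $$ (1, j) - ?A $$ (0, j) * ?A $$ (1, i) = 0"
  have A: "dim_row ?A = 2" "dim_col ?A = tri_r D + 1" using D by (auto simp: trinomial_data_def)
  have indep: "x = 0 \<and> y = 0"
    if "x * ?A $$ (0, i) + y * ?A $$ (0, j) = 0" "x * ?A $$ (1, i) + y * ?A $$ (1, j) = 0" for x y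
  proof -
    have "x \<cdot>\<^sub>v col ?A i + y \<cdot>\<^sub>v col ?A j = 0\<^sub>v 2"
    proof (rule eq_vecI)
      fix k assume "k < dim_vec (0\<^sub>v 2 :: 'k vec)"
      then consider "k = 0" | "k = 1" by fastforce
      then show "(x \<cdot>\<^sub>v col ?A i + y \<cdot>\<^sub>v col ?A j) $ k = 0\<^sub>v 2 $ k"
        by cases (use A ij that in auto)
    qed (use A in simp)
    then show ?thesis using D ij by (auto simp: trinomial_data_def)
  qed
  \<comment> \<open>With a vanishing minor, the entries of row 1 are coefficients of a relation
    between the columns and hence 0; the entries of row 0 then give another relation. So column
    \<open>i\<close> is zero, against independence.\<close>
  from indep[of "?A $$ (1, j)" "- ?A $$ (1, i)"] 0 have "?A $$ (1, i) = 0" "?A $$ (1, j) = 0"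
    by (auto simp: mult.commute)
  moreover from this indep[of "?A $$ (0, j)" "- ?A $$ (0, i)"] have "?A $$ (0, i) = 0" by (auto simp: mult.commute)
  ultimately show False using indep[of 1 0] by simp
qed

text \<open>The relation \<open>g_i\<close> expresses each of its three monomials through the other two, and it
  also holds for the linear forms \<open>\<gamma>_i Z + \<beta>_i W\<close>.\<close>

lemma tri_mon_linear:
  fixes D :: "'k::field trinomial_data"
  assumes D: "trinomial_data D" "2 \<le> tri_r D"
    and \<gamma>: "\<And>i. \<gamma> i = tri_A D $$ (0, i) * u0 + tri_A D $$ (1, i) * u1"
    and \<beta>: "\<And>i. \<beta> i = tri_A D $$ (0, i) * y0 + tri_A D $$ (1, i) * y1"
    and Z: "Z \<in> carrier (tri_poly_ring D)" and W: "W \<in> carrier (tri_poly_ring D)"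
    and T1: "tri_mon D 1 = mconst (\<gamma> 1) * Z + mconst (\<beta> 1) * W"
    and T2: "tri_mon D 2 = mconst (\<gamma> 2) * Z + mconst (\<beta> 2) * W"
    and i: "i \<le> tri_r D"
  shows "tri_eq D (tri_mon D i) (mconst (\<gamma> i) * Z + mconst (\<beta> i) * W)"
proof -
  let ?A = "tri_A D" and ?I = "tri_ideal D"
  define E where "E i = tri_mon D i - (mconst (\<gamma> i) * Z + mconst (\<beta> i) * W)" for i
  define m where "m i j = ?A $$ (0, i) * ?A $$ (1, j) - ?A $$ (0, j) * ?A $$ (1, i)" for i j
  \<comment> \<open>The linear forms drop out of the determinant: \<open>\<gamma>\<close> and
    \<open>\<beta>\<close> are combinations of the rows of A, so a first row built from them depends
    on the other two. Only the errors \<open>E\<close> remain.\<close>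
  have rel: "tri_rel D i = mconst (m (i+1) (i+2)) * E i - mconst (m i (i+2)) * E (i+1) + mconst (m i (i+1)) * E (i+2)" for i
    unfolding tri_rel_def det_3_rows E_def m_def \<gamma> \<beta>
    by (simp add: mconst.hom_add mconst.hom_mult mconst.hom_minus algebra_simps)
  have P: "mconst (\<gamma> i) * Z + mconst (\<beta> i) * W \<in> carrier (tri_poly_ring D)" for i
    using Z W by (intro mpoly_ring_add mpoly_ring_mult mpoly_ring_const)
  have E_P: "E i \<in> carrier (tri_poly_ring D)" if "i \<le> tri_r D" for i
    unfolding E_def using that P by (intro mpoly_ring_diff tri_mon_closed)
  have cancel: "tri_eq D f 0" if f: "f \<in> carrier (tri_poly_ring D)" "tri_eq D (mconst c * f) 0" "c \<noteq> 0" for c f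
  proof -
    have "tri_eq D (mconst c * f * mconst (1 / c)) 0"
      using f(2) mpoly_ring_const by (rule tri_eq_mult_0)
    moreover have "mconst c * f * mconst (1 / c) = mconst (c * (1 / c)) * f"
      unfolding mconst.hom_mult by (simp only: mult_ac)
    ultimately show ?thesis using f(3) by (simp add: mconst.hom_one)
  qed
  have relE: "tri_eq D (mconst (m (i+1) (i+2)) * E i - mconst (m i (i+2)) * E (i+1) + mconst (m i (i+1)) * E (i+2)) 0"
    if "i + 2 \<le> tri_r D" for i
    unfolding rel[symmetric]
    using tri_rel_in_ideal[OF that] tri_rel_closed[OF that] by (simp add: tri_eq_iff mpoly_ring_zero)
  have lin: "tri_eq D (mconst c * f + mconst d * g) 0" if "tri_eq D f 0" "tri_eq D g 0" for c d f g
    using tri_eq_add[OF tri_eq_mult[OF tri_eq_refl[OF mpoly_ring_const[of c]] that(1)]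
        tri_eq_mult[OF tri_eq_refl[OF mpoly_ring_const[of d]] that(2)]] by simp
  have E12: "E 1 = 0" "E 2 = 0" unfolding E_def T1 T2 by simp_all
  have "tri_eq D (E i) 0"
    using i
  proof (induction i rule: less_induct)
    case (less i)
    \<comment> \<open>The errors at 1 and 2 are exactly 0. Relation 0 is solved for its first term
      to reach index 0, and relation i - 2 for its last term to reach i.\<close>
    consider "i = 0" | "i = 1" | "i = 2" | "3 \<le> i" by linarith
    then show ?case
    proof cases
      case 1
      have "tri_eq D (mconst (m 1 2) * E 0) 0"
        using relE[of 0] D(2) by (simp only: add_0 E12 mult_zero_right diff_0_right add_0_right)
      moreover have "m 1 2 \<noteq> 0"
        unfolding m_def using D(2) by (intro trinomial_minor_nonzero[OF D(1)]) auto
      ultimately have "tri_eq D (E 0) 0" by (intro cancel[OF E_P]) auto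
      with 1 show ?thesis by simp
    next
      case 4
      then obtain k where 4: "i = k + 2" "1 \<le> k" by (intro that[of "i - 2"]) auto
      have k: "tri_eq D (E k) 0" "tri_eq D (E (k+1)) 0"
        using less.IH[of k] less.IH[of "k+1"] less.prems 4 by auto
      have "tri_eq D (mconst (m k (k+2)) * E (k+1) + mconst (- m (k+1) (k+2)) * E k) 0"
        using k by (intro lin)
      from tri_eq_add[OF relE[of k] this] have "tri_eq D (mconst (m k (k+1)) * E (k+2)) 0"
        using less.prems 4 by (simp add: mconst.hom_uminus)
      moreover have "m k (k+1) \<noteq> 0"
        unfolding m_def using 4 less.prems by (intro trinomial_minor_nonzero[OF D(1)]) auto
      ultimately have "tri_eq D (E (k+2)) 0"
        using 4(1) less.prems by (intro cancel[OF E_P]) auto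
      then show ?thesis using 4(1) by simp
    qed (use E12 in \<open>simp_all add: tri_eq_refl mpoly_ring_zero\<close>)
  qed
  then show ?thesis
    using tri_mon_closed[OF i] P[of i] by (auto simp: tri_eq_iff E_def)
qed

text \<open>By \<open>homogeneous_exponents\<close> the monomials of a nonzero \<open>f\<close>
  share a factor \<open>\<rho>\<close>, and the cofactors are products of powers of the T_i^{l_i}
  with the same total exponent e. Inserting the linear forms makes each cofactor a binary form of
  degree e, and these add up.\<close>

lemma homogeneous_normal_form:
  fixes D :: "'k::field trinomial_data"
  assumes D: "trinomial_data D" and f: "f \<in> carrier (tri_poly_ring D)"
    and w: "\<And>\<mu>. \<mu> \<in> Poly_Mapping.keys f \<Longrightarrow> tri_deg D \<mu> = w"
    and Z: "Z \<in> carrier (tri_poly_ring D)" and W: "W \<in> carrier (tri_poly_ring D)"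
    and T: "\<And>i. i \<le> tri_r D \<Longrightarrow> tri_eq D (tri_mon D i) (mconst (\<gamma> i) * Z + mconst (\<beta> i) * W)"
  shows "\<exists>\<rho> e p. Poly_Mapping.keys \<rho> \<subseteq> tri_vars D \<and> Polynomial.degree p \<le> e \<and>
    tri_eq D f (Poly_Mapping.single \<rho> 1 * homogenize mconst e p Z W)"
proof (cases "f = 0")
  case True
  then show ?thesis
    by (intro exI[of _ 0]) (simp add: homogenize_def tri_eq_refl mpoly_ring_zero)
next
  case False
  have keys: "Poly_Mapping.keys \<mu> \<subseteq> tri_vars D" if "\<mu> \<in> Poly_Mapping.keys f" for \<mu>
    using that f by (auto simp: mpoly_ring_def)
  obtain \<mu>0 where \<mu>0: "\<mu>0 \<in> Poly_Mapping.keys f" using False by fastforce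
  obtain \<rho> e where \<rho>: "Poly_Mapping.keys \<rho> \<subseteq> tri_vars D"
    and ex: "\<And>\<mu>. Poly_Mapping.keys \<mu> \<subseteq> tri_vars D \<Longrightarrow> tri_shift D \<mu> \<mu>0 \<Longrightarrow>
       \<exists>n. (\<Sum>i\<le>tri_r D. n i) = e \<and> \<mu> = \<rho> + (\<Sum>i\<le>tri_r D. tri_mon_exp D i (n i))"
    using homogeneous_exponents[OF D keys[OF \<mu>0]] by blast
  have "\<forall>\<mu>\<in>Poly_Mapping.keys f. \<exists>n. (\<Sum>i\<le>tri_r D. n i) = e \<and> \<mu> = \<rho> + (\<Sum>i\<le>tri_r D. tri_mon_exp D i (n i))"
    using ex keys w \<mu>0 tri_deg_eq_iff by metis
  then obtain n where n: "\<And>\<mu>. \<mu> \<in> Poly_Mapping.keys f \<Longrightarrow> (\<Sum>i\<le>tri_r D. n \<mu> i) = e"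
    "\<And>\<mu>. \<mu> \<in> Poly_Mapping.keys f \<Longrightarrow> \<mu> = \<rho> + (\<Sum>i\<le>tri_r D. tri_mon_exp D i (n \<mu> i))"
    by metis
  define q where "q \<mu> = (\<Prod>i\<le>tri_r D. [:\<gamma> i, \<beta> i:] ^ n \<mu> i)" for \<mu>
  define p where "p = (\<Sum>\<mu>\<in>Poly_Mapping.keys f. Polynomial.smult (Poly_Mapping.lookup f \<mu>) (q \<mu>))"
  have q: "Polynomial.degree (q \<mu>) \<le> e"
    "homogenize mconst e (q \<mu>) Z W = (\<Prod>i\<le>tri_r D. (mconst (\<gamma> i) * Z + mconst (\<beta> i) * W) ^ n \<mu> i)"
    if "\<mu> \<in> Poly_Mapping.keys f" for \<mu>
    using homogenize_prod_linear[OF comm_ring_hom_mconst, of "{..tri_r D}" \<gamma> \<beta> "n \<mu>" Z W] n(1)[OF that]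
    by (simp_all add: q_def)
  have deg: "Polynomial.degree p \<le> e"
    unfolding p_def using q(1) by (intro degree_sum_le) (auto intro: order.trans[OF degree_smult_le])
  have M: "Poly_Mapping.single \<rho> 1 \<in> carrier (tri_poly_ring D)"
    using \<rho> by (simp add: mpoly_ring_def)
  have "tri_eq D (\<Sum>\<mu>\<in>Poly_Mapping.keys f. mconst (Poly_Mapping.lookup f \<mu>) *
        (Poly_Mapping.single \<rho> 1 * (\<Prod>i\<le>tri_r D. tri_mon D i ^ n \<mu> i)))
     (\<Sum>\<mu>\<in>Poly_Mapping.keys f. mconst (Poly_Mapping.lookup f \<mu>) *
        (Poly_Mapping.single \<rho> 1 * (\<Prod>i\<le>tri_r D. (mconst (\<gamma> i) * Z + mconst (\<beta> i) * W) ^ n \<mu> i)))"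
    by (intro tri_eq_sum tri_eq_mult tri_eq_prod tri_eq_power T tri_eq_refl M mpoly_ring_const) auto
  also have "(\<Sum>\<mu>\<in>Poly_Mapping.keys f. mconst (Poly_Mapping.lookup f \<mu>) *
        (Poly_Mapping.single \<rho> 1 * (\<Prod>i\<le>tri_r D. tri_mon D i ^ n \<mu> i))) = f"
  proof -
    have "Poly_Mapping.single \<rho> 1 * (\<Prod>i\<le>tri_r D. tri_mon D i ^ n \<mu> i) = Poly_Mapping.single \<mu> (1::'k)"
      if "\<mu> \<in> Poly_Mapping.keys f" for \<mu>
      by (subst (2) n(2)[OF that]) (simp add: tri_mon_power prod_single mult_single)
    then show ?thesis
      by (subst (3) mpoly_expand) (simp add: single_mult_mconst)
  qed
  also have "(\<Sum>\<mu>\<in>Poly_Mapping.keys f. mconst (Poly_Mapping.lookup f \<mu>) *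
        (Poly_Mapping.single \<rho> 1 * (\<Prod>i\<le>tri_r D. (mconst (\<gamma> i) * Z + mconst (\<beta> i) * W) ^ n \<mu> i))) =
      Poly_Mapping.single \<rho> 1 * homogenize mconst e p Z W"
    unfolding p_def homogenize_sum_smult[OF comm_ring_hom_mconst] sum_distrib_left
    by (rule sum.cong) (simp_all add: q(2) mult_ac)
  finally show ?thesis using \<rho> deg by blast
qed

lemma monomial_tri_vars:
  assumes "Poly_Mapping.keys \<rho> \<subseteq> tri_vars D"
  shows "Poly_Mapping.single \<rho> (1::'k::comm_ring_1) =
    (\<Prod>(i, j)\<in>tri_indices D. mvar (TV i j) ^ Poly_Mapping.lookup \<rho> (TV i j)) *
    (\<Prod>k\<in>{1..tri_m D}. mvar (SV k) ^ Poly_Mapping.lookup \<rho> (SV k))"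
proof -
  have "(\<Prod>v\<in>tri_vars D. mvar v ^ Poly_Mapping.lookup \<rho> v :: (tvar, 'k) mpoly) =
     (\<Prod>v\<in>(\<lambda>(i, j). TV i j) ` tri_indices D. mvar v ^ Poly_Mapping.lookup \<rho> v) *
     (\<Prod>v\<in>SV ` {1..tri_m D}. mvar v ^ Poly_Mapping.lookup \<rho> v)"
    unfolding tri_vars_def by (rule prod.union_disjoint) (auto simp: finite_tri_indices)
  also have "(\<Prod>v\<in>(\<lambda>(i, j). TV i j) ` tri_indices D. mvar v ^ Poly_Mapping.lookup \<rho> v :: (tvar, 'k) mpoly) =
     (\<Prod>(i, j)\<in>tri_indices D. mvar (TV i j) ^ Poly_Mapping.lookup \<rho> (TV i j))"
    by (subst prod.reindex) (auto simp: inj_on_def case_prod_beta)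
  also have "(\<Prod>v\<in>SV ` {1..tri_m D}. mvar v ^ Poly_Mapping.lookup \<rho> v :: (tvar, 'k) mpoly) =
     (\<Prod>k\<in>{1..tri_m D}. mvar (SV k) ^ Poly_Mapping.lookup \<rho> (SV k))"
    by (subst prod.reindex) (auto simp: inj_on_def)
  finally show ?thesis by (simp add: monomial_eq_prod[OF finite_tri_vars assms])
qed

lemma tri_variables_closed:
  "(i, j) \<in> tri_indices D \<Longrightarrow> mvar (TV i j) \<in> carrier (tri_poly_ring D)"
  "k \<in> {1..tri_m D} \<Longrightarrow> mvar (SV k) \<in> carrier (tri_poly_ring D)"
  by (rule mpoly_ring_var; force simp: tri_vars_def)+

lemma homogeneous_at_variables:
  "\<exists>\<nu>. homogeneous_at D \<nu> (\<Prod>x\<in>S. mvar (v x) ^ n x)"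
  unfolding mvar_power prod_single by (blast intro: homogeneous_at_single)

section \<open>The kernel of a partial derivative\<close>

lemma kernel_partial_S:
  fixes D :: "'k::field_char_0 trinomial_data"
  assumes D: "trinomial_data D" "2 \<le> tri_r D" and p: "1 \<le> p" "p \<le> tri_m D" and \<delta>: "is_partial_S D p \<delta>"
    and h: "h \<in> carrier (tri_alg D)"
  shows "tri_homogeneous D h \<and> h \<in> tri_kernel D \<delta> \<longleftrightarrow>
          (\<exists>(F :: (nat, 'k) mpoly) (b :: nat \<Rightarrow> nat \<Rightarrow> nat) (d :: nat \<Rightarrow> nat).
             F \<in> carrier (mpoly_ring {1, 2}) \<and> mhomogeneous F \<and>
             h = tri_cls D (msubst (tri_mon D) F *
                   (\<Prod>(i, j)\<in>tri_indices D. mvar (TV i j) ^ b i j) *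
                   (\<Prod>k\<in>{1..tri_m D} - {p}. mvar (SV k) ^ d k)))"
    (is "?L \<longleftrightarrow> ?R")
proof -
  let ?P = "carrier (tri_poly_ring D)"
  let ?V' = "tri_vars D - {SV p}"
  define g where "g v = (if v = SV p then 1 else 0 :: (tvar, 'k) mpoly)" for v
  have g_closed: "g v \<in> ?P" for v by (simp add: g_def mpoly_ring_one mpoly_ring_zero)
  have p': "SV p \<in> tri_vars D" using p by (auto simp: tri_vars_def)
  have mpder_g: "mpder (tri_vars D) g f = mpderiv (SV p) f" for f
  proof -
    have "mpder (tri_vars D) g f = (\<Sum>v\<in>tri_vars D. if v = SV p then mpderiv (SV p) f else 0)"
      unfolding mpder_def g_def by (rule sum.cong) auto
    then show ?thesis using p' by (simp add: finite_tri_vars)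
  qed
  have \<delta>_eq: "\<delta> (tri_cls D f) = tri_cls D (mpderiv (SV p) f)" if "f \<in> ?P" for f
    unfolding mpder_g[symmetric]
  proof (rule derivation_eq_mpder[OF _ g_closed _ that])
    show "tri_derivation D \<delta>" using \<delta> by (simp add: is_partial_S_def)
    fix v assume "v \<in> tri_vars D"
    then show "\<delta> (tri_cls D (mvar v)) = tri_cls D (g v)"
      using \<delta> by (auto simp: is_partial_S_def tri_vars_def g_def tri_cls_0_1)
  qed
  have T': "tri_mon D i \<in> carrier (mpoly_ring ?V')" if "i \<le> tri_r D" for i
    by (rule mpoly_ring_mono[OF _ tri_mon_block]) (use that in \<open>auto simp: tri_vars_def tri_indices_def image_iff\<close>)
  show ?thesis
  proof
    assume L: ?L
    then obtain w f where f: "f \<in> ?P" "\<And>\<mu>. \<mu> \<in> Poly_Mapping.keys f \<Longrightarrow> tri_deg D \<mu> = w" "h = tri_cls D f"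
      by (auto simp: tri_homogeneous_def tri_component_def)
    let ?A = "tri_A D"
    define m where "m = ?A $$ (0, 1) * ?A $$ (1, 2) - ?A $$ (0, 2) * ?A $$ (1, 1)"
    have m: "m \<noteq> 0" unfolding m_def using D by (intro trinomial_minor_nonzero) auto
    \<comment> \<open>Cramer's rule: at the indices 1, 2 the values become (1, 0) for
      \<open>\<gamma>\<close> and (0, 1) for \<open>\<beta>\<close>, so T_1^{l_1} and T_2^{l_2}
      themselves serve as the two coordinates.\<close>
    define \<gamma> where "\<gamma> i = ?A $$ (0, i) * (?A $$ (1, 2) / m) + ?A $$ (1, i) * (- ?A $$ (0, 2) / m)" for i
    define \<beta> where "\<beta> i = ?A $$ (0, i) * (- ?A $$ (1, 1) / m) + ?A $$ (1, i) * (?A $$ (0, 1) / m)" for i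
    have \<gamma>\<beta>: "\<gamma> 1 = 1" "\<gamma> 2 = 0" "\<beta> 1 = 0" "\<beta> 2 = 1"
      using m by (simp_all add: \<gamma>_def \<beta>_def field_simps) (simp_all add: m_def algebra_simps)
    have "tri_eq D (tri_mon D i) (mconst (\<gamma> i) * tri_mon D 1 + mconst (\<beta> i) * tri_mon D 2)" if "i \<le> tri_r D" for i
      by (rule tri_mon_linear[OF D \<gamma>_def \<beta>_def])
         (use D that in \<open>auto intro!: tri_mon_closed simp: \<gamma>\<beta>[unfolded One_nat_def] \<gamma>\<beta> mconst.hom_one mconst.hom_zero\<close>)
    from homogeneous_normal_form[OF D(1) f(1,2) tri_mon_closed tri_mon_closed this] D(2)
    obtain \<rho> e q where \<rho>: "Poly_Mapping.keys \<rho> \<subseteq> tri_vars D"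
      and eq: "tri_eq D f (Poly_Mapping.single \<rho> 1 * homogenize mconst e q (tri_mon D 1) (tri_mon D 2))"
      by auto
    let ?H = "homogenize mconst e q (tri_mon D 1) (tri_mon D 2)"
    let ?f = "Poly_Mapping.single \<rho> 1 * ?H"
    have f': "?f \<in> ?P" "h = tri_cls D ?f" using eq f(3) by (auto simp: tri_eq_def)
    show ?R
    proof (cases "Poly_Mapping.lookup \<rho> (SV p) = 0")
      case True
      \<comment> \<open>The same binary form in formal variables 1 and 2, into which
        \<open>msubst (tri_mon D)\<close> puts T_1^{l_1} and T_2^{l_2}.\<close>
      define F where "F = homogenize mconst e q (mvar 1) (mvar (2::nat))"
      have F: "F \<in> carrier (mpoly_ring {1, 2})"
        unfolding F_def homogenize_def
        by (intro mpoly_ring_sum mpoly_ring_mult mpoly_ring_power mpoly_ring_var mpoly_ring_const) auto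
      have "(\<Sum>v\<in>Poly_Mapping.keys \<mu>. Poly_Mapping.lookup \<mu> v) = e" if "\<mu> \<in> Poly_Mapping.keys F" for \<mu>
      proof -
        have "Poly_Mapping.keys F \<subseteq> (\<Union>k\<le>e. Poly_Mapping.keys (mconst (poly.coeff q k) * mvar (1::nat) ^ (e - k) * mvar 2 ^ k))"
          unfolding F_def homogenize_def by (rule keys_sum)
        with that obtain k where k: "k \<le> e"
          "\<mu> \<in> Poly_Mapping.keys (mconst (poly.coeff q k) * mvar (1::nat) ^ (e - k) * mvar 2 ^ k)" by blast
        then have \<mu>: "\<mu> = Poly_Mapping.single 1 (e - k) + Poly_Mapping.single (2::nat) k"
          by (auto simp: mvar_power mconst_def mult_single split: if_splits)
        have "(\<Sum>v\<in>Poly_Mapping.keys \<mu>. Poly_Mapping.lookup \<mu> v) = (\<Sum>v\<in>{1, 2}. Poly_Mapping.lookup \<mu> v)"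
          by (rule sum.mono_neutral_left) (auto simp: \<mu> in_keys_iff lookup_add lookup_single when_def split: if_splits)
        also have "\<dots> = e" using k(1) by (simp add: \<mu> lookup_add lookup_single)
        finally show ?thesis .
      qed
      then have hF: "mhomogeneous F" unfolding mhomogeneous_def by blast
      have sF: "msubst (tri_mon D) F = ?H"
        unfolding F_def msubst_eq_mpeval
        using hom_homogenize[OF comm_ring_hom_mpeval[OF comm_ring_hom_mconst], of "tri_mon D" mconst mconst e q "mvar 1" "mvar 2"]
        by (simp add: mpeval_mconst[OF comm_ring_hom_mconst] mpeval_mvar[OF comm_ring_hom_mconst])
      have "(\<Prod>k\<in>{1..tri_m D}. mvar (SV k) ^ Poly_Mapping.lookup \<rho> (SV k)) =
         (\<Prod>k\<in>{1..tri_m D} - {p}. mvar (SV k) ^ Poly_Mapping.lookup \<rho> (SV k) :: (tvar, 'k) mpoly)"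
        by (rule prod.mono_neutral_right) (use True in auto)
      then have "h = tri_cls D (msubst (tri_mon D) F *
            (\<Prod>(i, j)\<in>tri_indices D. mvar (TV i j) ^ Poly_Mapping.lookup \<rho> (TV i j)) *
            (\<Prod>k\<in>{1..tri_m D} - {p}. mvar (SV k) ^ Poly_Mapping.lookup \<rho> (SV k)))"
        unfolding f'(2) sF monomial_tri_vars[OF \<rho>] by (simp add: mult_ac)
      with F hF show ?thesis
        by (intro exI[of _ F] exI[of _ "\<lambda>i j. Poly_Mapping.lookup \<rho> (TV i j)"]
            exI[of _ "\<lambda>k. Poly_Mapping.lookup \<rho> (SV k)"]) simp
    next
      case False
      have H0: "mpderiv (SV p) ?H = 0"
      proof (rule mpderiv_eq_0[of _ ?V'])
        show "?H \<in> carrier (mpoly_ring ?V')"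
          unfolding homogenize_def using D(2)
          by (intro mpoly_ring_sum mpoly_ring_mult mpoly_ring_power mpoly_ring_const T') auto
      qed simp
      let ?c = "of_nat (Poly_Mapping.lookup \<rho> (SV p)) :: 'k"
      have "tri_eq D (mpderiv (SV p) ?f) 0"
        using L \<delta>_eq[OF f'(1)] f' tri_cls_eq_zero_iff[of "mpderiv (SV p) ?f" D]
        by (auto simp: tri_kernel_def mpoly_ring_mpderiv)
      \<comment> \<open>Multiplication by S_p turns the derivative into the Euler operator, which
        scales the representative by the exponent of S_p; this is invertible in characteristic
        0.\<close>
      then have "tri_eq D (mpderiv (SV p) ?f * (mvar (SV p) * mconst (1 / ?c))) 0"
        by (rule tri_eq_mult_0) (intro mpoly_ring_mult mpoly_ring_var mpoly_ring_const p')
      also have "mpderiv (SV p) ?f * (mvar (SV p) * mconst (1 / ?c)) =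
          (mvar (SV p) * mpderiv (SV p) (Poly_Mapping.single \<rho> 1)) * ?H * mconst (1 / ?c)"
        by (simp only: mpderiv_mult H0 mult_zero_right mult_zero_left add_0_right mult_ac)
      also have "\<dots> = mconst (?c * (1 / ?c)) * ?f"
        unfolding mvar_mult_mpderiv_monomial mconst.hom_mult by (simp only: mult_ac)
      also have "\<dots> = ?f" using False by (simp add: mconst.hom_one)
      finally have "h = tri_cls D 0"
        using f' by (simp add: tri_eq_def)
      then show ?thesis
        by (intro exI[of _ 0] exI[of _ "\<lambda>_ _. 0"] exI[of _ "\<lambda>_. 0"])
           (simp add: mpoly_ring_zero mhomogeneous_def msubst_def)
    qed
  next
    assume ?R
    then obtain F :: "(nat, 'k) mpoly" and b d where F: "F \<in> carrier (mpoly_ring {1, 2})" "mhomogeneous F"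
      and h_eq: "h = tri_cls D (msubst (tri_mon D) F *
                   (\<Prod>(i, j)\<in>tri_indices D. mvar (TV i j) ^ b i j) *
                   (\<Prod>k\<in>{1..tri_m D} - {p}. mvar (SV k) ^ d k))" (is "_ = tri_cls D ?f")
      by blast
    have F_eq: "msubst (tri_mon D) F = (\<Sum>\<mu>\<in>Poly_Mapping.keys F. mconst (Poly_Mapping.lookup F \<mu>) *
        (tri_mon D 1 ^ Poly_Mapping.lookup \<mu> 1 * tri_mon D 2 ^ Poly_Mapping.lookup \<mu> 2))"
      unfolding msubst_def
    proof (rule sum.cong[OF refl])
      fix \<mu> assume "\<mu> \<in> Poly_Mapping.keys F"
      then have "Poly_Mapping.keys \<mu> \<subseteq> {1, 2}" using F(1) by (auto simp: mpoly_ring_def)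
      then have "(\<Prod>v\<in>Poly_Mapping.keys \<mu>. tri_mon D v ^ Poly_Mapping.lookup \<mu> v) =
          (\<Prod>v\<in>{1, 2}. tri_mon D v ^ Poly_Mapping.lookup \<mu> v)"
        by (intro prod.mono_neutral_left) (auto simp: in_keys_iff)
      then show "mconst (Poly_Mapping.lookup F \<mu>) * (\<Prod>v\<in>Poly_Mapping.keys \<mu>. tri_mon D v ^ Poly_Mapping.lookup \<mu> v) =
          mconst (Poly_Mapping.lookup F \<mu>) * (tri_mon D 1 ^ Poly_Mapping.lookup \<mu> 1 * tri_mon D 2 ^ Poly_Mapping.lookup \<mu> 2)"
        by simp
    qed
    have f: "?f \<in> carrier (mpoly_ring ?V')"
      unfolding F_eq using D(2)
      by (intro mpoly_ring_mult mpoly_ring_sum mpoly_ring_prod mpoly_ring_power T' mpoly_ring_const)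
         (auto intro!: mpoly_ring_power mpoly_ring_var simp: tri_vars_def image_iff split: prod.splits)
    then have f': "?f \<in> ?P" by (rule mpoly_ring_mono[rotated]) auto
    obtain n where n: "\<And>\<mu>. \<mu> \<in> Poly_Mapping.keys F \<Longrightarrow> (\<Sum>v\<in>Poly_Mapping.keys \<mu>. Poly_Mapping.lookup \<mu> v) = n"
      using F(2) by (auto simp: mhomogeneous_def)
    \<comment> \<open>All T_i^{l_i} have the same degree, so every term of a form of degree n has
      the degree of the n-th power of T_1^{l_1}.\<close>
    have "homogeneous_at D (tri_mon_exp D 1 n) (msubst (tri_mon D) F)"
      unfolding F_eq
    proof (rule homogeneous_at_sum)
      fix \<mu> assume \<mu>: "\<mu> \<in> Poly_Mapping.keys F"
      then have "Poly_Mapping.keys \<mu> \<subseteq> {1, 2}" using F(1) by (auto simp: mpoly_ring_def)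
      then have "(\<Sum>v\<in>Poly_Mapping.keys \<mu>. Poly_Mapping.lookup \<mu> v) = (\<Sum>v\<in>{1, 2}. Poly_Mapping.lookup \<mu> v)"
        by (intro sum.mono_neutral_left) (auto simp: in_keys_iff)
      then have "Poly_Mapping.lookup \<mu> 1 + Poly_Mapping.lookup \<mu> 2 = n" using n[OF \<mu>] by simp
      then have e: "tri_mon_exp D 1 n = 0 + (tri_mon_exp D 1 (Poly_Mapping.lookup \<mu> 1) + tri_mon_exp D 1 (Poly_Mapping.lookup \<mu> 2))"
        by (simp add: tri_mon_exp_def distrib_right single_add flip: sum.distrib) (metis distrib_right single_add)
      show "homogeneous_at D (tri_mon_exp D 1 n) (mconst (Poly_Mapping.lookup F \<mu>) *
          (tri_mon D 1 ^ Poly_Mapping.lookup \<mu> 1 * tri_mon D 2 ^ Poly_Mapping.lookup \<mu> 2))"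
        unfolding e using D(2) by (intro homogeneous_at_mult homogeneous_at_mconst homogeneous_at_mon_power) auto
    qed
    moreover obtain \<nu>1 where "homogeneous_at D \<nu>1 (\<Prod>(i, j)\<in>tri_indices D. mvar (TV i j) ^ b i j :: (tvar, 'k) mpoly)"
      using homogeneous_at_variables[where S = "tri_indices D" and D = D and v = "\<lambda>(i, j). TV i j" and n = "\<lambda>(i, j). b i j"]
      by (auto simp: case_prod_beta)
    moreover obtain \<nu>2 where "homogeneous_at D \<nu>2 (\<Prod>k\<in>{1..tri_m D} - {p}. mvar (SV k) ^ d k :: (tvar, 'k) mpoly)"
      using homogeneous_at_variables[where S = "{1..tri_m D} - {p}" and D = D and v = SV and n = d] by auto
    ultimately have "homogeneous_at D (tri_mon_exp D 1 n + \<nu>1 + \<nu>2) ?f"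
      by (intro homogeneous_at_mult)
    then have "tri_homogeneous D h" unfolding h_eq by (rule tri_homogeneous_cls[OF f'])
    moreover have "mpderiv (SV p) ?f = 0" by (rule mpderiv_eq_0[OF f]) simp
    then have "\<delta> h = \<zero>\<^bsub>tri_alg D\<^esub>"
      unfolding h_eq \<delta>_eq[OF f'] by (simp only: tri_cls_0_1)
    ultimately show ?L using h by (simp add: tri_kernel_def)
  qed
qed

section \<open>The kernels of the derivations \<open>\<delta>_{C,\<beta>}\<close>\<close>

text \<open>A combination of the rows of A satisfies every relation, since the determinants get
  dependent rows. The value \<open>t i\<close> is realized by a root of order
  \<open>tri_l D i 1\<close> at \<open>TV i 1\<close> and 1 at all other variables, which keeps the
  coordinates nonzero.\<close>

lemma tri_point_exists:
  fixes D :: "'k::alg_closed_field trinomial_data"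
  assumes D: "trinomial_data D"
    and t: "\<And>i. i \<le> tri_r D \<Longrightarrow> t i = tri_A D $$ (0, i) * x + tri_A D $$ (1, i) * y"
    and t0: "\<And>i. i \<le> tri_r D \<Longrightarrow> t i \<noteq> 0"
  shows "\<exists>a. (\<forall>v. a v \<noteq> 0) \<and> (\<forall>i\<le>tri_r D. mpeval (\<lambda>x. x) a (tri_mon D i) = t i) \<and>
    (\<forall>f\<in>tri_ideal D. mpeval (\<lambda>x. x) a f = 0)"
proof -
  have l: "tri_n D i > 0" "tri_l D i 1 > 0" if "i \<le> tri_r D" for i
    using D that by (auto simp: trinomial_data_def)
  have "\<exists>z. z ^ tri_l D i 1 = t i" if "i \<le> tri_r D" for i
    using nth_root_exists[of "tri_l D i 1" "t i"] l[OF that] by auto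
  then obtain z where z: "\<And>i. i \<le> tri_r D \<Longrightarrow> z i ^ tri_l D i 1 = t i" by metis
  define a where "a v = (case v of SV k \<Rightarrow> 1 | TV i j \<Rightarrow> if i \<le> tri_r D \<and> j = 1 then z i else 1)" for v
  interpret ev: comm_ring_hom "mpeval (\<lambda>x. x) a" by (rule comm_ring_hom_mpeval[OF comm_ring_hom_id])
  have "z i \<noteq> 0" if "i \<le> tri_r D" for i
    using z[OF that] t0[OF that] l(2)[OF that] by (metis zero_power)
  then have a0: "a v \<noteq> 0" for v by (auto simp: a_def split: tvar.split)
  have T: "mpeval (\<lambda>x. x) a (tri_mon D i) = t i" if i: "i \<le> tri_r D" for i
  proof -
    have "mpeval (\<lambda>x. x) a (tri_mon D i) = (\<Prod>j=1..tri_n D i. if j = 1 then t i else 1)"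
      unfolding tri_mon_def ev.hom_prod
      by (rule prod.cong) (use i z in \<open>auto simp: ev.hom_power mpeval_mvar[OF comm_ring_hom_id] a_def\<close>)
    also have "\<dots> = t i" using l(1)[OF i] by (subst prod.delta) auto
    finally show ?thesis .
  qed
  have "mpeval (\<lambda>x. x) a (tri_rel D i) = 0" if "i + 2 \<le> tri_r D" for i
    unfolding tri_rel_def det_3_rows using that
    by (simp add: ev.hom_add ev.hom_minus ev.hom_mult mpeval_mconst[OF comm_ring_hom_id] T t algebra_simps)
  then show ?thesis using a0 T tri_ideal_eval_eq_0 by blast
qed

section \<open>The lift of \<open>\<delta>_{C,\<beta>}\<close> to the polynomial ring\<close>

context
  fixes D :: "'k::{alg_closed_field, field_char_0} trinomial_data"
    and C :: "nat \<Rightarrow> nat" and \<beta> :: "nat \<Rightarrow> 'k"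
begin

text \<open>Products over the indices with nonzero \<open>\<beta> i\<close> cover both shapes of the
  derivation: over all indices, or over all but i_0.\<close>

abbreviation "delta_support \<equiv> {i. i \<le> tri_r D \<and> \<beta> i \<noteq> 0}"

abbreviation delta_factor :: "nat \<Rightarrow> (tvar, 'k) mpoly" where
  "delta_factor k \<equiv> mpderiv (TV k (C k)) (tri_mon D k)"

definition delta_gen :: "tvar \<Rightarrow> (tvar, 'k) mpoly" where
  "delta_gen v = (case v of SV k \<Rightarrow> 0 | TV i j \<Rightarrow>
     if j = C i \<and> i \<in> delta_support then mconst (\<beta> i) * (\<Prod>k\<in>delta_support - {i}. delta_factor k) else 0)"

abbreviation delta_poly :: "(tvar, 'k) mpoly \<Rightarrow> (tvar, 'k) mpoly" where
  "delta_poly \<equiv> mpder (tri_vars D) delta_gen"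

lemma delta_gen_closed: "delta_gen v \<in> carrier (tri_poly_ring D)"
  by (cases v) (auto simp: delta_gen_def mpoly_ring_zero
      intro!: mpoly_ring_mult mpoly_ring_const mpoly_ring_prod mpoly_ring_mpderiv tri_mon_closed)

lemma delta_poly_mconst_mult: "delta_poly (mconst c * f) = mconst c * delta_poly f"
  by (simp add: mpder_mult)

context
  fixes y0 y1 :: 'k
  assumes D: "trinomial_data D" "2 \<le> tri_r D"
    and C: "\<And>i. i \<le> tri_r D \<Longrightarrow> C i \<in> {1..tri_n D i}"
    and \<beta>: "\<And>i. \<beta> i = tri_A D $$ (0, i) * y0 + tri_A D $$ (1, i) * y1"
    and \<beta>_nz: "y0 \<noteq> 0 \<or> y1 \<noteq> 0"
begin

text \<open>Of the variables in T_i^{l_i} only T_{i c_i} can be moved, and its value lacks just the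
  factor k = i, which the chain rule supplies. So a common factor appears, independent of
  \<open>i\<close>.\<close>

lemma delta_poly_mon:
  assumes i: "i \<le> tri_r D"
  shows "delta_poly (tri_mon D i) = mconst (\<beta> i) * (\<Prod>k\<in>delta_support. delta_factor k)"
proof -
  have other: "mpderiv (TV k j) (tri_mon D i) = 0" if "k \<noteq> i" for k j
    by (rule mpderiv_eq_0[OF tri_mon_block]) (use that in auto)
  have S: "mpderiv (SV k) (tri_mon D i) = 0" for k
    by (rule mpderiv_eq_0[OF tri_mon_block]) auto
  have "delta_poly (tri_mon D i) =
      (\<Sum>v\<in>tri_vars D. if v = TV i (C i) then delta_gen v * delta_factor i else 0)"
    unfolding mpder_def
  proof (rule sum.cong[OF refl])
    fix v
    show "delta_gen v * mpderiv v (tri_mon D i) = (if v = TV i (C i) then delta_gen v * delta_factor i else 0)"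
      by (cases v) (auto simp: S other delta_gen_def)
  qed
  also have "\<dots> = delta_gen (TV i (C i)) * delta_factor i"
    using i C[OF i] by (auto simp: sum.delta finite_tri_vars tri_vars_def tri_indices_def)
  also have "\<dots> = mconst (\<beta> i) * (\<Prod>k\<in>delta_support. delta_factor k)"
  proof (cases "\<beta> i = 0")
    case False
    then have "(\<Prod>k\<in>delta_support. delta_factor k) = delta_factor i * (\<Prod>k\<in>delta_support - {i}. delta_factor k)"
      using i by (intro prod.remove) auto
    then show ?thesis using False i by (simp add: delta_gen_def mult_ac)
  qed (simp add: delta_gen_def mconst.hom_zero)
  finally show ?thesis .
qed

text \<open>The images of the two monomials are \<open>\<beta> 1\<close> and
  \<open>\<beta> 2\<close> times the same polynomial, so the cross combination cancels.\<close>

lemma delta_poly_invariant: "delta_poly (mconst (\<beta> 2) * tri_mon D 1 - mconst (\<beta> 1) * tri_mon D 2) = 0"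
proof -
  have T: "delta_poly (tri_mon D 1) = mconst (\<beta> 1) * (\<Prod>k\<in>delta_support. delta_factor k)"
    "delta_poly (tri_mon D 2) = mconst (\<beta> 2) * (\<Prod>k\<in>delta_support. delta_factor k)"
    using D(2) by (intro delta_poly_mon; simp)+
  show ?thesis
    unfolding mpder_diff delta_poly_mconst_mult T by (simp add: mult_ac)
qed

text \<open>Logarithmic differentiation at a point with nonzero coordinates: a monomial contributes
  its exponent of T_{i c_i} times the logarithmic derivative of that variable. The latter is the
  common factor times \<open>\<beta> i\<close> / (l_{i c_i} t_i), because T_{i c_i}
  \<open>delta_factor i\<close> = l_{i c_i} t_i there.\<close>

lemma delta_poly_monomial_eval:
  fixes a :: "tvar \<Rightarrow> 'k"
  defines "ev \<equiv> mpeval (\<lambda>x. x) a"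
  assumes a: "\<And>v. a v \<noteq> 0" and t: "\<And>i. i \<le> tri_r D \<Longrightarrow> ev (tri_mon D i) = t i"
    and t0: "\<And>i. i \<le> tri_r D \<Longrightarrow> t i \<noteq> 0"
  shows "ev (\<Prod>k\<in>delta_support. delta_factor k) \<noteq> 0"
    and "ev (delta_poly (Poly_Mapping.single \<rho> 1)) =
      ev (\<Prod>k\<in>delta_support. delta_factor k) * ev (Poly_Mapping.single \<rho> 1) *
      (\<Sum>i\<in>delta_support. of_nat (Poly_Mapping.lookup \<rho> (TV i (C i))) * \<beta> i / (of_nat (tri_l D i (C i)) * t i))"
proof -
  interpret ev: comm_ring_hom ev unfolding ev_def by (rule comm_ring_hom_mpeval[OF comm_ring_hom_id])
  have var: "ev (mvar v) = a v" for v unfolding ev_def by (rule mpeval_mvar[OF comm_ring_hom_id])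
  have const: "ev (mconst c) = c" for c unfolding ev_def by (rule mpeval_mconst[OF comm_ring_hom_id])
  have dmon: "a v * ev (mpderiv v (Poly_Mapping.single \<mu> 1)) = of_nat (Poly_Mapping.lookup \<mu> v) * ev (Poly_Mapping.single \<mu> 1)"
    for v \<mu>
    using arg_cong[OF mvar_mult_mpderiv_monomial[of v \<mu> 1], of ev] by (simp add: ev.hom_mult var const)
  have mon: "tri_mon D k = Poly_Mapping.single (tri_mon_exp D k 1) 1" for k
    using tri_mon_power[of D k 1] by simp
  have factor: "a (TV k (C k)) * ev (delta_factor k) = of_nat (tri_l D k (C k)) * t k" if "k \<le> tri_r D" for k
    using dmon[of "TV k (C k)" "tri_mon_exp D k 1", folded mon] C[OF that] t[OF that]
    by (simp add: lookup_tri_mon_exp)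
  have l: "tri_l D k (C k) > 0" if "k \<le> tri_r D" for k
    using D C[OF that] that by (auto simp: trinomial_data_def)
  have factor0: "ev (delta_factor k) \<noteq> 0" if "k \<le> tri_r D" for k
    using factor[OF that] l[OF that] t0[OF that] by auto
  then show q0: "ev (\<Prod>k\<in>delta_support. delta_factor k) \<noteq> 0" by (auto simp: ev.hom_prod)
  let ?q = "ev (\<Prod>k\<in>delta_support. delta_factor k)" and ?M = "Poly_Mapping.single \<rho> (1::'k)"
  have summand: "ev (delta_gen (TV i (C i))) * ev (mpderiv (TV i (C i)) ?M) =
      ?q * ev ?M * (of_nat (Poly_Mapping.lookup \<rho> (TV i (C i))) * \<beta> i / (of_nat (tri_l D i (C i)) * t i))"
    if i: "i \<in> delta_support" for i
  proof -
    have i': "i \<le> tri_r D" using i by simp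
    have "?q = ev (delta_factor i) * ev (\<Prod>k\<in>delta_support - {i}. delta_factor k)"
      unfolding ev.hom_mult[symmetric] by (subst prod.remove[OF _ i]) auto
    moreover have "ev (delta_gen (TV i (C i))) = \<beta> i * ev (\<Prod>k\<in>delta_support - {i}. delta_factor k)"
      using i by (simp add: delta_gen_def ev.hom_mult const)
    ultimately have 1: "ev (delta_gen (TV i (C i))) * ev (delta_factor i) = \<beta> i * ?q" by simp
    have 2: "ev (mpderiv (TV i (C i)) ?M) * a (TV i (C i)) = of_nat (Poly_Mapping.lookup \<rho> (TV i (C i))) * ev ?M"
      using dmon by (simp only: mult.commute)
    have "ev (delta_gen (TV i (C i))) * ev (mpderiv (TV i (C i)) ?M) * (of_nat (tri_l D i (C i)) * t i) =
       (ev (delta_gen (TV i (C i))) * ev (delta_factor i)) * (ev (mpderiv (TV i (C i)) ?M) * a (TV i (C i)))"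
      unfolding factor[OF i', symmetric] by (simp only: mult_ac)
    also have "\<dots> = ?q * ev ?M * (of_nat (Poly_Mapping.lookup \<rho> (TV i (C i))) * \<beta> i)"
      unfolding 1 2 by (simp only: mult_ac)
    finally show ?thesis using l[OF i'] t0[OF i'] by (simp add: field_simps)
  qed
  have "ev (delta_poly ?M) = (\<Sum>v\<in>tri_vars D. ev (delta_gen v) * ev (mpderiv v ?M))"
    by (simp add: mpder_def ev.hom_sum ev.hom_mult)
  also have "\<dots> = (\<Sum>v\<in>(\<lambda>i. TV i (C i)) ` delta_support. ev (delta_gen v) * ev (mpderiv v ?M))"
  proof (rule sum.mono_neutral_right[OF finite_tri_vars])
    show "(\<lambda>i. TV i (C i)) ` delta_support \<subseteq> tri_vars D"
      using C by (force simp: tri_vars_def tri_indices_def)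
    show "\<forall>v\<in>tri_vars D - (\<lambda>i. TV i (C i)) ` delta_support. ev (delta_gen v) * ev (mpderiv v ?M) = 0"
    proof
      fix v assume "v \<in> tri_vars D - (\<lambda>i. TV i (C i)) ` delta_support"
      then have "delta_gen v = 0" by (cases v) (auto simp: delta_gen_def)
      then show "ev (delta_gen v) * ev (mpderiv v ?M) = 0" by simp
    qed
  qed
  also have "\<dots> = (\<Sum>i\<in>delta_support. ev (delta_gen (TV i (C i))) * ev (mpderiv (TV i (C i)) ?M))"
    by (subst sum.reindex) (auto simp: inj_on_def)
  also have "\<dots> = ?q * ev ?M *
      (\<Sum>i\<in>delta_support. of_nat (Poly_Mapping.lookup \<rho> (TV i (C i))) * \<beta> i / (of_nat (tri_l D i (C i)) * t i))"
    unfolding sum_distrib_left by (rule sum.cong[OF refl summand])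
  finally show "ev (delta_poly ?M) = \<dots>" .
qed

text \<open>\<open>ker\<close> ranges over all representatives, because \<open>delta_poly\<close>
  acts on polynomials and is applied to the normal form of \<open>f\<close> instead of
  \<open>f\<close> itself.\<close>

lemma homogeneous_kernel_delta_poly:
  assumes f: "f \<in> carrier (tri_poly_ring D)" and w: "\<And>\<mu>. \<mu> \<in> Poly_Mapping.keys f \<Longrightarrow> tri_deg D \<mu> = w"
    and ker: "\<And>f'. tri_eq D f f' \<Longrightarrow> tri_eq D (delta_poly f') 0"
  shows "\<exists>\<alpha> s \<rho>. Poly_Mapping.keys \<rho> \<subseteq> tri_vars D \<and> (\<forall>i\<in>delta_support. Poly_Mapping.lookup \<rho> (TV i (C i)) = 0) \<and>
    tri_eq D f (mconst \<alpha> * (mconst (\<beta> 2) * tri_mon D 1 - mconst (\<beta> 1) * tri_mon D 2) ^ s * Poly_Mapping.single \<rho> 1)"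
proof -
  let ?A = "tri_A D" and ?P = "carrier (tri_poly_ring D)"
  \<comment> \<open>(u0, u1) completes (y0, y1) to a basis, so \<open>\<gamma>\<close> and
    \<open>\<beta>\<close> together span the row space of A and their minors stay nonzero.\<close>
  obtain u0 u1 where u: "u0 * y1 - u1 * y0 \<noteq> 0"
    using that[of 1 0] that[of 0 1] \<beta>_nz by force
  define \<gamma> where "\<gamma> i = ?A $$ (0, i) * u0 + ?A $$ (1, i) * u1" for i
  have minor: "\<gamma> i * \<beta> j - \<gamma> j * \<beta> i \<noteq> 0" if "i \<le> tri_r D" "j \<le> tri_r D" "i \<noteq> j" for i j
  proof -
    have "\<gamma> i * \<beta> j - \<gamma> j * \<beta> i =
        (?A $$ (0, i) * ?A $$ (1, j) - ?A $$ (0, j) * ?A $$ (1, i)) * (u0 * y1 - u1 * y0)"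
      by (simp add: \<gamma>_def \<beta> algebra_simps)
    then show ?thesis using u trinomial_minor_nonzero[OF D(1) that] by simp
  qed
  have nz: "\<gamma> i \<noteq> 0 \<or> \<beta> i \<noteq> 0" if "i \<le> tri_r D" for i
    using minor[of i 1] minor[of i 0] that D(2) by (cases "i = 0") auto
  define m where "m = \<gamma> 1 * \<beta> 2 - \<gamma> 2 * \<beta> 1"
  have m: "m \<noteq> 0" unfolding m_def using D(2) by (intro minor) auto
  let ?T = "tri_mon D"
  \<comment> \<open>\<open>Z\<close> and \<open>W\<close> solve T_i^{l_i} =
    \<open>\<gamma> i\<close> Z + \<open>\<beta> i\<close> W for i = 1, 2, a system with determinant
    \<open>m\<close>; \<open>Z\<close> is a multiple of the invariant \<open>Y\<close>.\<close>
  define Y where "Y = mconst (\<beta> 2) * ?T 1 - mconst (\<beta> 1) * ?T 2"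
  define Z where "Z = mconst (1 / m) * Y"
  define W where "W = mconst (1 / m) * (mconst (\<gamma> 1) * ?T 2 - mconst (\<gamma> 2) * ?T 1)"
  have T_closed: "?T 1 \<in> ?P" "?T 2 \<in> ?P" using D(2) by (auto intro: tri_mon_closed)
  have Y: "Y \<in> ?P" and Z: "Z \<in> ?P" and W: "W \<in> ?P"
    unfolding Y_def Z_def W_def by (intro mpoly_ring_mult mpoly_ring_diff mpoly_ring_const T_closed)+
  have lin: "mconst (1 / m) * (mconst m * f) = f" for f :: "(tvar, 'k) mpoly"
    using m by (simp add: mult.assoc[symmetric] mconst.hom_one flip: mconst.hom_mult)
  have T1: "?T 1 = mconst (\<gamma> 1) * Z + mconst (\<beta> 1) * W"
  proof -
    have "mconst (\<gamma> 1) * Z + mconst (\<beta> 1) * W = mconst (1 / m) * (mconst m * ?T 1)"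
      by (simp add: Z_def W_def Y_def m_def mconst.hom_minus mconst.hom_mult algebra_simps)
    then show ?thesis by (simp add: lin)
  qed
  have T2: "?T 2 = mconst (\<gamma> 2) * Z + mconst (\<beta> 2) * W"
  proof -
    have "mconst (\<gamma> 2) * Z + mconst (\<beta> 2) * W = mconst (1 / m) * (mconst m * ?T 2)"
      by (simp add: Z_def W_def Y_def m_def mconst.hom_minus mconst.hom_mult algebra_simps)
    then show ?thesis by (simp add: lin)
  qed
  define q where "q = (\<Prod>k\<in>delta_support. delta_factor k)"
  have dZ: "delta_poly Z = 0"
    by (simp add: Z_def Y_def delta_poly_mconst_mult delta_poly_invariant del: One_nat_def)
  have dW: "delta_poly W = q"
  proof -
    have T: "delta_poly (?T 1) = mconst (\<beta> 1) * q" "delta_poly (?T 2) = mconst (\<beta> 2) * q"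
      unfolding q_def using D(2) by (intro delta_poly_mon; simp)+
    have "delta_poly W = mconst (1 / m) * (mconst m * q)"
      unfolding W_def delta_poly_mconst_mult mpder_diff T
      by (simp add: m_def mconst.hom_minus mconst.hom_mult algebra_simps)
    then show ?thesis by (simp add: lin)
  qed
  have "tri_eq D (?T i) (mconst (\<gamma> i) * Z + mconst (\<beta> i) * W)" if "i \<le> tri_r D" for i
    by (rule tri_mon_linear[OF D \<gamma>_def \<beta> Z W T1 T2 that])
  from homogeneous_normal_form[OF D(1) f w Z W this]
  obtain \<rho> e p where \<rho>: "Poly_Mapping.keys \<rho> \<subseteq> tri_vars D" and p: "Polynomial.degree p \<le> e"
    and eq: "tri_eq D f (Poly_Mapping.single \<rho> 1 * homogenize mconst e p Z W)" by blast
  let ?M = "Poly_Mapping.single \<rho> (1::'k)" and ?H = "homogenize mconst e p Z W"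
  \<comment> \<open>Since \<open>Z\<close> is killed and \<open>W\<close> is sent to
    \<open>q\<close>, the derivation acts on binary forms as q d/dW.\<close>
  have dH: "delta_poly ?H = (\<Sum>k\<le>e. mconst (poly.coeff p k) * (Z ^ (e - k) * (of_nat k * W ^ (k - 1) * q)))"
    unfolding homogenize_def by (simp add: mpder_sum mpder_mult mpder_power dZ dW mult.assoc)
  have log_eq: "poly (pderiv p) x + poly p x * (\<Sum>i\<in>delta_support. of_nat (Poly_Mapping.lookup \<rho> (TV i (C i))) * \<beta> i /
        (of_nat (tri_l D i (C i)) * (\<gamma> i + \<beta> i * x))) = 0"
    if x: "\<And>i. i \<in> {..tri_r D} \<Longrightarrow> \<gamma> i + \<beta> i * x \<noteq> 0" for x
  proof -
    obtain a where a: "\<And>v. a v \<noteq> 0" "\<And>i. i \<le> tri_r D \<Longrightarrow> mpeval (\<lambda>x. x) a (?T i) = \<gamma> i + \<beta> i * x"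
      "\<And>f. f \<in> tri_ideal D \<Longrightarrow> mpeval (\<lambda>x. x) a f = 0"
    proof -
      \<comment> \<open>The point sought has Z = 1 and W = x; its T_i^{l_i} come from the row
        combination with coefficients u + x y.\<close>
      have "\<gamma> i + \<beta> i * x = ?A $$ (0, i) * (u0 + y0 * x) + ?A $$ (1, i) * (u1 + y1 * x)" for i
        by (simp add: \<gamma>_def \<beta> algebra_simps)
      from tri_point_exists[of D "\<lambda>i. \<gamma> i + \<beta> i * x", OF D(1) this] x that show ?thesis by blast
    qed
    let ?ev = "mpeval (\<lambda>x. x) a"
    interpret ev: comm_ring_hom ?ev by (rule comm_ring_hom_mpeval[OF comm_ring_hom_id])
    note const = mpeval_mconst[OF comm_ring_hom_id]
    have evT: "?ev (?T 1) = \<gamma> 1 + \<beta> 1 * x" "?ev (?T 2) = \<gamma> 2 + \<beta> 2 * x"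
      using D(2) by (auto intro: a(2))
    have "?ev Z = 1 / m * m" "?ev W = 1 / m * (m * x)"
      unfolding Z_def W_def Y_def ev.hom_mult ev.hom_minus const evT
      by (simp_all add: m_def algebra_simps)
    then have evZ: "?ev Z = 1" and evW: "?ev W = x" using m by simp_all
    have evH: "?ev ?H = poly p x"
      using hom_homogenize[OF ev.comm_ring_hom_axioms, of mconst "\<lambda>x. x" e p Z W] homogenize_1[OF p, of x]
      by (simp add: const evZ evW)
    have evdH: "?ev (delta_poly ?H) = poly (pderiv p) x * ?ev q"
      unfolding dH poly_pderiv_altdef[OF p]
      by (simp add: ev.hom_sum ev.hom_mult ev.hom_power const evZ evW ev.hom_of_nat sum_distrib_right mult.assoc)
    have "?ev (delta_poly (?M * ?H)) = 0"
      using ker[OF eq] by (intro a(3)) (simp add: tri_eq_iff)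
    \<comment> \<open>Both summands of the Leibniz rule carry the values of \<open>?M\<close> and
      \<open>q\<close>, which are nonzero at the point, so the remaining factor vanishes.\<close>
    then have "?ev (delta_poly ?M) * poly p x + ?ev ?M * (poly (pderiv p) x * ?ev q) = 0"
      by (simp add: mpder_mult ev.hom_add ev.hom_mult evH evdH)
    moreover note delta_poly_monomial_eval[of a "\<lambda>i. \<gamma> i + \<beta> i * x", OF a(1,2) x, folded q_def]
    moreover have "?ev ?M \<noteq> 0"
      unfolding monomial_eq_prod[OF finite_tri_vars \<rho>]
      using a(1) by (auto simp: ev.hom_prod ev.hom_power mpeval_mvar[OF comm_ring_hom_id] finite_tri_vars)
    ultimately have "?ev ?M * ?ev q * (poly (pderiv p) x + poly p x * (\<Sum>i\<in>delta_support.
        of_nat (Poly_Mapping.lookup \<rho> (TV i (C i))) * \<beta> i / (of_nat (tri_l D i (C i)) * (\<gamma> i + \<beta> i * x)))) = 0"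
      and "?ev ?M * ?ev q \<noteq> 0"
      by (simp_all add: algebra_simps)
    then show ?thesis by simp
  qed
  show ?thesis
  proof (cases "p = 0")
    case True
    then have "tri_eq D f 0" using eq by (simp add: homogenize_def mconst.hom_zero)
    then show ?thesis by (intro exI[of _ 0]) (simp add: mconst.hom_zero)
  next
    case False
    have l: "tri_l D i (C i) > 0" if "i \<in> delta_support" for i
      using D C that by (auto simp: trinomial_data_def)
    have "finite {..tri_r D}" "delta_support \<subseteq> {..tri_r D}" "\<And>i. i \<in> delta_support \<Longrightarrow> \<beta> i \<noteq> 0"
      "\<And>i. i \<in> {..tri_r D} \<Longrightarrow> \<gamma> i \<noteq> 0 \<or> \<beta> i \<noteq> 0"
      using nz by auto
    note log = log_derivative_eq_0[where b = "\<lambda>i. Poly_Mapping.lookup \<rho> (TV i (C i))"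
        and l = "\<lambda>i. tri_l D i (C i)", OF this l False log_eq]
    obtain c where c: "p = [:c:]"
      using log(1) by (auto elim: degree_eq_zeroE)
    have \<rho>0: "Poly_Mapping.lookup \<rho> (TV i (C i)) = 0" if "i \<in> delta_support" for i
      using log(2) that by blast
    \<comment> \<open>A constant form of degree e is c Z^e, and \<open>Z\<close> is \<open>Y\<close>
      divided by \<open>m\<close>.\<close>
    have "?M * ?H = mconst (c * (1 / m) ^ e) * Y ^ e * ?M"
      unfolding c homogenize_const[OF comm_ring_hom_mconst] Z_def mconst.hom_mult mconst.hom_power power_mult_distrib
      by (simp only: mult_ac)
    from eq[unfolded this] show ?thesis
      unfolding Y_def using \<rho> \<rho>0
      by (intro exI[of _ "c * (1 / m) ^ e"] exI[of _ e] exI[of _ \<rho>] conjI ballI)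
  qed
qed

end

end

section \<open>Homogeneous kernel elements of \<open>\<delta>_{C,\<beta>}\<close> in the
  algebra\<close>

lemma kernel_delta:
  fixes D :: "'k::{alg_closed_field, field_char_0} trinomial_data"
  assumes D: "trinomial_data D" "2 \<le> tri_r D" and \<delta>: "is_delta D C \<beta> \<delta>"
    and h: "h \<in> carrier (tri_alg D)"
  shows "tri_homogeneous D h \<and> h \<in> tri_kernel D \<delta> \<longleftrightarrow>
          (\<exists>(\<alpha> :: 'k) (s :: nat) (b :: nat \<Rightarrow> nat \<Rightarrow> nat) (d :: nat \<Rightarrow> nat).
             h = tri_cls D (mconst \<alpha> *
                   (mconst (\<beta> $ 2) * tri_mon D 1 - mconst (\<beta> $ 1) * tri_mon D 2) ^ s *
                   (\<Prod>(i, j)\<in>{(i, j) \<in> tri_indices D. tri_cls D (mvar (TV i j)) \<in> tri_kernel D \<delta>}.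
                      mvar (TV i j) ^ b i j) *
                   (\<Prod>k=1..tri_m D. mvar (SV k) ^ d k)))"
    (is "?L \<longleftrightarrow> ?R")
proof -
  let ?A = "tri_A D" and ?r = "tri_r D" and ?P = "carrier (tri_poly_ring D)"
  obtain J where J: "tri_beta D J \<beta>" "tri_C D J C" "tri_delta_values D J C \<beta> \<delta>" and der: "tri_derivation D \<delta>"
    using \<delta> unfolding is_delta_def by blast
  have A: "?A \<in> carrier_mat 2 (?r + 1)" using D by (simp add: trinomial_data_def)
  \<comment> \<open>\<open>y\<close> holds the coordinates of \<open>\<beta>\<close> with respect to
    the rows of A; \<open>b\<close> is \<open>\<beta>\<close> as a function given by them.\<close>
  obtain y where y: "y \<in> carrier_vec 2" "?A\<^sup>T *\<^sub>v y = \<beta>"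
    using J(1) A vec_space.row_space_eq[OF A] by (auto simp: tri_beta_def)
  define b where "b i = ?A $$ (0, i) * y $ 0 + ?A $$ (1, i) * y $ 1" for i
  have \<beta>: "\<beta> $ i = b i" if "i \<le> ?r" for i
    using A y(1) that by (auto simp: y(2)[symmetric] b_def scalar_prod_def numeral_2_eq_2)
  have y_nz: "y $ 0 \<noteq> 0 \<or> y $ 1 \<noteq> 0"
  proof (rule ccontr)
    assume "\<not> ?thesis"
    then have "\<beta> $ i = 0" if "i \<le> ?r" for i using \<beta>[OF that] by (simp add: b_def)
    moreover have "dim_vec \<beta> = ?r + 1" using y(2) A by auto
    ultimately have "\<beta> = 0\<^sub>v (?r + 1)" by (intro eq_vecI) auto
    then show False using J(1) by (simp add: tri_beta_def)
  qed
  have C: "C i \<in> {1..tri_n D i}" if "i \<le> ?r" for i using J(2) that by (simp add: tri_C_def)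
  let ?N = "{i. i \<le> ?r \<and> b i \<noteq> 0}"
  let ?g = "delta_gen D C b" and ?d = "mpder (tri_vars D) (delta_gen D C b)"
  note ctx = D C b_def y_nz
  note g_closed = delta_gen_closed[of D C b]
  have "J = {i. i \<le> ?r \<and> b i = 0}" using J(1) \<beta> by (auto simp: tri_beta_def)
  \<comment> \<open>\<open>J\<close> is the zero set of \<open>\<beta>\<close>, so removing it
    leaves the support; the cases of empty and one-element \<open>J\<close> are treated together
    from here on.\<close>
  then have N: "{0..?r} - insert i J = ?N - {i}" for i by auto
  have gen: "\<delta> (tri_cls D (mvar v)) = tri_cls D (?g v)" if v: "v \<in> tri_vars D" for v
  proof (cases v)
    case (TV i j)
    with v have ij: "(i, j) \<in> tri_indices D" by (auto simp: tri_vars_def)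
    then have "\<delta> (tri_cls D (mvar (TV i j))) = (if j = C i
         then tri_cls D (mconst (b i) * (\<Prod>k\<in>?N - {i}. mpderiv (TV k (C k)) (tri_mon D k)))
         else \<zero>\<^bsub>tri_alg D\<^esub>)"
      using J(3) \<beta>[of i] by (auto simp: tri_delta_values_def N tri_indices_def)
    then show ?thesis using ij
      by (auto simp: TV delta_gen_def tri_cls_0_1 mconst.hom_zero tri_indices_def)
  next
    case (SV k)
    with v J(3) show ?thesis by (auto simp: tri_delta_values_def tri_vars_def delta_gen_def tri_cls_0_1)
  qed
  have \<delta>_eq: "\<delta> (tri_cls D f) = tri_cls D (?d f)" if "f \<in> ?P" for f
    by (rule derivation_eq_mpder[OF der g_closed gen that])
  have d_closed: "?d f \<in> ?P" if "f \<in> ?P" for f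
    by (rule mpder_closed[OF g_closed that])
  have ker_iff: "tri_cls D f \<in> tri_kernel D \<delta> \<longleftrightarrow> tri_eq D (?d f) 0" if "f \<in> ?P" for f
    using that by (simp add: tri_kernel_def tri_alg_carrier \<delta>_eq tri_cls_eq_zero_iff d_closed)
  let ?K = "{(i, j) \<in> tri_indices D. tri_cls D (mvar (TV i j)) \<in> tri_kernel D \<delta>}"
  let ?Y = "mconst (b 2) * tri_mon D 1 - mconst (b 1) * tri_mon D 2"
  have Y: "mconst (\<beta> $ 2) * tri_mon D 1 - mconst (\<beta> $ 1) * tri_mon D 2 = ?Y"
    using \<beta>[of 1] \<beta>[of 2] D(2) by simp
  show ?thesis
    unfolding Y
  proof
    assume L: ?L
    then obtain w f where f: "f \<in> ?P" "\<And>\<mu>. \<mu> \<in> Poly_Mapping.keys f \<Longrightarrow> tri_deg D \<mu> = w" "h = tri_cls D f"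
      by (auto simp: tri_homogeneous_def tri_component_def)
    have "tri_eq D (?d f') 0" if "tri_eq D f f'" for f'
      using that L ker_iff[of f'] f(3) by (auto simp: tri_eq_def)
    from homogeneous_kernel_delta_poly[OF ctx f(1,2) this]
    obtain \<alpha> s \<rho> where \<rho>: "Poly_Mapping.keys \<rho> \<subseteq> tri_vars D" "\<And>i. i \<in> ?N \<Longrightarrow> Poly_Mapping.lookup \<rho> (TV i (C i)) = 0"
      and eq: "tri_eq D f (mconst \<alpha> * ?Y ^ s * Poly_Mapping.single \<rho> 1)"
      by blast
    \<comment> \<open>A variable outside \<open>?K\<close> has nonzero \<open>delta_gen\<close>,
      since a zero value would put its class into the kernel. So it is some T_{i c_i} with
      \<open>b i\<close> nonzero, where \<open>\<rho>\<close> has exponent 0.\<close>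
    have K: "Poly_Mapping.lookup \<rho> (TV i j) = 0" if ij: "(i, j) \<in> tri_indices D" "(i, j) \<notin> ?K" for i j
    proof -
      have "?g (TV i j) \<noteq> 0"
      proof
        assume "?g (TV i j) = 0"
        then have "?d (mvar (TV i j)) = 0"
          using ij by (subst mpder_mvar[OF finite_tri_vars]) (force simp: tri_vars_def)+
        then show False
          using ij ker_iff[OF tri_variables_closed(1)[OF ij(1)]] by (auto simp: tri_eq_refl mpoly_ring_zero)
      qed
      then show ?thesis using \<rho>(2)[of i] by (auto simp: delta_gen_def split: if_splits)
    qed
    have "(\<Prod>(i, j)\<in>tri_indices D. mvar (TV i j) ^ Poly_Mapping.lookup \<rho> (TV i j)) =
        (\<Prod>(i, j)\<in>?K. mvar (TV i j) ^ Poly_Mapping.lookup \<rho> (TV i j) :: (tvar, 'k) mpoly)"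
    proof (rule prod.mono_neutral_right[OF finite_tri_indices])
      show "\<forall>x\<in>tri_indices D - ?K. (case x of (i, j) \<Rightarrow> mvar (TV i j) ^ Poly_Mapping.lookup \<rho> (TV i j)) = (1 :: (tvar, 'k) mpoly)"
      proof
        fix x assume "x \<in> tri_indices D - ?K"
        then show "(case x of (i, j) \<Rightarrow> mvar (TV i j) ^ Poly_Mapping.lookup \<rho> (TV i j)) = (1 :: (tvar, 'k) mpoly)"
          using K[of "fst x" "snd x"] by (cases x) auto
      qed
    qed auto
    then have "h = tri_cls D (mconst \<alpha> * ?Y ^ s *
          (\<Prod>(i, j)\<in>?K. mvar (TV i j) ^ Poly_Mapping.lookup \<rho> (TV i j)) *
          (\<Prod>k=1..tri_m D. mvar (SV k) ^ Poly_Mapping.lookup \<rho> (SV k)))"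
      using eq f(3) unfolding monomial_tri_vars[OF \<rho>(1)] by (simp add: tri_eq_def mult.assoc)
    then show "\<exists>\<alpha> s b d. h = tri_cls D (mconst \<alpha> * ?Y ^ s * (\<Prod>(i, j)\<in>?K. mvar (TV i j) ^ b i j) *
          (\<Prod>k=1..tri_m D. mvar (SV k) ^ d k))"
      by (intro exI[of _ \<alpha>] exI[of _ s] exI[of _ "\<lambda>i j. Poly_Mapping.lookup \<rho> (TV i j)"]
            exI[of _ "\<lambda>k. Poly_Mapping.lookup \<rho> (SV k)"])
  next
    assume "\<exists>\<alpha> s b d. h = tri_cls D (mconst \<alpha> * ?Y ^ s * (\<Prod>(i, j)\<in>?K. mvar (TV i j) ^ b i j) *
          (\<Prod>k=1..tri_m D. mvar (SV k) ^ d k))"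
    then obtain \<alpha> s c d where h_eq: "h = tri_cls D (mconst \<alpha> * ?Y ^ s *
          (\<Prod>(i, j)\<in>?K. mvar (TV i j) ^ c i j) * (\<Prod>k=1..tri_m D. mvar (SV k) ^ d k))" (is "_ = tri_cls D ?f")
      by blast
    \<comment> \<open>The derivative is required to vanish only modulo the ideal, as this is what
      membership of T_ij in \<open>?K\<close> provides. The Leibniz rule makes the condition stable
      under products.\<close>
    let ?ker = "\<lambda>f. f \<in> ?P \<and> tri_eq D (?d f) 0"
    have ker_mult: "?ker (f * g)" if "?ker f" "?ker g" for f g
    proof -
      have "tri_eq D (?d f * g + f * ?d g) (0 * g + f * 0)"
        using that by (intro tri_eq_add tri_eq_mult tri_eq_refl) auto
      then show ?thesis using that by (simp add: mpder_mult mpoly_ring_mult)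
    qed
    have ker_0: "?ker f" if "f \<in> ?P" "?d f = 0" for f
      using that by (simp add: tri_eq_refl mpoly_ring_zero)
    have ker_power: "?ker (f ^ n)" if "?ker f" for f n
    proof (induction n)
      case (Suc n)
      show ?case unfolding power_Suc by (rule ker_mult[OF that Suc])
    qed (simp add: mpoly_ring_one mpoly_ring_zero tri_eq_refl)
    have ker_prod: "?ker (\<Prod>x\<in>S. f x)" if "\<And>x. x \<in> S \<Longrightarrow> ?ker (f x)" for f and S :: "'b set"
      using that
    proof (induction S rule: infinite_finite_induct)
      case (insert x S)
      show ?case unfolding prod.insert[OF insert(1,2)] by (rule ker_mult) (use insert in auto)
    qed (simp_all add: mpoly_ring_one mpoly_ring_zero tri_eq_refl)
    have kY: "?ker ?Y"
      using D(2) by (intro ker_0 delta_poly_invariant[OF ctx] mpoly_ring_diff mpoly_ring_mult mpoly_ring_const tri_mon_closed) auto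
    have kT: "?ker (mvar (TV i j))" if "(i, j) \<in> ?K" for i j
      using that ker_iff[OF tri_variables_closed(1)] tri_variables_closed(1)[of i j D] by auto
    have kS: "?ker (mvar (SV k))" if "k \<in> {1..tri_m D}" for k
    proof (rule ker_0)
      show "mvar (SV k) \<in> ?P" using that by (rule tri_variables_closed)
      show "?d (mvar (SV k)) = 0"
        using that by (subst mpder_mvar[OF finite_tri_vars]) (auto simp: tri_vars_def delta_gen_def)
    qed
    have "?ker ?f"
    proof (intro ker_mult)
      show "?ker (mconst \<alpha>)" by (rule ker_0) (simp_all add: mpoly_ring_const)
      show "?ker (?Y ^ s)" by (rule ker_power[OF kY])
      show "?ker (\<Prod>(i, j)\<in>?K. mvar (TV i j) ^ c i j)" by (rule ker_prod) (use kT ker_power in auto)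
      show "?ker (\<Prod>k=1..tri_m D. mvar (SV k) ^ d k)" by (rule ker_prod) (use kS ker_power in auto)
    qed
    then have f: "?f \<in> ?P" and "h \<in> tri_kernel D \<delta>" unfolding h_eq by (simp_all only: ker_iff)
    have e1: "homogeneous_at D (tri_mon_exp D 1 1) (tri_mon D i)" if "i \<le> ?r" for i
      using homogeneous_at_mon_power[OF that, of 1 1] D(2) by simp
    have "homogeneous_at D (0 + tri_mon_exp D 1 1) (mconst (b 2) * tri_mon D 1 + mconst (- b 1) * tri_mon D 2)"
      using D(2) by (intro homogeneous_at_add homogeneous_at_mult homogeneous_at_mconst e1) auto
    then have hY: "homogeneous_at D (tri_mon_exp D 1 1) ?Y" by (simp add: mconst.hom_uminus)
    have "\<exists>\<nu>. homogeneous_at D \<nu> (?Y ^ s)"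
    proof (induction s)
      case 0
      show ?case using homogeneous_at_mconst[of D 1] by (auto simp: mconst.hom_one)
    next
      case (Suc s)
      then show ?case unfolding power_Suc using homogeneous_at_mult[OF hY] by blast
    qed
    then obtain \<nu>0 where \<nu>0: "homogeneous_at D \<nu>0 (?Y ^ s)" by blast
    obtain \<nu>1 where \<nu>1: "homogeneous_at D \<nu>1 (\<Prod>(i, j)\<in>?K. mvar (TV i j) ^ c i j :: (tvar, 'k) mpoly)"
      using homogeneous_at_variables[where S = ?K and D = D and v = "\<lambda>(i, j). TV i j" and n = "\<lambda>(i, j). c i j"]
      by (auto simp: case_prod_beta)
    obtain \<nu>2 where \<nu>2: "homogeneous_at D \<nu>2 (\<Prod>k=1..tri_m D. mvar (SV k) ^ d k :: (tvar, 'k) mpoly)"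
      using homogeneous_at_variables[where S = "{1..tri_m D}" and D = D and v = SV and n = d] by auto
    have "homogeneous_at D (0 + \<nu>0 + \<nu>1 + \<nu>2) ?f"
      by (intro homogeneous_at_mult homogeneous_at_mconst \<nu>0 \<nu>1 \<nu>2)
    then have "tri_homogeneous D h" unfolding h_eq by (rule tri_homogeneous_cls[OF f])
    with \<open>h \<in> tri_kernel D \<delta>\<close> show ?L by blast
  qed
qed

theorem proposition5:
  fixes D :: "'k::{alg_closed_field, field_char_0} trinomial_data"
  assumes "trinomial_data D" and "tri_r D \<ge> 2"
  shows
    "(\<forall>p \<delta>. 1 \<le> p \<and> p \<le> tri_m D \<and> is_partial_S D p \<delta> \<longrightarrow>
       (\<forall>h\<in>carrier (tri_alg D).
          tri_homogeneous D h \<and> h \<in> tri_kernel D \<delta> \<longleftrightarrow>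
          (\<exists>(F :: (nat, 'k) mpoly) (b :: nat \<Rightarrow> nat \<Rightarrow> nat) (d :: nat \<Rightarrow> nat).
             F \<in> carrier (mpoly_ring {1, 2}) \<and> mhomogeneous F \<and>
             h = tri_cls D (msubst (tri_mon D) F *
                   (\<Prod>(i, j)\<in>tri_indices D. mvar (TV i j) ^ b i j) *
                   (\<Prod>k\<in>{1..tri_m D} - {p}. mvar (SV k) ^ d k)))))
     \<and>
     (\<forall>C \<beta> \<delta>. is_delta D C \<beta> \<delta> \<longrightarrow>
       (\<forall>h\<in>carrier (tri_alg D).
          tri_homogeneous D h \<and> h \<in> tri_kernel D \<delta> \<longleftrightarrow>
          (\<exists>(\<alpha> :: 'k) (s :: nat) (b :: nat \<Rightarrow> nat \<Rightarrow> nat) (d :: nat \<Rightarrow> nat).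
             h = tri_cls D (mconst \<alpha> *
                   (mconst (\<beta> $ 2) * tri_mon D 1 - mconst (\<beta> $ 1) * tri_mon D 2) ^ s *
                   (\<Prod>(i, j)\<in>{(i, j) \<in> tri_indices D. tri_cls D (mvar (TV i j)) \<in> tri_kernel D \<delta>}.
                      mvar (TV i j) ^ b i j) *
                   (\<Prod>k=1..tri_m D. mvar (SV k) ^ d k)))))"
  using kernel_partial_S[OF assms] kernel_delta[OF assms] by simp

end
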